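(* Let $T=[\boldsymbol{v}_1,\boldsymbol{v}_2,\boldsymbol{v}_3]\subset\mathbb{R}^2$ be a nondegenerate triangle, let $S_1,\dots,S_{39}$ be the basis $\mathcal{B}_c$ of the space $\mathcal{S}^3_5$ of $C^3$ piecewise quintics on the Powell-Sabin 12-split of $T$, and let $\boldsymbol{\xi}_1,\dots,\boldsymbol{\xi}_{39}$ be its domain points (see context). The collocation matrix $\big(S_j(\boldsymbol{\xi}_i)\big)_{i,j=1}^{39}$ is nonsingular; i.e., for any real values $y_1,\dots,y_{39}$ there is a unique $s\in\mathcal{S}^3_5$ with $s(\boldsymbol{\xi}_i)=y_i$ for $i=1,\dots,39$.
   Context: Let $\boldsymbol{v}_4=(\boldsymbol{v}_1+\boldsymbol{v}_2)/2$, $\boldsymbol{v}_5=(\boldsymbol{v}_2+\boldsymbol{v}_3)/2$, $\boldsymbol{v}_6=(\boldsymbol{v}_1+\boldsymbol{v}_3)/2$, $\boldsymbol{v}_{10}=(\boldsymbol{v}_1+\boldsymbol{v}_2+\boldsymbol{v}_3)/3$. The Powell-Sabin 12-split of $T$ is the subdivision of $T$ into 12 triangles obtained by drawing all segments connecting pairs among $\boldsymbol{v}_1,\dots,\boldsymbol{v}_6$. $\mathcal{S}^3_5$ is the space of $C^3$ functions on $T$ that are polynomials of total degree at most 5 on each of the 12 triangles; it has dimension 39. Simplex splines: for nonnegative integers $m_1,\dots,m_6$ with sum 8, let $K$ be the multiset containing $\boldsymbol{v}_i$ with multiplicity $m_i$ (and having convex hull of positive area). Choose a nondegenerate simplex $\sigma\subset\mathbb{R}^7$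 whose 8 vertices are mapped onto the elements of $K$ (with multiplicity) by the projection $\pi:\mathbb{R}^7\to\mathbb{R}^2$ onto the first two coordinates, and define $$Q[m_1m_2m_3m_4m_5m_6](\boldsymbol{x})=\frac{\mathrm{area}(T)}{\binom{7}{2}}\cdot\frac{\mathrm{vol}_5(\sigma\cap\pi^{-1}(\boldsymbol{x}))}{\mathrm{vol}_7(\sigma)},\quad \boldsymbol{x}\in T,$$ independent of the choice of $\sigma$. The basis $\mathcal{B}_c=\{S_1,\dots,S_{39}\}$, together with a multiset of five dual points $\{\boldsymbol{p}^*_{j,1},\dots,\boldsymbol{p}^*_{j,5}\}$ for each $S_j$, is the union of the $S_3$-orbits (permutations of $\boldsymbol{v}_1,\boldsymbol{v}_2,\boldsymbol{v}_3$ with the induced permutations of $\boldsymbol{v}_4,\boldsymbol{v}_5,\boldsymbol{v}_6$, acting simultaneously on the function and its dual points) of: $\frac14Q[600101]$ with $\{\boldsymbol{v}_1,\boldsymbol{v}_1,\boldsymbol{v}_1,\boldsymbol{v}_1,\boldsymbol{v}_1\}$; $\frac14Q[500201]$ with $\{\boldsymbol{v}_1,\boldsymbol{v}_1,\boldsymbol{v}_1,\boldsymbol{v}_1,\boldsymbol{v}_4\}$; $\frac12Q[410201]$ with $\{\boldsymbol{v}_1,\boldsymbol{v}_1,\boldsymbol{v}_1,\boldsymbol{v}_4,\boldsymbol{v}_4\}$; $\frac12Q[320201]$ with $\{\boldsymbol{v}_1,\boldsymbol{v}_1,\boldsymbol{v}_2,\boldsymbol{v}_4,\boldsymbol{v}_4\}$;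 $\frac34Q[220211]$ with $\{\boldsymbol{v}_1,\boldsymbol{v}_2,\boldsymbol{v}_4,\boldsymbol{v}_4,\boldsymbol{v}_{10}\}$; $Q[141110]$ with $\{\boldsymbol{v}_2,\boldsymbol{v}_2,\boldsymbol{v}_2,\boldsymbol{v}_4,\boldsymbol{v}_5\}$; $\frac12Q[131210]$ with $\{\boldsymbol{v}_1,\boldsymbol{v}_2,\boldsymbol{v}_2,\boldsymbol{v}_4,\boldsymbol{v}_5\}$; $\frac34Q[121211]$ with $\{\boldsymbol{v}_1,\boldsymbol{v}_2,\boldsymbol{v}_4,\boldsymbol{v}_5,\boldsymbol{v}_{10}\}$. The domain points are $\boldsymbol{\xi}_j=\frac15\sum_{r=1}^5\boldsymbol{p}^*_{j,r}$. *)

theory Defs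
  imports "HOL-Analysis.Analysis" "HOL-Combinatorics.Permutations"
begin

text \<open>A triangle is given by \<open>v 1, v 2, v 3\<close>; other values of \<open>v\<close> are never used.\<close>

definition macro_triangle :: "(nat \<Rightarrow> real^2) \<Rightarrow> (real^2) set" where
  "macro_triangle v = convex hull {v 1, v 2, v 3}"

definition ps_point :: "(nat \<Rightarrow> real^2) \<Rightarrow> nat \<Rightarrow> real^2" where
  "ps_point v i =
    (if i = 4 then midpoint (v 1) (v 2)
     else if i = 5 then midpoint (v 2) (v 3)
     else if i = 6 then midpoint (v 1) (v 3)
     else if i = 10 then (1/3) *\<^sub>R (v 1 + v 2 + v 3)
     else v i)"

text \<open>The faces of the split are the closures of the regions into which the segments
  (which cover the sides of the triangle) cut the triangle.\<close>

definition ps12_segments :: "(nat \<Rightarrow> real^2) \<Rightarrow> (real^2) set" where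
  "ps12_segments v =
    (\<Union>i\<in>{1..6}. \<Union>j\<in>{1..6}. closed_segment (ps_point v i) (ps_point v j))"

definition ps12_split :: "(nat \<Rightarrow> real^2) \<Rightarrow> (real^2) set set" where
  "ps12_split v = closure ` components (macro_triangle v - ps12_segments v)"

text \<open>On sets with boundary, derivatives are taken relative to the set.\<close>

primrec C_k_on :: "nat \<Rightarrow> ('a::euclidean_space \<Rightarrow> real) \<Rightarrow> 'a set \<Rightarrow> bool" where
  "C_k_on 0 f X \<longleftrightarrow> continuous_on X f"
| "C_k_on (Suc k) f X \<longleftrightarrow>
    (\<exists>f'. (\<forall>x\<in>X. (f has_derivative f' x) (at x within X)) \<and>
          (\<forall>b\<in>Basis. C_k_on k (\<lambda>x. f' x b) X))"

definition poly_deg_le_on :: "nat \<Rightarrow> (real^2 \<Rightarrow> real) \<Rightarrow> (real^2) set \<Rightarrow> bool" where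
  "poly_deg_le_on d f X \<longleftrightarrow>
    (\<exists>c :: nat \<Rightarrow> nat \<Rightarrow> real. \<forall>x\<in>X. f x = (\<Sum>i\<le>d. \<Sum>j\<le>d-i. c i j * (x$1)^i * (x$2)^j))"

text \<open>Functions on the triangle are represented by extensional functions, so that
  equality of representatives is equality on the triangle.\<close>

definition spline_space :: "(nat \<Rightarrow> real^2) \<Rightarrow> (real^2 \<Rightarrow> real) set" where
  "spline_space v = {s \<in> extensional (macro_triangle v).
     C_k_on 3 s (macro_triangle v) \<and> (\<forall>\<tau>\<in>ps12_split v. poly_deg_le_on 5 s \<tau>)}"

definition knots :: "(nat \<Rightarrow> real^2) \<Rightarrow> nat list \<Rightarrow> (real^2) multiset" where
  "knots v m = (\<Sum>i<6. replicate_mset (m ! i) (ps_point v (Suc i)))"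

text \<open>\<open>\<real>\<^sup>7\<close> is \<open>\<real>\<^sup>2 \<times> \<real>\<^sup>5\<close>, so the projection is \<^const>\<open>fst\<close> and the fibre over \<open>x\<close> is
  identified with a subset of \<open>\<real>\<^sup>5\<close>.\<close>

definition lifts :: "(real^2) multiset \<Rightarrow> ((real^2) \<times> (real^5)) set \<Rightarrow> bool" where
  "lifts K \<sigma> \<longleftrightarrow> 7 simplex \<sigma> \<and> image_mset fst (mset_set {w. w extreme_point_of \<sigma>}) = K"

definition simplex_spline :: "(nat \<Rightarrow> real^2) \<Rightarrow> nat list \<Rightarrow> real^2 \<Rightarrow> real" where
  "simplex_spline v m x =
    (let \<sigma> = (SOME \<sigma>. lifts (knots v m) \<sigma>)
     in measure lborel (macro_triangle v) / real (7 choose 2)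
        * (measure lborel {y. (x, y) \<in> \<sigma>} / measure lborel \<sigma>))"

definition basis_generators :: "(real \<times> nat list \<times> nat multiset) set" where
  "basis_generators =
    {(1/4, [6,0,0,1,0,1], {#1,1,1,1,1#}),
     (1/4, [5,0,0,2,0,1], {#1,1,1,1,4#}),
     (1/2, [4,1,0,2,0,1], {#1,1,1,4,4#}),
     (1/2, [3,2,0,2,0,1], {#1,1,2,4,4#}),
     (3/4, [2,2,0,2,1,1], {#1,2,4,4,10#}),
     (1,   [1,4,1,1,1,0], {#2,2,2,4,5#}),
     (1/2, [1,3,1,2,1,0], {#1,2,2,4,5#}),
     (3/4, [1,2,1,2,1,1], {#1,2,4,5,10#})}"

text \<open>Relabelling the vertices to \<open>v \<circ> p\<close> permutes the midpoints accordingly.\<close>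

definition spline_basis ::
  "(nat \<Rightarrow> real^2) \<Rightarrow> ((real^2 \<Rightarrow> real) \<times> (real^2) multiset) set" where
  "spline_basis v =
    {(\<lambda>x\<in>macro_triangle v. c * simplex_spline (v \<circ> p) m x, image_mset (ps_point (v \<circ> p)) d) | c m d p.
       (c, m, d) \<in> basis_generators \<and> p permutes {1,2,3}}"

definition domain_point :: "(real^2) multiset \<Rightarrow> real^2" where
  "domain_point d = (1/5) *\<^sub>R \<Sum>\<^sub># d"

text \<open>The basis has exactly 39 elements, so that enumerations of it by the type \<open>39\<close> exist.
  This is shown by counting at the level of the labels \<open>1,\<dots>,6,10\<close>.\<close>

definition relabel :: "nat list \<Rightarrow> nat \<Rightarrow> nat" where
  "relabel q i = (let mid = (\<lambda>a b. if a + b = 3 then 4 else if a + b = 5 then 5 else 6) in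
     if i = 4 then mid (q ! 0) (q ! 1) else if i = 5 then mid (q ! 1) (q ! 2)
     else if i = 6 then mid (q ! 0) (q ! 2) else if i = 10 then 10 else q ! (i - 1))"

definition label_perms :: "nat list list" where
  "label_perms = [[1,2,3],[1,3,2],[2,1,3],[2,3,1],[3,1,2],[3,2,1]]"

definition label_gens :: "(nat \<times> nat list \<times> nat list) list" where
  "label_gens =
    [(1, [6,0,0,1,0,1], [1,1,1,1,1]),
     (1, [5,0,0,2,0,1], [1,1,1,1,4]),
     (2, [4,1,0,2,0,1], [1,1,1,4,4]),
     (2, [3,2,0,2,0,1], [1,1,2,4,4]),
     (3, [2,2,0,2,1,1], [1,2,4,4,10]),
     (4, [1,4,1,1,1,0], [2,2,2,4,5]),
     (2, [1,3,1,2,1,0], [1,2,2,4,5]),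
     (3, [1,2,1,2,1,1], [1,2,4,5,10])]"

definition knot_labels :: "nat list \<Rightarrow> nat list" where
  "knot_labels m = concat (map (\<lambda>i. replicate (m ! i) (Suc i)) [0..<6])"

definition relabel_gen :: "nat list \<Rightarrow> nat \<times> nat list \<times> nat list \<Rightarrow> nat \<times> nat list \<times> nat list" where
  "relabel_gen q = (\<lambda>(n, m, d).
     (n, sort (map (relabel q) (knot_labels m)), sort (map (relabel q) d)))"

definition label_basis :: "(nat \<times> nat list \<times> nat list) list" where
  "label_basis = concat (map (\<lambda>q. map (relabel_gen q) label_gens) label_perms)"

definition labels_spline :: "(nat \<Rightarrow> real^2) \<Rightarrow> nat \<times> nat list \<times> nat list
     \<Rightarrow> (real^2 \<Rightarrow> real) \<times> (real^2) multiset" where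
  "labels_spline v = (\<lambda>(n, k, d).
    (\<lambda>x\<in>macro_triangle v. real n / 4 *
      (let \<sigma> = (SOME \<sigma>. lifts (mset (map (ps_point v) k)) \<sigma>)
       in measure lborel (macro_triangle v) / real (7 choose 2)
        * (measure lborel {y. (x, y) \<in> \<sigma>} / measure lborel \<sigma>)),
     mset (map (ps_point v) d)))"

lemma card_label_basis: "card (set label_basis) = 39"
proof -
  have "length (remdups label_basis) = 39" by code_simp
  then show ?thesis by (simp add: length_remdups_card_conv)
qed

lemma card_label_duals: "card ((snd \<circ> snd) ` set label_basis) = 39"
proof -
  have "length (remdups (map (snd \<circ> snd) label_basis)) = 39" by code_simp
  then show ?thesis by (simp add: length_remdups_card_conv)
qed

lemma label_basis_duals:
  "\<forall>(n, k, d) \<in> set label_basis. sorted d \<and> set d \<subseteq> {1,2,3,4,5,6,10}"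
proof -
  have "list_all (\<lambda>(n, k, d). sorted d \<and> list_all (\<lambda>i. List.member [1,2,3,4,5,6,10] i) d) label_basis"
    by code_simp
  then show ?thesis by (fastforce simp: list_all_iff List.member_iff)
qed

lemma ps_point_relabel:
  assumes "q \<in> set label_perms" "q = [p 1, p 2, p 3]" "i \<in> {1,2,3,4,5,6,10}"
  shows "ps_point (v \<circ> p) i = ps_point v (relabel q i)"
proof -
  have "(p 1, p 2, p 3) \<in> {(1,2,3),(1,3,2),(2,1,3),(2,3,1),(3,1,2),(3,2,1)}"
    using assms(1,2) by (auto simp: label_perms_def)
  then have p: "p 1 = 1 \<and> p 2 = 2 \<and> p 3 = 3 \<or> p 1 = 1 \<and> p 2 = 3 \<and> p 3 = 2 \<or>
      p 1 = 2 \<and> p 2 = 1 \<and> p 3 = 3 \<or> p 1 = 2 \<and> p 2 = 3 \<and> p 3 = 1 \<or>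
      p 1 = 3 \<and> p 2 = 1 \<and> p 3 = 2 \<or> p 1 = 3 \<and> p 2 = 2 \<and> p 3 = 1"
    by (simp only: insert_iff empty_iff prod.inject simp_thms)
  have i: "i = 1 \<or> i = 2 \<or> i = 3 \<or> i = 4 \<or> i = 5 \<or> i = 6 \<or> i = 10"
    using assms(3) by simp
  show ?thesis unfolding assms(2)
    using p i by (elim disjE conjE; simp add: ps_point_def relabel_def Let_def midpoint_sym add_ac)
qed

lemma knots_relabel:
  assumes "q \<in> set label_perms" "q = [p 1, p 2, p 3]"
  shows "knots (v \<circ> p) m = mset (map (ps_point v) (sort (map (relabel q) (knot_labels m))))"
proof -
  have "ps_point (v \<circ> p) i = ps_point v (relabel q i)" if "i \<in> {1,2,3,4,5,6}" for i
    using that by (intro ps_point_relabel[OF assms]) auto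
  then show ?thesis
    by (simp add: knots_def knot_labels_def eval_nat_numeral lessThan_Suc add_ac)
qed

lemma perm_labels:
  "(\<lambda>p. [p 1, p 2, p 3]) ` {p. p permutes {1,2,3::nat}} = set label_perms"
proof (intro equalityI subsetI)
  fix q assume "q \<in> (\<lambda>p. [p 1, p 2, p 3]) ` {p. p permutes {1,2,3::nat}}"
  then obtain p where p: "p permutes {1,2,3::nat}" and q: "q = [p 1, p 2, p 3]" by auto
  have "p 1 \<in> {1,2,3}" "p 2 \<in> {1,2,3}" "p 3 \<in> {1,2,3}"
    using permutes_in_image[OF p] by blast+
  moreover have "p 1 \<noteq> p 2" "p 1 \<noteq> p 3" "p 2 \<noteq> p 3"
    by (simp_all add: inj_eq[OF permutes_inj[OF p]])
  ultimately show "q \<in> set label_perms" unfolding q label_perms_def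
    by (simp only: insert_iff empty_iff simp_thms) (elim disjE; simp)
next
  fix q assume q: "q \<in> set label_perms"
  define p where "p i = (if i \<in> {1,2,3} then q ! (i - 1) else i)" for i
  have "bij_betw p {1,2,3} {1,2,3}"
  proof -
    have "q = [1,2,3] \<or> q = [1,3,2] \<or> q = [2,1,3] \<or> q = [2,3,1] \<or> q = [3,1,2] \<or> q = [3,2,1]"
      using q by (simp add: label_perms_def)
    moreover have "{2, 1, 3} = {1, 2, 3::nat}" "{1, 3, 2} = {1, 2, 3::nat}" "{2, 3, 1} = {1, 2, 3::nat}"
      "{3, 1, 2} = {1, 2, 3::nat}" "{3, 2, 1} = {1, 2, 3::nat}" by blast+
    ultimately show ?thesis
      by (elim disjE; simp add: p_def bij_betw_def inj_on_def)
  qed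
  then have "p permutes {1,2,3}"
    by (rule bij_imp_permutes) (auto simp: p_def)
  moreover have "q = [p 1, p 2, p 3]"
    using q by (auto simp: label_perms_def p_def)
  ultimately show "q \<in> (\<lambda>p. [p 1, p 2, p 3]) ` {p. p permutes {1,2,3::nat}}" by blast
qed

lemma triangle_permute:
  assumes "p permutes {1,2,3}"
  shows "macro_triangle (v \<circ> p) = macro_triangle v"
proof -
  have "{(v \<circ> p) 1, (v \<circ> p) 2, (v \<circ> p) 3} = v ` p ` {1,2,3}" by simp
  also have "\<dots> = {v 1, v 2, v 3}" using permutes_image[OF assms] by simp
  finally show ?thesis by (simp add: macro_triangle_def)
qed

lemma basis_generators_labels:
  "basis_generators = (\<lambda>(n, m, d). (real n / 4, m, mset d)) ` set label_gens"
  by (simp add: basis_generators_def label_gens_def)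

lemma label_gens_duals: "(n, m, d) \<in> set label_gens \<Longrightarrow> set d \<subseteq> {1,2,3,4,5,6,10}"
  by (auto simp: label_gens_def)

lemma labels_spline_relabel:
  assumes "(n, m, d) \<in> set label_gens" "p permutes {1,2,3}"
  shows "labels_spline v (relabel_gen [p 1, p 2, p 3] (n, m, d)) =
    (\<lambda>x\<in>macro_triangle v. real n / 4 * simplex_spline (v \<circ> p) m x, image_mset (ps_point (v \<circ> p)) (mset d))"
proof -
  let ?q = "[p 1, p 2, p 3]"
  have q: "?q \<in> set label_perms" using perm_labels assms(2) by blast
  have "image_mset (ps_point (v \<circ> p)) (mset d) = image_mset (ps_point v) (mset (map (relabel ?q) d))"
    using label_gens_duals[OF assms(1)] ps_point_relabel[OF q refl]
    by (auto simp: multiset.map_comp intro!: image_mset_cong)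
  then show ?thesis
    by (simp add: labels_spline_def relabel_gen_def simplex_spline_def
        triangle_permute[OF assms(2)] knots_relabel[OF q refl])
qed

lemma spline_basis_labels: "spline_basis v = labels_spline v ` set label_basis"
proof -
  have "spline_basis v = (\<Union>p\<in>{p. p permutes {1,2,3}}. \<Union>g\<in>set label_gens.
      {labels_spline v (relabel_gen [p 1, p 2, p 3] g)})"
    unfolding spline_basis_def basis_generators_labels
  proof (intro equalityI subsetI)
    fix z assume "z \<in> {(\<lambda>x\<in>macro_triangle v. c * simplex_spline (v \<circ> p) m x, image_mset (ps_point (v \<circ> p)) d) | c m d p.
       (c, m, d) \<in> (\<lambda>(n, m, d). (real n / 4, m, mset d)) ` set label_gens \<and> p permutes {1,2,3}}"
    then obtain n m d p where g: "(n, m, d) \<in> set label_gens" and p: "p permutes {1,2,3}"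
      and z: "z = (\<lambda>x\<in>macro_triangle v. real n / 4 * simplex_spline (v \<circ> p) m x, image_mset (ps_point (v \<circ> p)) (mset d))"
      by clarsimp
    then show "z \<in> (\<Union>p\<in>{p. p permutes {1,2,3}}. \<Union>g\<in>set label_gens.
        {labels_spline v (relabel_gen [p 1, p 2, p 3] g)})"
      using labels_spline_relabel[OF g p, of v] by blast
  next
    fix z assume "z \<in> (\<Union>p\<in>{p. p permutes {1,2,3}}. \<Union>g\<in>set label_gens.
        {labels_spline v (relabel_gen [p 1, p 2, p 3] g)})"
    then obtain p n m d where g: "(n, m, d) \<in> set label_gens" and p: "p permutes {1,2,3}"
      and z: "z = labels_spline v (relabel_gen [p 1, p 2, p 3] (n, m, d))"
      by auto
    have "(real n / 4, m, mset d) \<in> (\<lambda>(n, m, d). (real n / 4, m, mset d)) ` set label_gens"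
      using g by force
    then show "z \<in> {(\<lambda>x\<in>macro_triangle v. c * simplex_spline (v \<circ> p) m x, image_mset (ps_point (v \<circ> p)) d) | c m d p.
       (c, m, d) \<in> (\<lambda>(n, m, d). (real n / 4, m, mset d)) ` set label_gens \<and> p permutes {1,2,3}}"
      using p z labels_spline_relabel[OF g p, of v] by blast
  qed
  also have "\<dots> = (\<Union>q\<in>set label_perms. \<Union>g\<in>set label_gens. {labels_spline v (relabel_gen q g)})"
    unfolding perm_labels[symmetric] by auto
  also have "\<dots> = labels_spline v ` set label_basis"
    by (simp only: label_basis_def set_concat set_map image_UN image_image UNION_singleton_eq_range)
  finally show ?thesis .
qed

lemma noncollinear_det:
  fixes a b c :: "real^2"
  assumes "\<not> collinear {a, b, c}"
  shows "(b$1 - a$1) * (c$2 - a$2) - (b$2 - a$2) * (c$1 - a$1) \<noteq> 0"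
proof
  assume 0: "(b$1 - a$1) * (c$2 - a$2) - (b$2 - a$2) * (c$1 - a$1) = 0"
  have "a \<noteq> b" using assms by auto
  then have "\<not> (b$1 - a$1 = 0 \<and> b$2 - a$2 = 0)" by (auto simp: vec_eq_iff forall_2)
  then obtain t where "c$1 - a$1 = t * (b$1 - a$1)" "c$2 - a$2 = t * (b$2 - a$2)"
  proof (cases "b$1 - a$1 = 0")
    case True
    with 0 that[of "(c$2 - a$2) / (b$2 - a$2)"] \<open>\<not> (b$1 - a$1 = 0 \<and> b$2 - a$2 = 0)\<close>
    show ?thesis by auto
  next
    case False
    with 0 that[of "(c$1 - a$1) / (b$1 - a$1)"] show ?thesis by (auto simp: field_simps)
  qed
  then have "c = a + t *\<^sub>R (b - a)" by (simp add: vec_eq_iff forall_2 algebra_simps)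
  then have "\<forall>x\<in>{a, b, c}. \<exists>s. x = a + s *\<^sub>R (b - a)"
    by (auto intro: exI[of _ "0::real"] exI[of _ "1::real"])
  then show False using assms unfolding collinear_alt by blast
qed

lemma inj_ps_point:
  assumes "\<not> collinear {v 1, v 2, v 3}"
  shows "inj_on (ps_point v) {1,2,3,4,5,6,10}"
proof -
  define s t :: "nat \<Rightarrow> real" where
    "s i = (if i = 2 then 1 else if i = 4 \<or> i = 5 then 1/2 else if i = 10 then 1/3 else 0)" and
    "t i = (if i = 3 then 1 else if i = 5 \<or> i = 6 then 1/2 else if i = 10 then 1/3 else 0)" for i
  let ?D = "(v 2$1 - v 1$1) * (v 3$2 - v 1$2) - (v 2$2 - v 1$2) * (v 3$1 - v 1$1)"
  have D: "?D \<noteq> 0" by (rule noncollinear_det[OF assms])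
  have coords: "ps_point v i $ k = v 1 $ k + s i * (v 2 $ k - v 1 $ k) + t i * (v 3 $ k - v 1 $ k)"
    if "i \<in> {1,2,3,4,5,6,10}" for i k
    using that by (auto simp: ps_point_def midpoint_def s_def t_def field_simps)
  have st: "s i = s j \<and> t i = t j"
    if ij: "i \<in> {1,2,3,4,5,6,10}" "j \<in> {1,2,3,4,5,6,10}" "ps_point v i = ps_point v j" for i j
  proof -
    have 1: "(s i - s j) * (v 2 $ k - v 1 $ k) + (t i - t j) * (v 3 $ k - v 1 $ k) = 0" for k
      using coords[OF ij(1), of k] coords[OF ij(2), of k] ij(3) by (simp add: algebra_simps)
    have "(s i - s j) * ?D = 0" "(t i - t j) * ?D = 0"
      using 1[of 1] 1[of 2] by algebra+
    with D show ?thesis by simp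
  qed
  show ?thesis
  proof (rule inj_onI)
    fix i j assume ij: "i \<in> {1,2,3,4,5,6,10}" "j \<in> {1,2,3,4,5,6,10}" "ps_point v i = ps_point v j"
    have "s i = s j \<and> t i = t j" by (rule st[OF ij])
    then show "i = j" using ij(1,2)
      by (simp only: insert_iff empty_iff simp_thms) (elim disjE; simp add: s_def t_def)
  qed
qed

lemma sorted_map_mset_inj:
  assumes "inj_on f A" "set xs \<subseteq> A" "set ys \<subseteq> A" "sorted xs" "sorted ys"
    "mset (map f xs) = mset (map f ys)"
  shows "xs = (ys :: nat list)"
proof -
  have "mset (map (inv_into A f) (map f xs)) = mset (map (inv_into A f) (map f ys))"
    using assms(6) by (metis mset_map)
  moreover have "map (inv_into A f) (map f zs) = zs" if "set zs \<subseteq> A" for zs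
    using that assms(1) by (induction zs) auto
  ultimately have "mset xs = mset ys" using assms(2,3) by metis
  then show ?thesis using assms(4,5) by (metis properties_for_sort sorted_sort_id)
qed

lemma card_spline_basis:
  assumes "\<not> collinear {v 1, v 2, v 3}"
  shows "card (spline_basis v) = 39"
proof -
  have inj: "inj_on (snd \<circ> snd) (set label_basis)"
    by (rule eq_card_imp_inj_on[OF finite_set]) (simp only: card_label_basis card_label_duals)
  have "inj_on (labels_spline v) (set label_basis)"
  proof (rule inj_onI)
    fix x y assume x: "x \<in> set label_basis" and y: "y \<in> set label_basis"
      and e: "labels_spline v x = labels_spline v y"
    have "mset (map (ps_point v) (snd (snd x))) = mset (map (ps_point v) (snd (snd y)))"
      using arg_cong[OF e, of snd] by (simp add: labels_spline_def split_beta)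
    moreover have "sorted (snd (snd z)) \<and> set (snd (snd z)) \<subseteq> {1,2,3,4,5,6,10}"
      if "z \<in> set label_basis" for z
      using bspec[OF label_basis_duals that] by (simp only: case_prod_beta)
    ultimately have "snd (snd x) = snd (snd y)"
      using sorted_map_mset_inj[OF inj_ps_point[OF assms]] x y by blast
    then show "x = y" using inj_onD[OF inj _ x y] by simp
  qed
  then show ?thesis by (simp add: spline_basis_labels card_image card_label_basis)
qed

end

theory Submission
  imports Defs
begin

text \<open>
  Both claims reduce to one determinant, because neither depends on how the basis functions are
  scaled by positive factors.

  Up to such a factor, a simplex spline at \<open>x\<close> is the volume of the set of convex weights that
  represent \<open>x\<close> by the knots. Solving for the weights of three affinely independent knots turns
  this set into a polytope in \<open>\<real>\<^sup>5\<close> given by five sign conditions and three linear inequalities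
  (\<open>fibre_measure\<close>), and its volume is found by adding the five remaining knots one at a time,
  each costing one integration of truncated powers (\<open>cone_vol_step\<close>). In barycentric
  coordinates each of the eight generators thus becomes an explicit homogeneous expression of
  degree five, its profile (\<open>spline_profile\<close>).

  The six lines on which the interior edges of the split lie run from side to side of the triangle, so truncated
  fourth powers of the corresponding affine functions are splines. Together with the quintic
  polynomials, their products with affine functions fill the whole spline space: across each edge
  two neighbouring polynomial pieces differ by the fourth power of the edge times an affine
  cofactor (\<open>smooth_join\<close>), going once around the barycentre shows that the cofactors at the two
  ends of each median agree (\<open>centre_cofactor_eq\<close>), and the median through a corner contributes nothing
  new there (\<open>corner_cofactor_eq\<close>). This exhibits \<open>21 + 6 \<cdot> 3 = 39\<close> functions spanning
  the space (\<open>spline_imp_truncated_span\<close>), and the profiles lie in that span.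

  At the domain points, whose barycentric coordinates are multiples of \<open>1/30\<close>, the profiles take integer
  values up to a common factor. This integer matrix has an inverse modulo 7
  (\<open>colloc_inv_mod7\<close>), so the collocation matrix is nonsingular. It factors through the values of the 39
  spanning functions at the domain points; that factor is nonsingular too, so
  a spline that vanishes at all domain points is zero, and interpolation is uniquely solvable.
\<close>

section \<open>Fibres of a simplex\<close>

text \<open>Vertices are indexed rather than collected in a set, so that the five free weights and the
  three eliminated ones can be addressed by the two halves of a sum type.\<close>

lemma convex_hull_range:
  fixes W :: "'k::finite \<Rightarrow> 'a::euclidean_space"
  assumes "inj W"
  shows "convex hull (range W) = {\<Sum>k\<in>UNIV. l k *\<^sub>R W k | l. (\<forall>k. 0 \<le> l k) \<and> sum l UNIV = 1}"
proof (intro equalityI subsetI)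
  fix z assume "z \<in> convex hull (range W)"
  then obtain u where u: "\<forall>x\<in>range W. 0 \<le> u x" "sum u (range W) = 1" "(\<Sum>x\<in>range W. u x *\<^sub>R x) = z"
    by (auto simp: convex_hull_finite)
  have "sum (u \<circ> W) UNIV = 1" "(\<Sum>k\<in>UNIV. (u \<circ> W) k *\<^sub>R W k) = z"
    using u(2,3) by (simp_all add: sum.reindex[OF assms] o_def)
  then show "z \<in> {\<Sum>k\<in>UNIV. l k *\<^sub>R W k | l. (\<forall>k. 0 \<le> l k) \<and> sum l UNIV = 1}"
    using u(1) by force
next
  fix z assume "z \<in> {\<Sum>k\<in>UNIV. l k *\<^sub>R W k | l. (\<forall>k. 0 \<le> l k) \<and> sum l UNIV = 1}"
  then obtain l where "\<forall>k. 0 \<le> l k" "sum l UNIV = 1" and z: "z = (\<Sum>k\<in>UNIV. l k *\<^sub>R W k)" by auto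
  then show "z \<in> convex hull (range W)"
    unfolding z by (intro convex_sum) (auto simp: hull_inc)
qed

lemma affine_independent_range:
  fixes W :: "'k::finite \<Rightarrow> 'a::euclidean_space"
  assumes "inj W"
  shows "\<not> affine_dependent (range W) \<longleftrightarrow>
    (\<forall>l. sum l UNIV = 0 \<longrightarrow> (\<Sum>k\<in>UNIV. l k *\<^sub>R W k) = 0 \<longrightarrow> (\<forall>k. l k = 0))"
proof -
  have "affine_dependent (range W) \<longleftrightarrow>
    (\<exists>u. sum (u \<circ> W) UNIV = 0 \<and> (\<exists>k. (u \<circ> W) k \<noteq> 0) \<and> (\<Sum>k\<in>UNIV. (u \<circ> W) k *\<^sub>R W k) = 0)"
    by (simp add: affine_dependent_explicit_finite sum.reindex[OF assms] o_def)
  also have "\<dots> \<longleftrightarrow> (\<exists>l. sum l UNIV = 0 \<and> (\<exists>k. l k \<noteq> 0) \<and> (\<Sum>k\<in>UNIV. l k *\<^sub>R W k) = 0)"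
  proof
    assume "\<exists>l. sum l UNIV = 0 \<and> (\<exists>k. l k \<noteq> 0) \<and> (\<Sum>k\<in>UNIV. l k *\<^sub>R W k) = 0"
    then obtain l where "sum l UNIV = 0 \<and> (\<exists>k. l k \<noteq> 0) \<and> (\<Sum>k\<in>UNIV. l k *\<^sub>R W k) = 0" by blast
    moreover have "(l \<circ> inv W) \<circ> W = l" using assms by (simp add: o_assoc[symmetric])
    ultimately show "\<exists>u. sum (u \<circ> W) UNIV = 0 \<and> (\<exists>k. (u \<circ> W) k \<noteq> 0) \<and> (\<Sum>k\<in>UNIV. (u \<circ> W) k *\<^sub>R W k) = 0"
      by metis
  qed blast
  finally show ?thesis by auto
qed

lemma image_mset_lift:
  assumes "finite S" "image_mset f M = image_mset h (mset_set S)"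
  shows "\<exists>w. M = image_mset w (mset_set S) \<and> (\<forall>i\<in>S. f (w i) = h i)"
  using assms
proof (induction S arbitrary: M rule: finite_induct)
  case empty then show ?case by simp
next
  case (insert i S)
  then have "image_mset f M = add_mset (h i) (image_mset h (mset_set S))" by simp
  then obtain N b where N: "M = add_mset b N" "f b = h i" "image_mset f N = image_mset h (mset_set S)"
    by (metis msed_map_invR)
  obtain w where w: "N = image_mset w (mset_set S)" "\<forall>j\<in>S. f (w j) = h j"
    using insert.IH[OF N(3)] by blast
  have "image_mset (w(i := b)) (mset_set S) = image_mset w (mset_set S)"
    using insert.hyps by (intro image_mset_cong) auto
  then have "M = image_mset (w(i := b)) (mset_set (insert i S))"
    using N(1) w(1) insert.hyps by simp
  moreover have "\<forall>j\<in>insert i S. f ((w(i := b)) j) = h j"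
    using N(2) w(2) by simp
  ultimately show ?case by blast
qed

text \<open>The vertex set determines the simplex, and the multiset equation of the projections lets the vertices
  be indexed so that each lies over a prescribed knot even when knots coincide.\<close>

lemma lifts_vertices:
  fixes \<kappa> :: "5 + 3 \<Rightarrow> real^2"
  assumes "lifts (image_mset \<kappa> (mset_set UNIV)) \<sigma>"
  obtains W where "inj W" "\<sigma> = convex hull (range W)" "\<not> affine_dependent (range W)" "\<And>k. fst (W k) = \<kappa> k"
proof -
  obtain C where C: "\<not> affine_dependent C" "int (card C) = 7 + 1" "\<sigma> = convex hull C"
    using assms by (auto simp: lifts_def simplex)
  have "{w. w extreme_point_of \<sigma>} = C"
    using extreme_point_of_convex_hull_affine_independent[OF C(1)] C(3) by auto
  with assms have "image_mset fst (mset_set C) = image_mset \<kappa> (mset_set UNIV)"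
    by (simp add: lifts_def)
  then obtain W where W: "mset_set C = image_mset W (mset_set UNIV)" "\<forall>i\<in>UNIV. fst (W i) = \<kappa> i"
    using image_mset_lift[where f = fst and M = "mset_set C" and h = \<kappa> and S = UNIV, OF finite] by blast
  have "finite C" using C(1) by (simp add: aff_independent_finite)
  then have "C = range W" using arg_cong[OF W(1), of set_mset] by simp
  moreover have "card (range W) = card (UNIV :: (5+3) set)"
    using C(2) \<open>C = range W\<close> by (simp add: card_UNIV_sum)
  then have "inj W" by (intro eq_card_imp_inj_on) auto
  with \<open>C = range W\<close> show ?thesis using C W(2) by (intro that[of W]) simp_all
qed

text \<open>The weights of the three knots \<open>a j\<close> are determined by the five other weights, so the fibre
  over \<open>x\<close> is an injective affine image of a polytope of free weights. The linear part does not
  depend on \<open>x\<close>, hence neither does the Jacobian \<open>C\<close>. The factors \<open>s i\<close> rescale the free weights, which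
  later clears the denominators of the midpoints.\<close>

lemma fibre_measure:
  fixes a :: "3 \<Rightarrow> real^2" and h :: "5 \<Rightarrow> real^2" and A :: "3 \<Rightarrow> real^2 \<Rightarrow> real" and s :: "5 \<Rightarrow> real"
  assumes lift: "lifts (image_mset (case_sum h a) (mset_set UNIV)) \<sigma>"
    and A1: "\<And>x. (\<Sum>j\<in>UNIV. A j x) = 1" and Ax: "\<And>x. (\<Sum>j\<in>UNIV. A j x *\<^sub>R a j) = x"
    and Au: "\<And>u. sum u UNIV = 1 \<Longrightarrow> (\<And>j. A j (\<Sum>j\<in>UNIV. u j *\<^sub>R a j) = u j)"
    and s: "\<And>i. s i > 0"
  shows "\<exists>C>0. \<forall>x. measure lborel {y. (x, y) \<in> \<sigma>} =
    C * measure lborel {\<mu>. (\<forall>i. 0 \<le> \<mu> $ i) \<and> (\<forall>j. 0 \<le> A j x - (\<Sum>i\<in>UNIV. \<mu> $ i * (s i * A j (h i))))}"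
proof -
  obtain W where W: "inj W" "\<sigma> = convex hull (range W)" "\<not> affine_dependent (range W)"
    "\<And>k. fst (W k) = case_sum h a k"
    using lifts_vertices[OF lift] by metis
  note split = UNIV_Plus_UNIV[symmetric] sum.Plus[OF finite finite]
  define Y where "Y i = snd (W (Inl i))" for i
  define Z where "Z j = snd (W (Inr j))" for j
  have WY: "W (Inl i) = (h i, Y i)" "W (Inr j) = (a j, Z j)" for i j
    using W(4) by (simp_all add: Y_def Z_def prod_eq_iff)
  define L where "L \<mu> = (\<Sum>i\<in>UNIV. (\<mu> $ i * s i) *\<^sub>R (Y i - (\<Sum>j\<in>UNIV. A j (h i) *\<^sub>R Z j)))" for \<mu> :: "real^5"
  define y0 where "y0 x = (\<Sum>j\<in>UNIV. A j x *\<^sub>R Z j)" for x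
  define P where "P x = {\<mu>::real^5. (\<forall>i. 0 \<le> \<mu> $ i) \<and> (\<forall>j. 0 \<le> A j x - (\<Sum>i\<in>UNIV. \<mu> $ i * (s i * A j (h i))))}" for x
  have L: "linear L"
    by (rule linearI) (simp_all add: L_def sum.distrib[symmetric] scaleR_sum_right algebra_simps)
  \<comment> \<open>the weights with given free part that represent x\<close>
  have combo: "(\<Sum>i\<in>UNIV. (\<mu> $ i * s i) *\<^sub>R W (Inl i)) + (\<Sum>j\<in>UNIV. (A j x - (\<Sum>i\<in>UNIV. \<mu> $ i * (s i * A j (h i)))) *\<^sub>R W (Inr j))
     = (x, y0 x + L \<mu>)" for \<mu> x
  proof -
    have swap: "(\<Sum>j\<in>UNIV. (A j x - (\<Sum>i\<in>UNIV. \<mu> $ i * (s i * A j (h i)))) *\<^sub>R q j) =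
      (\<Sum>j\<in>UNIV. A j x *\<^sub>R q j) - (\<Sum>i\<in>UNIV. (\<mu> $ i * s i) *\<^sub>R (\<Sum>j\<in>UNIV. A j (h i) *\<^sub>R q j))"
      for q :: "3 \<Rightarrow> 'z::real_vector"
    proof -
      have "(\<Sum>j\<in>UNIV. (\<Sum>i\<in>UNIV. \<mu> $ i * (s i * A j (h i))) *\<^sub>R q j) = (\<Sum>i\<in>UNIV. (\<mu> $ i * s i) *\<^sub>R (\<Sum>j\<in>UNIV. A j (h i) *\<^sub>R q j))"
        unfolding scaleR_sum_left scaleR_sum_right by (subst sum.swap) (simp add: mult.assoc)
      then show ?thesis by (simp add: scaleR_diff_left sum_subtractf)
    qed
    have "fst ((\<Sum>i\<in>UNIV. (\<mu> $ i * s i) *\<^sub>R W (Inl i)) + (\<Sum>j\<in>UNIV. (A j x - (\<Sum>i\<in>UNIV. \<mu> $ i * (s i * A j (h i)))) *\<^sub>R W (Inr j))) = x"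
      by (simp add: fst_sum WY swap Ax)
    moreover have "snd ((\<Sum>i\<in>UNIV. (\<mu> $ i * s i) *\<^sub>R W (Inl i)) + (\<Sum>j\<in>UNIV. (A j x - (\<Sum>i\<in>UNIV. \<mu> $ i * (s i * A j (h i)))) *\<^sub>R W (Inr j))) = y0 x + L \<mu>"
      by (simp add: snd_sum WY swap y0_def L_def scaleR_diff_right sum_subtractf)
    ultimately show ?thesis by (simp add: prod_eq_iff)
  qed
  have mass: "(\<Sum>i\<in>UNIV. \<mu> $ i * s i) + (\<Sum>j\<in>UNIV. (A j x - (\<Sum>i\<in>UNIV. \<mu> $ i * (s i * A j (h i))))) = 1" for \<mu> x
  proof -
    have "(\<Sum>j\<in>UNIV. \<Sum>i\<in>UNIV. \<mu> $ i * (s i * A j (h i))) = (\<Sum>i\<in>UNIV. \<mu> $ i * s i)"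
      by (subst sum.swap) (simp add: sum_distrib_left[symmetric] A1)
    then show ?thesis by (simp add: sum_subtractf A1)
  qed
  have inj: "inj L"
  proof (rule linear_injective_0[OF L, THEN iffD2], intro allI impI)
    fix \<mu> assume 0: "L \<mu> = 0"
    define l where "l = case_sum (\<lambda>i. \<mu> $ i * s i) (\<lambda>j. - (\<Sum>i\<in>UNIV. \<mu> $ i * (s i * A j (h i))))"
    have "sum l UNIV = 0"
      using mass[of \<mu> 0] unfolding l_def split by (simp add: sum_subtractf A1 sum_negf)
    moreover have "(\<Sum>k\<in>UNIV. l k *\<^sub>R W k) = 0"
    proof -
      have "(\<Sum>j\<in>UNIV. (A j 0) *\<^sub>R W (Inr j)) = (0, y0 0)"
        using combo[of 0 0] by (simp add: L_def)
      then show ?thesis using combo[of \<mu> 0] 0 unfolding l_def split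
        by (simp add: scaleR_diff_left sum_subtractf sum_negf)
    qed
    ultimately have "l k = 0" for k using W(3) affine_independent_range[OF W(1)] by blast
    from this[of "Inl i" for i] have "\<mu> $ i * s i = 0" for i by (simp add: l_def)
    then show "\<mu> = 0" using s by (simp add: vec_eq_iff) (metis less_irrefl)
  qed
  have fibre: "{y. (x, y) \<in> \<sigma>} = (+) (y0 x) ` (L ` P x)" for x
  proof (intro equalityI subsetI)
    fix y assume "y \<in> {y. (x, y) \<in> \<sigma>}"
    then obtain l where l: "\<forall>k. 0 \<le> l k" "sum l UNIV = 1" "(x, y) = (\<Sum>k\<in>UNIV. l k *\<^sub>R W k)"
      unfolding W(2) convex_hull_range[OF W(1)] by auto
    define \<mu> :: "real^5" where "\<mu> = (\<chi> i. l (Inl i) / s i)"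
    have ms: "\<mu> $ i * s i = l (Inl i)" for i using s[of i] by (simp add: \<mu>_def)
    define u where "u j = l (Inr j) + (\<Sum>i\<in>UNIV. \<mu> $ i * (s i * A j (h i)))" for j
    have "sum u UNIV = 1"
    proof -
      have "sum u UNIV = sum (\<lambda>j. l (Inr j)) UNIV + (\<Sum>i\<in>UNIV. \<mu> $ i * s i)"
        using mass[of \<mu> x] by (simp add: u_def sum.distrib sum_subtractf A1)
      then show ?thesis using l(2) unfolding split by (simp add: ms)
    qed
    moreover have "(\<Sum>j\<in>UNIV. u j *\<^sub>R a j) = x"
    proof -
      have "x = fst (\<Sum>k\<in>UNIV. l k *\<^sub>R W k)" using l(3) by (metis fst_conv)
      also have "\<dots> = (\<Sum>i\<in>UNIV. l (Inl i) *\<^sub>R h i) + (\<Sum>j\<in>UNIV. l (Inr j) *\<^sub>R a j)"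
        unfolding split by (simp add: fst_sum WY)
      also have "(\<Sum>i\<in>UNIV. l (Inl i) *\<^sub>R h i) = (\<Sum>j\<in>UNIV. (\<Sum>i\<in>UNIV. \<mu> $ i * (s i * A j (h i))) *\<^sub>R a j)"
        unfolding scaleR_sum_left by (subst sum.swap)
          (simp add: mult.assoc[symmetric] ms scaleR_scaleR[symmetric] scaleR_sum_right[symmetric] Ax del: scaleR_scaleR)
      finally show ?thesis by (simp add: u_def scaleR_add_left sum.distrib)
    qed
    ultimately have "A j x = u j" for j using Au[of u j] by simp
    then have Ir: "l (Inr j) = A j x - (\<Sum>i\<in>UNIV. \<mu> $ i * (s i * A j (h i)))" for j
      by (simp add: u_def)
    have "(x, y) = (x, y0 x + L \<mu>)"
      unfolding combo[symmetric] l(3) split by (simp add: ms Ir)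
    moreover have "\<mu> \<in> P x"
      unfolding P_def mem_Collect_eq
    proof (intro conjI allI)
      show "0 \<le> \<mu> $ i" for i using l(1) s[of i] by (simp add: \<mu>_def)
      show "0 \<le> A j x - (\<Sum>i\<in>UNIV. \<mu> $ i * (s i * A j (h i)))" for j
        unfolding Ir[symmetric] using l(1) by blast
    qed
    ultimately show "y \<in> (+) (y0 x) ` (L ` P x)" by blast
  next
    fix y assume "y \<in> (+) (y0 x) ` (L ` P x)"
    then obtain \<mu> where \<mu>: "\<mu> \<in> P x" "y = y0 x + L \<mu>" by blast
    define l where "l = case_sum (\<lambda>i. \<mu> $ i * s i) (\<lambda>j. A j x - (\<Sum>i\<in>UNIV. \<mu> $ i * (s i * A j (h i))))"
    have "\<forall>k. 0 \<le> l k" using \<mu>(1) s by (auto simp: l_def P_def less_imp_le split: sum.split)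
    moreover have "sum l UNIV = 1" unfolding l_def split using mass[of \<mu> x] by simp
    moreover have "(\<Sum>k\<in>UNIV. l k *\<^sub>R W k) = (x, y)"
      unfolding l_def split \<mu>(2) combo[symmetric] by simp
    ultimately show "y \<in> {y. (x, y) \<in> \<sigma>}"
      unfolding W(2) convex_hull_range[OF W(1)] mem_Collect_eq by (intro exI[of _ l]) simp
  qed
  have Pc: "compact (P x)" for x
  proof -
    have "closed (P x)" unfolding P_def
      by (intro closed_Collect_conj closed_Collect_all closed_Collect_le continuous_intros)
    moreover have "bounded (P x)"
    proof -
      have "P x \<subseteq> cbox 0 (\<chi> i. 1 / s i)"
      proof
        fix \<mu> assume \<mu>: "\<mu> \<in> P x"
        have "0 \<le> (\<Sum>j\<in>UNIV. (A j x - (\<Sum>i\<in>UNIV. \<mu> $ i * (s i * A j (h i)))))"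
          using \<mu> by (intro sum_nonneg) (auto simp: P_def)
        then have "(\<Sum>i\<in>UNIV. \<mu> $ i * s i) \<le> 1"
          using mass[of \<mu> x] by linarith
        moreover have "\<mu> $ i * s i \<le> (\<Sum>i\<in>UNIV. \<mu> $ i * s i)" for i
          using \<mu> s by (intro member_le_sum) (auto simp: P_def less_imp_le)
        ultimately have "\<mu> $ i * s i \<le> 1" for i by (meson order_trans)
        then show "\<mu> \<in> cbox 0 (\<chi> i. 1 / s i)"
          using \<mu> s by (simp add: mem_box_cart P_def field_simps)
      qed
      then show ?thesis using bounded_cbox bounded_subset by blast
    qed
    ultimately show ?thesis by (simp add: compact_eq_bounded_closed)
  qed
  have "measure lborel {y. (x, y) \<in> \<sigma>} = \<bar>det (matrix L)\<bar> * measure lborel (P x)" for x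
  proof -
    have LP: "compact (L ` P x)" using Pc L by (intro compact_continuous_image linear_continuous_on) (auto simp: linear_conv_bounded_linear)
    then have "compact ((+) (y0 x) ` (L ` P x))" by (rule compact_translation)
    then have "measure lborel {y. (x, y) \<in> \<sigma>} = measure lebesgue ((+) (y0 x) ` (L ` P x))"
      unfolding fibre by (simp add: measure_completion borel_compact)
    also have "\<dots> = measure lebesgue (L ` P x)" by (rule measure_translation)
    also have "\<dots> = \<bar>det (matrix L)\<bar> * measure lebesgue (P x)"
      by (intro measure_linear_image L lmeasurable_compact Pc)
    also have "measure lebesgue (P x) = measure lborel (P x)"
      using Pc by (simp add: measure_completion borel_compact)
    finally show ?thesis .
  qed
  moreover have "det (matrix L) \<noteq> 0"
    using inj L by (simp add: det_nz_iff_inj)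
  ultimately show ?thesis unfolding P_def by (intro exI[of _ "\<bar>det (matrix L)\<bar>"]) simp
qed

section \<open>Iterated integrals over five-dimensional space\<close>

lemma exhaust_5: "x = 1 \<or> x = 2 \<or> x = 3 \<or> x = 4 \<or> x = (5::5)"
proof (induct x)
  case (of_int z)
  then have "z = 0 \<or> z = 1 \<or> z = 2 \<or> z = 3 \<or> z = 4" by fastforce
  then show ?case by auto
qed

lemma UNIV_5: "(UNIV :: 5 set) = {1, 2, 3, 4, 5}"
  using exhaust_5 by auto

lemma forall_5: "(\<forall>i::5. P i) \<longleftrightarrow> P 1 \<and> P 2 \<and> P 3 \<and> P 4 \<and> P 5"
  by (metis exhaust_5)

lemma sum_5: "sum f (UNIV :: 5 set) = f 1 + f 2 + f 3 + f 4 + f 5"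
  unfolding UNIV_5 by (simp add: ac_simps)

lemma prod_5: "prod f (UNIV :: 5 set) = f 1 * f 2 * f 3 * f 4 * f 5"
  unfolding UNIV_5 by (simp add: ac_simps)

text \<open>Five-dimensional integrals are computed over a product of lines, whose coordinates can be
  integrated out one by one.\<close>

definition vec5 :: "real \<times> real \<times> real \<times> real \<times> real \<Rightarrow> real^5" where
  "vec5 = (\<lambda>(a, b, c, d, e). \<chi> i. if i = 1 then a else if i = 2 then b else if i = 3 then c else if i = 4 then d else e)"

lemma vec5_nth [simp]:
  "vec5 (a, b, c, d, e) $ 1 = a" "vec5 (a, b, c, d, e) $ 2 = b" "vec5 (a, b, c, d, e) $ 3 = c"
  "vec5 (a, b, c, d, e) $ 4 = d" "vec5 (a, b, c, d, e) $ 5 = e"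
  by (simp_all add: vec5_def)

lemma vec5_measurable [measurable]: "vec5 \<in> borel_measurable borel"
proof (rule borel_measurable_continuous_onI)
  have "continuous_on UNIV (\<lambda>x. vec5 x $ i)" for i
    using exhaust_5[of i]
    by (auto simp: vec5_def split_beta intro!: continuous_intros)
  then show "continuous_on UNIV vec5"
    using continuous_on_vec_lambda[of UNIV "\<lambda>i x. vec5 x $ i"] by simp
qed

lemma emeasure_lborel_Times:
  fixes A :: "'a::euclidean_space set" and B :: "'b::euclidean_space set"
  assumes "A \<in> sets borel" "B \<in> sets borel"
  shows "emeasure lborel (A \<times> B) = emeasure lborel A * emeasure lborel B"
  using assms by (simp add: lborel_prod[symmetric] lborel.emeasure_pair_measure_Times)

lemma nn_integral_lborel_prod:
  fixes f :: "'a::euclidean_space \<times> 'b::euclidean_space \<Rightarrow> ennreal"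
  assumes "f \<in> borel_measurable borel"
  shows "(\<integral>\<^sup>+x. f x \<partial>lborel) = (\<integral>\<^sup>+a. \<integral>\<^sup>+b. f (a, b) \<partial>lborel \<partial>lborel)"
  unfolding lborel_prod[symmetric] using assms
  by (subst lborel.nn_integral_fst[symmetric]) (simp_all add: lborel_prod)

lemma lborel_vec5: "(lborel :: (real^5) measure) = distr lborel borel vec5"
proof (rule lborel_eqI)
  fix l u :: "real^5" assume lu: "\<And>b. b \<in> Basis \<Longrightarrow> l \<bullet> b \<le> u \<bullet> b"
  have le: "l $ i \<le> u $ i" for i using lu[of "axis i 1"] by (simp add: inner_axis)
  have "vec5 -` box l u = {l$1<..<u$1} \<times> {l$2<..<u$2} \<times> {l$3<..<u$3} \<times> {l$4<..<u$4} \<times> {l$5<..<u$5}"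
    by (auto simp: mem_box_cart forall_5)
  then have "emeasure (distr lborel borel vec5) (box l u) = ennreal (\<Prod>i\<in>UNIV. u $ i - l $ i)"
    by (simp add: emeasure_distr emeasure_lborel_Times borel_Times le prod_5 ennreal_mult mult.assoc)
  also have "(\<Prod>i\<in>UNIV. u $ i - l $ i) = (\<Prod>b\<in>Basis. (u - l) \<bullet> b)"
    by (simp add: Basis_vec_def UNION_singleton_eq_range prod.reindex axis_eq_axis inj_on_def inner_axis)
  finally show "emeasure (distr lborel borel vec5) (box l u) = ennreal (\<Prod>b\<in>Basis. (u - l) \<bullet> b)" .
qed simp

lemma nn_integral_real5:
  assumes [measurable]: "f \<in> borel_measurable borel"
  shows "(\<integral>\<^sup>+x. f x \<partial>lborel) = (\<integral>\<^sup>+a. \<integral>\<^sup>+b. \<integral>\<^sup>+c. \<integral>\<^sup>+d. \<integral>\<^sup>+e. f (vec5 (a, b, c, d, e)) \<partial>lborel \<partial>lborel \<partial>lborel \<partial>lborel \<partial>lborel)"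
proof -
  have "(\<integral>\<^sup>+x. f x \<partial>lborel) = (\<integral>\<^sup>+x. f (vec5 x) \<partial>lborel)"
    by (subst lborel_vec5) (simp add: nn_integral_distr)
  also have "\<dots> = (\<integral>\<^sup>+a. \<integral>\<^sup>+b. \<integral>\<^sup>+c. \<integral>\<^sup>+d. \<integral>\<^sup>+e. f (vec5 (a, b, c, d, e)) \<partial>lborel \<partial>lborel \<partial>lborel \<partial>lborel \<partial>lborel)"
    by (simp add: nn_integral_lborel_prod)
  finally show ?thesis .
qed

text \<open>The volume of the set of nonnegative weights for which subtracting the weighted sum of the
  vectors from \<open>(\<alpha>, \<beta>, \<gamma>)\<close> leaves a point of the positive octant; equivalently, the
  multivariate truncated power (cone spline) of the vectors and the three unit vectors.\<close>

fun cone_vol :: "(real \<times> real \<times> real) list \<Rightarrow> real \<Rightarrow> real \<Rightarrow> real \<Rightarrow> ennreal" where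
  "cone_vol [] \<alpha> \<beta> \<gamma> = (if 0 \<le> \<alpha> \<and> 0 \<le> \<beta> \<and> 0 \<le> \<gamma> then 1 else 0)"
| "cone_vol ((p, q, r) # ks) \<alpha> \<beta> \<gamma> =
    (\<integral>\<^sup>+t. cone_vol ks (\<alpha> - t * p) (\<beta> - t * q) (\<gamma> - t * r) * indicator {0..} t \<partial>lborel)"

lemma nn_integral_indicator_pull:
  "(\<integral>\<^sup>+x. f x * indicator A y \<partial>M) = (\<integral>\<^sup>+x. f x \<partial>M) * indicator A y"
  by (cases "y \<in> A") auto

lemma emeasure_polytope:
  "emeasure lborel {\<mu>::real^5. (\<forall>i. 0 \<le> \<mu> $ i) \<and> 0 \<le> \<alpha> - (\<Sum>i\<in>UNIV. \<mu> $ i * p i)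
      \<and> 0 \<le> \<beta> - (\<Sum>i\<in>UNIV. \<mu> $ i * q i) \<and> 0 \<le> \<gamma> - (\<Sum>i\<in>UNIV. \<mu> $ i * r i)}
   = cone_vol (map (\<lambda>i. (p i, q i, r i)) [1, 2, 3, 4, 5]) \<alpha> \<beta> \<gamma>"
  (is "emeasure lborel ?P = _")
proof -
  have "closed ?P"
    by (intro closed_Collect_conj closed_Collect_all closed_Collect_le continuous_intros)
  then have [measurable]: "?P \<in> sets borel" by simp
  have ind: "indicator ?P (vec5 (a, b, c, d, e)) = cone_vol [] (\<alpha> - a * p 1 - b * p 2 - c * p 3 - d * p 4 - e * p 5)
     (\<beta> - a * q 1 - b * q 2 - c * q 3 - d * q 4 - e * q 5) (\<gamma> - a * r 1 - b * r 2 - c * r 3 - d * r 4 - e * r 5)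
     * indicator {0..} e * indicator {0..} d * indicator {0..} c * indicator {0..} b * indicator {0..} a"
    for a b c d e
    by (auto simp: indicator_def forall_5 sum_5 algebra_simps)
  have "emeasure lborel ?P = (\<integral>\<^sup>+\<mu>. indicator ?P \<mu> \<partial>lborel)" by simp
  also have "\<dots> = cone_vol (map (\<lambda>i. (p i, q i, r i)) [1, 2, 3, 4, 5]) \<alpha> \<beta> \<gamma>"
    by (subst nn_integral_real5) (measurable, simp only: ind nn_integral_indicator_pull list.map cone_vol.simps)
  finally show ?thesis .
qed

section \<open>Volumes of cone fibres in closed form\<close>

text \<open>The divided truncated power \<open>z\<^sub>+\<^sup>n / n!\<close>. With this normalisation the derivative lowers the
  index and introduces no factor.\<close>

definition tp :: "nat \<Rightarrow> real \<Rightarrow> real" where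
  "tp n z = (if 0 \<le> z then z ^ n / fact n else 0)"

lemma tp_nonneg: "0 \<le> z \<Longrightarrow> tp n z = z ^ n / fact n" by (simp add: tp_def)
lemma tp_neg: "z < 0 \<Longrightarrow> tp n z = 0" by (simp add: tp_def)
lemma tp_at_0: "0 < n \<Longrightarrow> tp n 0 = 0" by (simp add: tp_def)

lemma tp_eq_max: "0 < n \<Longrightarrow> tp n z = max 0 z ^ n / fact n"
  by (cases "0 \<le> z") (simp_all add: tp_def)

lemma continuous_on_tp [continuous_intros]:
  "continuous_on S f \<Longrightarrow> 0 < n \<Longrightarrow> continuous_on S (\<lambda>x. tp n (f x))"
  by (simp add: tp_eq_max) (intro continuous_intros, auto)

lemma DERIV_tp:
  assumes "2 \<le> n"
  shows "(tp n has_real_derivative tp (n - 1) z) (at z)"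
proof -
  obtain m where n: "n = Suc (Suc m)" using assms by (metis add_2_eq_Suc le_Suc_ex)
  consider "z < 0" | "z = 0" | "0 < z" by linarith
  then show ?thesis
  proof cases
    case 1
    have "((\<lambda>_. 0) has_real_derivative 0) (at z)" by simp
    then have "(tp n has_real_derivative 0) (at z)"
      by (rule DERIV_cong_ev[THEN iffD1, OF refl _ refl, rotated])
        (use 1 in \<open>auto simp: tp_def eventually_nhds intro!: exI[of _ "{..<0}"]\<close>)
    then show ?thesis using 1 by (simp add: tp_def)
  next
    case 3
    have "((\<lambda>z. z ^ n / fact n) has_real_derivative z ^ (n - 1) / fact (n - 1)) (at z)"
      by (auto intro!: derivative_eq_intros simp: n simp del: power_Suc)
    then have "(tp n has_real_derivative z ^ (n - 1) / fact (n - 1)) (at z)"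
      by (rule DERIV_cong_ev[THEN iffD1, OF refl _ refl, rotated])
        (use 3 in \<open>auto simp: tp_def eventually_nhds intro!: exI[of _ "{0<..}"]\<close>)
    then show ?thesis using 3 by (simp add: tp_def)
  next
    case 2
    have "((\<lambda>h. tp n h / h) \<longlongrightarrow> 0) (at 0)"
    proof (rule tendsto_0_le[where K = 1])
      show "((\<lambda>h::real. h ^ Suc m) \<longlongrightarrow> 0) (at 0)"
        by (auto intro!: tendsto_eq_intros)
      have "norm (tp n h / h) \<le> norm (h ^ Suc m) * 1" for h :: real
      proof (cases "0 < h")
        case True
        then have "norm (tp n h / h) = h ^ Suc m / fact n" by (simp add: tp_def n del: fact_Suc)
        also have "\<dots> \<le> h ^ Suc m / 1"
          using True by (intro divide_left_mono) (auto simp: fact_ge_1)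
        finally show ?thesis using True by simp
      next
        case False
        then show ?thesis by (cases "h = 0") (simp_all add: tp_def)
      qed
      then show "\<forall>\<^sub>F h in at 0. norm (tp n h / h) \<le> norm (h ^ Suc m) * 1" by simp
    qed
    then show ?thesis using 2 by (simp add: DERIV_def tp_def n)
  qed
qed

lemma has_real_derivative_tp [derivative_intros]:
  assumes "(f has_real_derivative D) (at x)" "2 \<le> n"
  shows "((\<lambda>x. tp n (f x)) has_real_derivative tp (n - 1) (f x) * D) (at x)"
  using DERIV_chain2[OF DERIV_tp[OF assms(2)] assms(1)] by simp

definition cone_vol_is :: "(real \<times> real \<times> real) list \<Rightarrow> (real \<Rightarrow> real \<Rightarrow> real \<Rightarrow> real) \<Rightarrow> bool" where
  "cone_vol_is ks g \<longleftrightarrow> (\<forall>x y z. 0 \<le> g x y z \<and> cone_vol ks x y z = ennreal (g x y z))"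

lemma cone_vol_is_Nil: "cone_vol_is [] (\<lambda>x y z. tp 0 x * tp 0 y * tp 0 z)"
  by (auto simp: cone_vol_is_def tp_def)

text \<open>Adding a vector integrates the previous volume along a ray, and \<open>\<tau>\<close> is the time at which the
  ray leaves the cone. Nonnegativity of the closed form is carried along, since it is not visible
  from the formula but is needed to recover it from the extended nonnegative integral.\<close>

lemma cone_vol_step:
  assumes g: "cone_vol_is ks g" and "0 \<le> \<tau>" and cont: "continuous_on UNIV \<phi>"
    and eq: "\<And>t. 0 \<le> t \<Longrightarrow> t \<le> \<tau> \<Longrightarrow> g (x - t * p) (y - t * q) (z - t * r) = \<phi> t"
    and zero: "\<And>t. \<tau> < t \<Longrightarrow> g (x - t * p) (y - t * q) (z - t * r) = 0"
    and der: "\<And>t. (F has_real_derivative \<phi> t) (at t)"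
    and res: "F \<tau> - F 0 = res"
  shows "0 \<le> res \<and> cone_vol ((p, q, r) # ks) x y z = ennreal res"
proof -
  have nonneg: "0 \<le> \<phi> t" if "t \<in> {0..\<tau>}" for t
    using g eq[of t] that unfolding cone_vol_is_def by (metis atLeastAtMost_iff)
  have "cone_vol ((p, q, r) # ks) x y z = (\<integral>\<^sup>+t. ennreal (\<phi> t) * indicator {0..\<tau>} t \<partial>lborel)"
    unfolding cone_vol.simps
  proof (intro nn_integral_cong)
    fix t :: real
    have "cone_vol ks (x - t * p) (y - t * q) (z - t * r) = ennreal (g (x - t * p) (y - t * q) (z - t * r))"
      using g by (simp add: cone_vol_is_def)
    then show "cone_vol ks (x - t * p) (y - t * q) (z - t * r) * indicator {0..} t = ennreal (\<phi> t) * indicator {0..\<tau>} t"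
      using eq[of t] zero[of t] by (cases "t \<le> \<tau>"; cases "0 \<le> t") auto
  qed
  also have "\<dots> = ennreal (F \<tau> - F 0)"
    using assms(2) cont der nonneg
    by (intro nn_integral_FTC_Icc) (auto intro: borel_measurable_continuous_onI has_field_derivative_at_within)
  finally have *: "cone_vol ((p, q, r) # ks) x y z = ennreal res" by (simp add: res)
  have "F 0 \<le> F \<tau>"
  proof (rule DERIV_nonneg_imp_nondecreasing[OF assms(2)])
    show "\<exists>y. (F has_real_derivative y) (at t) \<and> 0 \<le> y" if "0 \<le> t" "t \<le> \<tau>" for t
      using der[of t] nonneg[of t] that by auto
  qed
  then have "0 \<le> res" using res by linarith
  then show ?thesis using * by (rule conjI)
qed

lemma cone_vol_zero:
  assumes g: "cone_vol_is ks g" and zero: "\<And>t. 0 \<le> t \<Longrightarrow> g (x - t * p) (y - t * q) (z - t * r) = 0" and "res = 0"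
  shows "0 \<le> res \<and> cone_vol ((p, q, r) # ks) x y z = ennreal res"
proof -
  have "cone_vol ks (x - t * p) (y - t * q) (z - t * r) * indicator {0..} t = 0" for t :: real
    using g zero[of t] by (cases "0 \<le> t") (auto simp: cone_vol_is_def)
  then have "cone_vol ((p, q, r) # ks) x y z = 0" unfolding cone_vol.simps by (simp only: nn_integral_const) simp
  then show ?thesis using assms(3) by simp
qed

lemma cone_vol_e1:
  assumes g: "cone_vol_is ks (\<lambda>x y z. tp n x * w y z)"
  shows "cone_vol_is ((1, 0, 0) # ks) (\<lambda>x y z. tp (Suc n) x * w y z)" (is "cone_vol_is _ ?g")
  unfolding cone_vol_is_def
proof (intro allI)
  fix x y z :: real
  show "0 \<le> (?g x y z) \<and> cone_vol ((1, 0, 0) # ks) x y z = ennreal (?g x y z)"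
  proof (cases "0 \<le> x")
    case True
    show ?thesis
    proof (rule cone_vol_step[OF g True, where \<phi> = "\<lambda>t. (x - t) ^ n / fact n * w y z" and F = "\<lambda>t. - ((x - t) ^ Suc n / fact (Suc n)) * w y z"])
      show "((\<lambda>t. - ((x - t) ^ Suc n / fact (Suc n)) * w y z) has_real_derivative (x - t) ^ n / fact n * w y z) (at t)" for t
        by (auto intro!: derivative_eq_intros simp del: power_Suc)
    qed (use True in \<open>auto simp: tp_def intro!: continuous_intros\<close>)
  next
    case False
    show ?thesis by (rule cone_vol_zero[OF g]) (use False in \<open>auto simp: tp_neg\<close>)
  qed
qed

lemma cone_vol_e2:
  assumes g: "cone_vol_is ks (\<lambda>x y z. w x z * tp 0 y)"
  shows "cone_vol_is ((0, 1, 0) # ks) (\<lambda>x y z. w x z * tp 1 y)" (is "cone_vol_is _ ?g")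
  unfolding cone_vol_is_def
proof (intro allI)
  fix x y z :: real
  show "0 \<le> (?g x y z) \<and> cone_vol ((0, 1, 0) # ks) x y z = ennreal (?g x y z)"
  proof (cases "0 \<le> y")
    case True
    show ?thesis
      by (rule cone_vol_step[OF g True, where \<phi> = "\<lambda>t. w x z" and F = "\<lambda>t. w x z * t"])
        (use True in \<open>auto simp: tp_def intro!: continuous_intros derivative_eq_intros\<close>)
  next
    case False
    show ?thesis by (rule cone_vol_zero[OF g]) (use False in \<open>auto simp: tp_neg\<close>)
  qed
qed

lemma cone_vol_e1_pow: "cone_vol_is (replicate n (1, 0, 0)) (\<lambda>x y z. tp n x * (tp 0 y * tp 0 z))"
proof (induction n)
  case 0 show ?case using cone_vol_is_Nil by (simp add: mult.assoc)
next
  case (Suc n)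
  show ?case using cone_vol_e1[OF Suc] by simp
qed

text \<open>The next eight steps differ only in the vector added and in the time at which the ray leaves the octant;
  the antiderivatives come from integrating truncated powers by parts.\<close>

lemma cone_vol_pow_diag:
  assumes g: "cone_vol_is ks (\<lambda>x y z. tp n x * (tp 0 y * tp 0 z))"
    and n: "0 < n"
  shows "cone_vol_is ((1, 1, 0) # ks) (\<lambda>x y z. (tp (Suc n) x - tp (Suc n) (x - y)) * (tp 0 y * tp 0 z))" (is "cone_vol_is _ ?g")
  unfolding cone_vol_is_def
proof (intro allI)
  fix x y z :: real
  show "0 \<le> (?g x y z) \<and> cone_vol ((1, 1, 0) # ks) x y z = ennreal (?g x y z)"
  proof (cases "0 \<le> y")
    case True
    show ?thesis
      by (rule cone_vol_step[OF g True, where \<phi> = "\<lambda>t. tp n (x - t) * tp 0 z" and F = "\<lambda>t. - tp (Suc n) (x - t) * tp 0 z"])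
        (use True n in \<open>auto simp: tp_nonneg tp_neg tp_at_0 algebra_simps intro!: continuous_intros derivative_eq_intros\<close>)
  next
    case False
    show ?thesis by (rule cone_vol_zero[OF g]) (use False in \<open>auto simp: tp_neg min_def split: if_splits\<close>)
  qed
qed

lemma cone_vol_pow_diag2:
  assumes g: "cone_vol_is ks (\<lambda>x y z. (tp n x - tp n (x - y)) * (tp 0 y * tp 0 z))"
    and n: "0 < n"
  shows "cone_vol_is ((1, 1, 0) # ks) (\<lambda>x y z. (tp (Suc n) x - tp (Suc n) (x - y) - y * tp n (x - y)) * (tp 0 y * tp 0 z))" (is "cone_vol_is _ ?g")
  unfolding cone_vol_is_def
proof (intro allI)
  fix x y z :: real
  show "0 \<le> (?g x y z) \<and> cone_vol ((1, 1, 0) # ks) x y z = ennreal (?g x y z)"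
  proof (cases "0 \<le> y")
    case True
    show ?thesis
      by (rule cone_vol_step[OF g True, where \<phi> = "\<lambda>t. (tp n (x - t) - tp n (x - y)) * tp 0 z" and F = "\<lambda>t. (- tp (Suc n) (x - t) - t * tp n (x - y)) * tp 0 z"])
        (use True n in \<open>auto simp: tp_nonneg tp_neg tp_at_0 algebra_simps intro!: continuous_intros derivative_eq_intros\<close>)
  next
    case False
    show ?thesis by (rule cone_vol_zero[OF g]) (use False in \<open>auto simp: tp_neg min_def split: if_splits\<close>)
  qed
qed

lemma cone_vol_diag_skew:
  assumes g: "cone_vol_is ks (\<lambda>x y z. (tp n x - tp n (x - y)) * (tp 0 y * tp 0 z))"
    and n: "0 < n"
  shows "cone_vol_is ((1, 0, 1) # ks) (\<lambda>x y z. (tp (Suc n) x - tp (Suc n) (x - y) - tp (Suc n) (x - z) + tp (Suc n) (x - y - z)) * (tp 0 y * tp 0 z))" (is "cone_vol_is _ ?g")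
  unfolding cone_vol_is_def
proof (intro allI)
  fix x y z :: real
  show "0 \<le> (?g x y z) \<and> cone_vol ((1, 0, 1) # ks) x y z = ennreal (?g x y z)"
  proof (cases "0 \<le> z")
    case True
    show ?thesis
      by (rule cone_vol_step[OF g True, where \<phi> = "\<lambda>t. (tp n (x - t) - tp n (x - y - t)) * tp 0 y" and F = "\<lambda>t. (- tp (Suc n) (x - t) + tp (Suc n) (x - y - t)) * tp 0 y"])
        (use True n in \<open>auto simp: tp_nonneg tp_neg tp_at_0 algebra_simps intro!: continuous_intros derivative_eq_intros\<close>)
  next
    case False
    show ?thesis by (rule cone_vol_zero[OF g]) (use False in \<open>auto simp: tp_neg min_def split: if_splits\<close>)
  qed
qed

lemma cone_vol_diag2_skew:
  assumes g: "cone_vol_is ks (\<lambda>x y z. (tp (Suc n) x - tp (Suc n) (x - y) - y * tp n (x - y)) * (tp 0 y * tp 0 z))"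
    and n: "0 < n"
  shows "cone_vol_is ((1, 0, 1) # ks) (\<lambda>x y z. (tp (Suc (Suc n)) x - tp (Suc (Suc n)) (x - y) - tp (Suc (Suc n)) (x - z) + tp (Suc (Suc n)) (x - y - z) - y * (tp (Suc n) (x - y) - tp (Suc n) (x - y - z))) * (tp 0 y * tp 0 z))" (is "cone_vol_is _ ?g")
  unfolding cone_vol_is_def
proof (intro allI)
  fix x y z :: real
  show "0 \<le> (?g x y z) \<and> cone_vol ((1, 0, 1) # ks) x y z = ennreal (?g x y z)"
  proof (cases "0 \<le> z")
    case True
    show ?thesis
      by (rule cone_vol_step[OF g True, where \<phi> = "\<lambda>t. (tp (Suc n) (x - t) - tp (Suc n) (x - y - t) - y * tp n (x - y - t)) * tp 0 y" and F = "\<lambda>t. (- tp (Suc (Suc n)) (x - t) + tp (Suc (Suc n)) (x - y - t) + y * tp (Suc n) (x - y - t)) * tp 0 y"])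
        (use True n in \<open>auto simp: tp_nonneg tp_neg tp_at_0 algebra_simps intro!: continuous_intros derivative_eq_intros\<close>)
  next
    case False
    show ?thesis by (rule cone_vol_zero[OF g]) (use False in \<open>auto simp: tp_neg min_def split: if_splits\<close>)
  qed
qed

lemma cone_vol_prod_diag:
  assumes g: "cone_vol_is ks (\<lambda>x y z. tp n x * tp 0 z * tp 1 y)"
    and n: "0 < n"
  shows "cone_vol_is ((1, 1, 0) # ks) (\<lambda>x y z. (y * tp (Suc n) x - tp (Suc (Suc n)) x + tp (Suc (Suc n)) (x - y)) * (tp 0 y * tp 0 z))" (is "cone_vol_is _ ?g")
  unfolding cone_vol_is_def
proof (intro allI)
  fix x y z :: real
  show "0 \<le> (?g x y z) \<and> cone_vol ((1, 1, 0) # ks) x y z = ennreal (?g x y z)"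
  proof (cases "0 \<le> y")
    case True
    show ?thesis
      by (rule cone_vol_step[OF g True, where \<phi> = "\<lambda>t. (y - t) * tp n (x - t) * tp 0 z" and F = "\<lambda>t. (- (y - t) * tp (Suc n) (x - t) + tp (Suc (Suc n)) (x - t)) * tp 0 z"])
        (use True n in \<open>auto simp: tp_nonneg tp_neg tp_at_0 algebra_simps intro!: continuous_intros derivative_eq_intros\<close>)
  next
    case False
    show ?thesis by (rule cone_vol_zero[OF g]) (use False in \<open>auto simp: tp_neg min_def split: if_splits\<close>)
  qed
qed

lemma cone_vol_prod_diag2:
  assumes g: "cone_vol_is ks (\<lambda>x y z. (y * tp n x - tp (Suc n) x + tp (Suc n) (x - y)) * (tp 0 y * tp 0 z))"
    and n: "0 < n"
  shows "cone_vol_is ((1, 1, 0) # ks) (\<lambda>x y z. (y * tp (Suc n) x - 2 * tp (Suc (Suc n)) x + 2 * tp (Suc (Suc n)) (x - y) + y * tp (Suc n) (x - y)) * (tp 0 y * tp 0 z))" (is "cone_vol_is _ ?g")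
  unfolding cone_vol_is_def
proof (intro allI)
  fix x y z :: real
  show "0 \<le> (?g x y z) \<and> cone_vol ((1, 1, 0) # ks) x y z = ennreal (?g x y z)"
  proof (cases "0 \<le> y")
    case True
    show ?thesis
      by (rule cone_vol_step[OF g True, where \<phi> = "\<lambda>t. ((y - t) * tp n (x - t) - tp (Suc n) (x - t) + tp (Suc n) (x - y)) * tp 0 z" and F = "\<lambda>t. (- (y - t) * tp (Suc n) (x - t) + 2 * tp (Suc (Suc n)) (x - t) + t * tp (Suc n) (x - y)) * tp 0 z"])
        (use True n in \<open>auto simp: tp_nonneg tp_neg tp_at_0 algebra_simps intro!: continuous_intros derivative_eq_intros\<close>)
  next
    case False
    show ?thesis by (rule cone_vol_zero[OF g]) (use False in \<open>auto simp: tp_neg min_def split: if_splits\<close>)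
  qed
qed

text \<open>The ray leaves the octant through whichever of two sides is met first, which is where the
  minimum comes from; the result is nevertheless a sum of truncated powers of lines, as
  \<open>profile_7\<close> shows.\<close>

lemma cone_vol_diag2_skew2:
  assumes g: "cone_vol_is ks (\<lambda>x y z. (tp (Suc n) x - tp (Suc n) (x - y) - tp (Suc n) (x - z) + tp (Suc n) (x - y - z) - y * (tp n (x - y) - tp n (x - y - z))) * (tp 0 y * tp 0 z))"
    and n: "0 < n"
  shows "cone_vol_is ((0, 1, 1) # ks) (\<lambda>x y z. (min y z * tp (Suc n) x - 2 * tp (Suc (Suc n)) (x - y + min y z) - tp (Suc (Suc n)) (x - z + min y z) + 3/4 * tp (Suc (Suc n)) (x - y - z + 2 * min y z) - (y - min y z) * (tp (Suc n) (x - y + min y z) - tp (Suc n) (x - y - z + 2 * min y z) / 2) + 2 * tp (Suc (Suc n)) (x - y) + tp (Suc (Suc n)) (x - z) - 3/4 * tp (Suc (Suc n)) (x - y - z) + y * (tp (Suc n) (x - y) - tp (Suc n) (x - y - z) / 2)) * (tp 0 y * tp 0 z))" (is "cone_vol_is _ ?g")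
  unfolding cone_vol_is_def
proof (intro allI)
  fix x y z :: real
  show "0 \<le> (?g x y z) \<and> cone_vol ((0, 1, 1) # ks) x y z = ennreal (?g x y z)"
  proof (cases "0 \<le> min y z")
    case True
    show ?thesis
      proof (rule cone_vol_step[OF g True, where \<phi> = "\<lambda>t. tp (Suc n) x - tp (Suc n) (x - y + t) - tp (Suc n) (x - z + t) + tp (Suc n) (x - y - z + 2 * t) - (y - t) * (tp n (x - y + t) - tp n (x - y - z + 2 * t))" and F = "\<lambda>t. t * tp (Suc n) x - 2 * tp (Suc (Suc n)) (x - y + t) - tp (Suc (Suc n)) (x - z + t) + 3/4 * tp (Suc (Suc n)) (x - y - z + 2 * t) - (y - t) * (tp (Suc n) (x - y + t) - tp (Suc n) (x - y - z + 2 * t) / 2)"])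
      show "continuous_on UNIV (\<lambda>t. tp (Suc n) x - tp (Suc n) (x - y + t) - tp (Suc n) (x - z + t) + tp (Suc n) (x - y - z + 2 * t) - (y - t) * (tp n (x - y + t) - tp n (x - y - z + 2 * t)))"
        using n by (intro continuous_intros) auto
      show "((\<lambda>t. t * tp (Suc n) x - 2 * tp (Suc (Suc n)) (x - y + t) - tp (Suc (Suc n)) (x - z + t) + 3/4 * tp (Suc (Suc n)) (x - y - z + 2 * t) - (y - t) * (tp (Suc n) (x - y + t) - tp (Suc n) (x - y - z + 2 * t) / 2)) has_real_derivative tp (Suc n) x - tp (Suc n) (x - y + t) - tp (Suc n) (x - z + t) + tp (Suc n) (x - y - z + 2 * t) - (y - t) * (tp n (x - y + t) - tp n (x - y - z + 2 * t))) (at t)" for t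
        using n by (auto intro!: derivative_eq_intros simp: algebra_simps add_divide_distrib diff_divide_distrib)
      show "(tp (Suc n) ((x - t * 0)) - tp (Suc n) ((x - t * 0) - (y - t * 1)) - tp (Suc n) ((x - t * 0) - (z - t * 1)) + tp (Suc n) ((x - t * 0) - (y - t * 1) - (z - t * 1)) - (y - t * 1) * (tp n ((x - t * 0) - (y - t * 1)) - tp n ((x - t * 0) - (y - t * 1) - (z - t * 1)))) * (tp 0 (y - t * 1) * tp 0 (z - t * 1)) = tp (Suc n) x - tp (Suc n) (x - y + t) - tp (Suc n) (x - z + t) + tp (Suc n) (x - y - z + 2 * t) - (y - t) * (tp n (x - y + t) - tp n (x - y - z + 2 * t))" if "0 \<le> t" "t \<le> min y z" for t
        using that by (simp add: tp_nonneg algebra_simps)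
    qed (use True n in \<open>auto simp: tp_nonneg tp_neg tp_at_0 min_less_iff_disj\<close>)
  next
    case False
    show ?thesis by (rule cone_vol_zero[OF g]) (use False in \<open>auto simp: tp_neg min_def split: if_splits\<close>)
  qed
qed

lemma cone_vol_prod_diag2_skew:
  assumes g: "cone_vol_is ks (\<lambda>x y z. (y * tp n x - 2 * tp (Suc n) x + 2 * tp (Suc n) (x - y) + y * tp n (x - y)) * (tp 0 y * tp 0 z))"
    and n: "0 < n"
  shows "cone_vol_is ((- 1, 1, 1) # ks) (\<lambda>x y z. ((y - min y z) * tp (Suc n) (x + min y z) - tp (Suc (Suc n)) (x + min y z) + 5/4 * tp (Suc (Suc n)) (x - y + 2 * min y z) + (y - min y z) * tp (Suc n) (x - y + 2 * min y z) / 2 - (y * tp (Suc n) x - tp (Suc (Suc n)) x + 5/4 * tp (Suc (Suc n)) (x - y) + y * tp (Suc n) (x - y) / 2)) * (tp 0 y * tp 0 z))" (is "cone_vol_is _ ?g")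
  unfolding cone_vol_is_def
proof (intro allI)
  fix x y z :: real
  show "0 \<le> (?g x y z) \<and> cone_vol ((- 1, 1, 1) # ks) x y z = ennreal (?g x y z)"
  proof (cases "0 \<le> min y z")
    case True
    show ?thesis
      proof (rule cone_vol_step[OF g True, where \<phi> = "\<lambda>t. (y - t) * tp n (x + t) - 2 * tp (Suc n) (x + t) + 2 * tp (Suc n) (x - y + 2 * t) + (y - t) * tp n (x - y + 2 * t)" and F = "\<lambda>t. (y - t) * tp (Suc n) (x + t) - tp (Suc (Suc n)) (x + t) + 5/4 * tp (Suc (Suc n)) (x - y + 2 * t) + (y - t) * tp (Suc n) (x - y + 2 * t) / 2"])
      show "continuous_on UNIV (\<lambda>t. (y - t) * tp n (x + t) - 2 * tp (Suc n) (x + t) + 2 * tp (Suc n) (x - y + 2 * t) + (y - t) * tp n (x - y + 2 * t))"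
        using n by (intro continuous_intros) auto
      show "((\<lambda>t. (y - t) * tp (Suc n) (x + t) - tp (Suc (Suc n)) (x + t) + 5/4 * tp (Suc (Suc n)) (x - y + 2 * t) + (y - t) * tp (Suc n) (x - y + 2 * t) / 2) has_real_derivative (y - t) * tp n (x + t) - 2 * tp (Suc n) (x + t) + 2 * tp (Suc n) (x - y + 2 * t) + (y - t) * tp n (x - y + 2 * t)) (at t)" for t
        using n by (auto intro!: derivative_eq_intros simp: algebra_simps add_divide_distrib diff_divide_distrib)
      show "((y - t * 1) * tp n ((x - t * (- 1))) - 2 * tp (Suc n) ((x - t * (- 1))) + 2 * tp (Suc n) ((x - t * (- 1)) - (y - t * 1)) + (y - t * 1) * tp n ((x - t * (- 1)) - (y - t * 1))) * (tp 0 (y - t * 1) * tp 0 (z - t * 1)) = (y - t) * tp n (x + t) - 2 * tp (Suc n) (x + t) + 2 * tp (Suc n) (x - y + 2 * t) + (y - t) * tp n (x - y + 2 * t)" if "0 \<le> t" "t \<le> min y z" for t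
        using that by (simp add: tp_nonneg algebra_simps)
    qed (use True n in \<open>auto simp: tp_nonneg tp_neg tp_at_0 min_less_iff_disj\<close>)
  next
    case False
    show ?thesis by (rule cone_vol_zero[OF g]) (use False in \<open>auto simp: tp_neg min_def split: if_splits\<close>)
  qed
qed

section \<open>Simplex splines as volumes of cone fibres\<close>

lemma measure_pos_full_dim:
  fixes S :: "'a::euclidean_space set"
  assumes "convex S" "compact S" "aff_dim S = DIM('a)"
  shows "0 < measure lborel S"
proof -
  have "interior S \<noteq> {}"
    using assms(1,3) by (metis rel_interior_interior aff_dim_eq_full rel_interior_eq_empty aff_dim_empty_eq of_nat_0_le_iff neg_0_le_iff_le zero_neq_neg_one not_one_le_zero)
  then have "\<not> negligible S" using assms(1) by (simp add: negligible_convex_interior)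
  then have "measure lebesgue S \<noteq> 0"
    using lmeasurable_compact[OF assms(2)] by (simp add: negligible_iff_measure)
  then show ?thesis
    using assms(2) by (simp add: measure_completion borel_compact less_le)
qed

lemma ex_lifts:
  fixes a :: "3 \<Rightarrow> real^2" and h :: "5 \<Rightarrow> real^2" and A :: "3 \<Rightarrow> real^2 \<Rightarrow> real"
  assumes A1: "\<And>x. (\<Sum>j\<in>UNIV. A j x) = 1" and Ax: "\<And>x. (\<Sum>j\<in>UNIV. A j x *\<^sub>R a j) = x"
    and Au: "\<And>u. sum u UNIV = 1 \<Longrightarrow> (\<And>j. A j (\<Sum>j\<in>UNIV. u j *\<^sub>R a j) = u j)"
  shows "\<exists>\<sigma>. lifts (image_mset (case_sum h a) (mset_set UNIV)) \<sigma>"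
proof -
  define W :: "5 + 3 \<Rightarrow> (real^2) \<times> (real^5)" where
    "W = case_sum (\<lambda>i. (h i, axis i 1)) (\<lambda>j. (a j, 0))"
  note split = UNIV_Plus_UNIV[symmetric] sum.Plus[OF finite finite]
  have indep: "l k = 0" if l: "sum l UNIV = 0" "(\<Sum>k\<in>UNIV. l k *\<^sub>R W k) = 0" for l k
  proof -
    have "0 = snd (\<Sum>k\<in>UNIV. l k *\<^sub>R W k)" using l(2) by simp
    also have "\<dots> = (\<Sum>i\<in>UNIV. l (Inl i) *\<^sub>R axis i 1)"
      unfolding split by (simp add: snd_sum W_def)
    finally have "(\<Sum>i\<in>UNIV. l (Inl i) *\<^sub>R axis i 1) $ i = (0::real^5) $ i" for i by simp
    then have Inl: "l (Inl i) = 0" for i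
      by (simp add: axis_def if_distrib[of "\<lambda>x. _ * x"] cong: if_cong)
    have "0 = fst (\<Sum>k\<in>UNIV. l k *\<^sub>R W k)" using l(2) by simp
    also have "\<dots> = (\<Sum>j\<in>UNIV. l (Inr j) *\<^sub>R a j)"
      unfolding split by (simp add: fst_sum W_def Inl)
    finally have 0: "(\<Sum>j\<in>UNIV. (A j 0 + l (Inr j)) *\<^sub>R a j) = 0"
      using Ax[of 0] by (simp add: scaleR_add_left sum.distrib)
    have "(\<Sum>j\<in>UNIV. l (Inr j)) = 0" using l(1) unfolding split by (simp add: Inl)
    then have "(\<Sum>j\<in>UNIV. A j 0 + l (Inr j)) = 1" by (simp add: sum.distrib A1)
    from Au[OF this] have "l (Inr j) = 0" for j unfolding 0 by simp
    with Inl show ?thesis by (cases k) auto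
  qed
  have "inj W"
  proof (rule injI, rule ccontr)
    fix k k' assume W: "W k = W k'" and ne: "k \<noteq> k'"
    define l :: "5 + 3 \<Rightarrow> real" where "l i = (if i = k then 1 else 0) - (if i = k' then 1 else 0)" for i
    have "sum l UNIV = 0" by (simp add: l_def sum_subtractf)
    moreover have "(\<Sum>k\<in>UNIV. l k *\<^sub>R W k) = 0"
      using W by (simp add: l_def scaleR_diff_left sum_subtractf if_distrib[of "\<lambda>x. x *\<^sub>R _"] cong: if_cong)
    ultimately have "l k = 0" by (rule indep)
    with ne show False by (simp add: l_def)
  qed
  then have ind: "\<not> affine_dependent (range W)"
    using affine_independent_range indep by blast
  have card: "card (range W) = 8"
    using \<open>inj W\<close> by (simp add: card_image card_UNIV_sum)
  have "7 simplex (convex hull (range W))"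
    unfolding simplex using ind card by (intro exI[of _ "range W"]) auto
  moreover have "{w. w extreme_point_of convex hull (range W)} = range W"
    using extreme_point_of_convex_hull_affine_independent[OF ind] by auto
  moreover have "image_mset fst (mset_set (range W)) = image_mset (case_sum h a) (mset_set UNIV)"
    unfolding image_mset_mset_set[OF \<open>inj W\<close>, symmetric] multiset.map_comp
    by (rule image_mset_cong) (auto simp: W_def split: sum.split)
  ultimately show ?thesis unfolding lifts_def by (intro exI[of _ "convex hull (range W)"]) simp
qed

text \<open>The three functions \<open>c1 * L1\<close>, \<open>c2 * L2\<close>, \<open>c3 * L3\<close> are the barycentric coordinates with respect
  to the knots \<open>a1, a2, a3\<close>; splitting off the positive constants allows coordinates without denominators.
  The normalisation of the spline goes into the unspecified factor \<open>\<kappa>\<close>.\<close>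

lemma simplex_spline_cone:
  fixes v :: "nat \<Rightarrow> real^2"
  assumes nc: "\<not> collinear {v 1, v 2, v 3}"
    and K: "knots v m = {#h1, h2, h3, h4, h5, a1, a2, a3#}"
    and L1: "\<And>x. c1 * L1 x + c2 * L2 x + c3 * L3 x = (1::real)"
    and Lx: "\<And>x. (c1 * L1 x) *\<^sub>R a1 + (c2 * L2 x) *\<^sub>R a2 + (c3 * L3 x) *\<^sub>R a3 = x"
    and Lu: "\<And>p q r. p + q + r = 1 \<Longrightarrow> c1 * L1 (p *\<^sub>R a1 + q *\<^sub>R a2 + r *\<^sub>R a3) = p
       \<and> c2 * L2 (p *\<^sub>R a1 + q *\<^sub>R a2 + r *\<^sub>R a3) = q \<and> c3 * L3 (p *\<^sub>R a1 + q *\<^sub>R a2 + r *\<^sub>R a3) = r"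
    and c: "0 < c1" "0 < c2" "0 < c3" and s: "0 < s1" "0 < s2" "0 < s3" "0 < s4" "0 < s5"
    and g: "cone_vol_is (map (\<lambda>(s, h). (s * L1 h, s * L2 h, s * L3 h)) [(s1, h1), (s2, h2), (s3, h3), (s4, h4), (s5, h5)]) g"
  shows "\<exists>\<kappa>>0. \<forall>x. simplex_spline v m x = \<kappa> * g (L1 x) (L2 x) (L3 x)"
proof -
  define a :: "3 \<Rightarrow> real^2" where "a j = (if j = 1 then a1 else if j = 2 then a2 else a3)" for j
  define A :: "3 \<Rightarrow> real^2 \<Rightarrow> real" where
    "A j x = (if j = 1 then c1 * L1 x else if j = 2 then c2 * L2 x else c3 * L3 x)" for j x
  define h :: "5 \<Rightarrow> real^2" where
    "h i = (if i = 1 then h1 else if i = 2 then h2 else if i = 3 then h3 else if i = 4 then h4 else h5)" for i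
  define s :: "5 \<Rightarrow> real" where
    "s i = (if i = 1 then s1 else if i = 2 then s2 else if i = 3 then s3 else if i = 4 then s4 else s5)" for i
  have A1: "(\<Sum>j\<in>UNIV. A j x) = 1" for x by (simp add: sum_3 A_def L1)
  have Ax: "(\<Sum>j\<in>UNIV. A j x *\<^sub>R a j) = x" for x by (simp add: sum_3 A_def a_def Lx)
  have Au: "A j (\<Sum>j\<in>UNIV. u j *\<^sub>R a j) = u j" if "sum u UNIV = 1" for u j
    using Lu[of "u 1" "u 2" "u 3"] that exhaust_3[of j] by (auto simp: sum_3 A_def a_def)
  have spos: "0 < s i" for i using s by (simp add: s_def)
  have Knots: "knots v m = image_mset (case_sum h a) (mset_set UNIV)"
  proof -
    have "mset_set (UNIV :: (5 + 3) set) = image_mset Inl (mset_set UNIV) + image_mset Inr (mset_set UNIV)"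
      unfolding UNIV_Plus_UNIV[symmetric] Plus_def
      by (subst mset_set_Union) (auto simp: image_mset_mset_set)
    then have "image_mset (case_sum h a) (mset_set UNIV) = image_mset h (mset_set UNIV) + image_mset a (mset_set UNIV)"
      by (simp add: multiset.map_comp o_def)
    moreover have "image_mset h (mset_set UNIV) = {#h1, h2, h3, h4, h5#}"
      unfolding UNIV_5 by (simp add: h_def)
    moreover have "image_mset a (mset_set UNIV) = {#a1, a2, a3#}"
      unfolding UNIV_3 by (simp add: a_def)
    ultimately show ?thesis unfolding K by (simp only: add_mset_commute union_mset_add_mset_left union_mset_add_mset_right add_0)
  qed
  define \<sigma> where "\<sigma> = (SOME \<sigma>. lifts (knots v m) \<sigma>)"
  have lift: "lifts (knots v m) \<sigma>"
    unfolding \<sigma>_def Knots by (rule someI_ex) (rule ex_lifts[OF A1 Ax Au])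
  have "\<exists>C>0. \<forall>x. measure lborel {y. (x, y) \<in> \<sigma>} =
    C * measure lborel {\<mu>::real^5. (\<forall>i. 0 \<le> \<mu> $ i) \<and> (\<forall>j. 0 \<le> A j x - (\<Sum>i\<in>UNIV. \<mu> $ i * (s i * A j (h i))))}"
    by (rule fibre_measure[OF lift[unfolded Knots] A1 Ax Au spos])
  then obtain C where C: "0 < C" and fibre: "\<And>x. measure lborel {y. (x, y) \<in> \<sigma>} =
    C * measure lborel {\<mu>::real^5. (\<forall>i. 0 \<le> \<mu> $ i) \<and> (\<forall>j. 0 \<le> A j x - (\<Sum>i\<in>UNIV. \<mu> $ i * (s i * A j (h i))))}"
    by blast
  have vol: "measure lborel {\<mu>::real^5. (\<forall>i. 0 \<le> \<mu> $ i) \<and> (\<forall>j. 0 \<le> A j x - (\<Sum>i\<in>UNIV. \<mu> $ i * (s i * A j (h i))))}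
     = g (L1 x) (L2 x) (L3 x)" for x
  proof -
    have scale: "0 \<le> c * l - (\<Sum>i\<in>UNIV. \<mu> $ i * (s i * (c * M (h i)))) \<longleftrightarrow> 0 \<le> l - (\<Sum>i\<in>UNIV. \<mu> $ i * (s i * M (h i)))"
      if "0 < c" for c l M and \<mu> :: "real^5"
    proof -
      have "c * l - (\<Sum>i\<in>UNIV. \<mu> $ i * (s i * (c * M (h i)))) = c * (l - (\<Sum>i\<in>UNIV. \<mu> $ i * (s i * M (h i))))"
        by (simp add: right_diff_distrib sum_distrib_left mult.left_commute)
      then show ?thesis using that by (simp add: zero_le_mult_iff)
    qed
    have "{\<mu>::real^5. (\<forall>i. 0 \<le> \<mu> $ i) \<and> (\<forall>j. 0 \<le> A j x - (\<Sum>i\<in>UNIV. \<mu> $ i * (s i * A j (h i))))} =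
      {\<mu>::real^5. (\<forall>i. 0 \<le> \<mu> $ i) \<and> 0 \<le> L1 x - (\<Sum>i\<in>UNIV. \<mu> $ i * (s i * L1 (h i)))
      \<and> 0 \<le> L2 x - (\<Sum>i\<in>UNIV. \<mu> $ i * (s i * L2 (h i))) \<and> 0 \<le> L3 x - (\<Sum>i\<in>UNIV. \<mu> $ i * (s i * L3 (h i)))}"
      by (simp add: forall_3 A_def scale c del: diff_ge_0_iff_ge)
    then have "emeasure lborel {\<mu>::real^5. (\<forall>i. 0 \<le> \<mu> $ i) \<and> (\<forall>j. 0 \<le> A j x - (\<Sum>i\<in>UNIV. \<mu> $ i * (s i * A j (h i))))}
       = ennreal (g (L1 x) (L2 x) (L3 x))"
      using g by (simp only: emeasure_polytope) (simp add: s_def h_def cone_vol_is_def)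
    then show ?thesis using g by (simp add: measure_def cone_vol_is_def)
  qed
  have "0 < measure lborel (macro_triangle v)"
  proof (rule measure_pos_full_dim)
    show "aff_dim (macro_triangle v) = DIM(real^2)"
      using nc aff_dim_le_DIM[of "{v 1, v 2, v 3}"]
      by (simp add: macro_triangle_def aff_dim_convex_hull collinear_aff_dim)
  qed (simp_all add: macro_triangle_def compact_convex_hull finite_imp_compact)
  moreover have "0 < measure lborel \<sigma>"
  proof (rule measure_pos_full_dim)
    have simp: "7 simplex \<sigma>" using lift by (simp add: lifts_def)
    show "aff_dim \<sigma> = DIM((real^2) \<times> (real^5))" using aff_dim_simplex[OF simp] by simp
    show "convex \<sigma>" "compact \<sigma>" using simp by (auto simp: convex_simplex compact_simplex)
  qed
  ultimately show ?thesis using C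
    by (intro exI[of _ "measure lborel (macro_triangle v) / real (7 choose 2) * (C / measure lborel \<sigma>)"])
      (simp add: simplex_spline_def \<sigma>_def[symmetric] Let_def fibre vol del: diff_ge_0_iff_ge)
qed

section \<open>Barycentric coordinates and the eight generating splines\<close>

\<comment> \<open>The vertex labels 1, 2, 3 are to be treated uniformly, so 1 is not rewritten to the successor of 0.\<close>
declare One_nat_def [simp del]

definition det3 :: "real^2 \<Rightarrow> real^2 \<Rightarrow> real^2 \<Rightarrow> real" where
  "det3 p q r = (q$1 - p$1) * (r$2 - p$2) - (q$2 - p$2) * (r$1 - p$1)"

definition bary :: "(nat \<Rightarrow> real^2) \<Rightarrow> nat \<Rightarrow> real^2 \<Rightarrow> real" where
  "bary v i x = det3 (if i = 1 then x else v 1) (if i = 2 then x else v 2) (if i = 3 then x else v 3)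
     / det3 (v 1) (v 2) (v 3)"

locale triangle =
  fixes v :: "nat \<Rightarrow> real^2"
  assumes noncollinear: "\<not> collinear {v 1, v 2, v 3}"
begin

abbreviation "b \<equiv> bary v"
abbreviation "T \<equiv> macro_triangle v"

lemma det3_nz: "det3 (v 1) (v 2) (v 3) \<noteq> 0"
  using noncollinear_det[OF noncollinear] by (simp add: det3_def)

lemma bary_sum: "b 1 x + b 2 x + b 3 x = 1"
proof -
  have "det3 x (v 2) (v 3) + det3 (v 1) x (v 3) + det3 (v 1) (v 2) x = det3 (v 1) (v 2) (v 3)"
    by (simp add: det3_def algebra_simps)
  then show ?thesis using det3_nz by (simp add: bary_def add_divide_distrib[symmetric])
qed

lemma bary_comb: "b 1 x *\<^sub>R v 1 + b 2 x *\<^sub>R v 2 + b 3 x *\<^sub>R v 3 = x"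
proof -
  have "det3 x (v 2) (v 3) * v 1 $ i + det3 (v 1) x (v 3) * v 2 $ i + det3 (v 1) (v 2) x * v 3 $ i
     = det3 (v 1) (v 2) (v 3) * x $ i" for i
    using exhaust_2[of i] by (elim disjE) (simp_all add: det3_def algebra_simps)
  then have "(det3 x (v 2) (v 3) * v 1 $ i + det3 (v 1) x (v 3) * v 2 $ i + det3 (v 1) (v 2) x * v 3 $ i)
     / det3 (v 1) (v 2) (v 3) = x $ i" for i
    using det3_nz by simp
  then show ?thesis by (simp add: vec_eq_iff bary_def add_divide_distrib)
qed

lemma bary_combination:
  assumes "p + q + r = 1"
  shows "b 1 (p *\<^sub>R v 1 + q *\<^sub>R v 2 + r *\<^sub>R v 3) = p" "b 2 (p *\<^sub>R v 1 + q *\<^sub>R v 2 + r *\<^sub>R v 3) = q"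
    "b 3 (p *\<^sub>R v 1 + q *\<^sub>R v 2 + r *\<^sub>R v 3) = r"
proof -
  let ?x = "p *\<^sub>R v 1 + q *\<^sub>R v 2 + r *\<^sub>R v 3"
  have r: "r = 1 - p - q" using assms by simp
  have "det3 ?x (v 2) (v 3) = p * det3 (v 1) (v 2) (v 3)" "det3 (v 1) ?x (v 3) = q * det3 (v 1) (v 2) (v 3)"
    "det3 (v 1) (v 2) ?x = r * det3 (v 1) (v 2) (v 3)"
    unfolding r by (simp_all add: det3_def algebra_simps)
  then show "b 1 ?x = p" "b 2 ?x = q" "b 3 ?x = r" using det3_nz by (simp_all add: bary_def)
qed

lemma bary_affine:
  assumes "p + q = 1"
  shows "b i (p *\<^sub>R x + q *\<^sub>R y) = (if i \<in> {1, 2, 3} then p * b i x + q * b i y else 1)"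
proof -
  have q: "q = 1 - p" using assms by simp
  have "det3 (p *\<^sub>R x + q *\<^sub>R y) c d = p * det3 x c d + q * det3 y c d"
    "det3 c (p *\<^sub>R x + q *\<^sub>R y) d = p * det3 c x d + q * det3 c y d"
    "det3 c d (p *\<^sub>R x + q *\<^sub>R y) = p * det3 c d x + q * det3 c d y" for c d
    unfolding q by (simp_all add: det3_def algebra_simps)
  then show ?thesis using det3_nz by (auto simp: bary_def add_divide_distrib)
qed

lemma bary_vertex [simp]:
  "b 1 (v 1) = 1" "b 1 (v 2) = 0" "b 1 (v 3) = 0" "b 2 (v 1) = 0" "b 2 (v 2) = 1" "b 2 (v 3) = 0"
  "b 3 (v 1) = 0" "b 3 (v 2) = 0" "b 3 (v 3) = 1"
  using det3_nz by (simp_all add: bary_def) (simp_all add: det3_def)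

lemma bary_midpoint: "i \<in> {1, 2, 3} \<Longrightarrow> b i (midpoint x y) = (b i x + b i y) / 2"
  using bary_affine[of "1/2" "1/2" i x y] by (auto simp: midpoint_def scaleR_add_right)

lemma triangle_bary: "x \<in> T \<longleftrightarrow> 0 \<le> b 1 x \<and> 0 \<le> b 2 x \<and> 0 \<le> b 3 x"
proof
  assume "x \<in> T"
  then obtain p q r where "0 \<le> p" "0 \<le> q" "0 \<le> r" "p + q + r = 1" "x = p *\<^sub>R v 1 + q *\<^sub>R v 2 + r *\<^sub>R v 3"
    by (auto simp: macro_triangle_def convex_hull_3)
  then show "0 \<le> b 1 x \<and> 0 \<le> b 2 x \<and> 0 \<le> b 3 x" using bary_combination[of p q r] by simp
next
  assume "0 \<le> b 1 x \<and> 0 \<le> b 2 x \<and> 0 \<le> b 3 x"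
  then show "x \<in> T"
    unfolding macro_triangle_def convex_hull_3 mem_Collect_eq
    using bary_sum[of x] bary_comb[of x] by metis
qed

text \<open>Three choices of the eliminated knots are needed: a generator in which a vertex of the triangle
  has multiplicity zero must be expanded with respect to midpoints.\<close>

lemma spline_cone_123:
  assumes K: "knots v m = {#h1, h2, h3, h4, h5, v 2, v 1, v 3#}"
    and s: "0 < s1" "0 < s2" "0 < s3" "0 < s4" "0 < s5"
    and g: "cone_vol_is (map (\<lambda>(s, h). (s * b 2 h, s * b 1 h, s * b 3 h)) [(s1, h1), (s2, h2), (s3, h3), (s4, h4), (s5, h5)]) g"
  shows "\<exists>\<kappa>>0. \<forall>x. simplex_spline v m x = \<kappa> * g (b 2 x) (b 1 x) (b 3 x)"
proof (rule simplex_spline_cone[OF noncollinear K, where ?L1.0 = "b 2" and ?L2.0 = "b 1" and ?L3.0 = "b 3"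
      and ?c1.0 = 1 and ?c2.0 = 1 and ?c3.0 = 1])
  fix x :: "real^2"
  show "1 * b 2 x + 1 * b 1 x + 1 * b 3 x = 1" using bary_sum[of x] by simp
  show "(1 * b 2 x) *\<^sub>R v 2 + (1 * b 1 x) *\<^sub>R v 1 + (1 * b 3 x) *\<^sub>R v 3 = x"
    using bary_comb[of x] by (simp add: add.commute)
next
  fix p q r :: real assume "p + q + r = 1"
  then show "1 * b 2 (p *\<^sub>R v 2 + q *\<^sub>R v 1 + r *\<^sub>R v 3) = p \<and>
    1 * b 1 (p *\<^sub>R v 2 + q *\<^sub>R v 1 + r *\<^sub>R v 3) = q \<and> 1 * b 3 (p *\<^sub>R v 2 + q *\<^sub>R v 1 + r *\<^sub>R v 3) = r"
    using bary_combination[of q p r] by (simp add: add.commute)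
qed (use s g in simp_all)

lemma spline_cone_126:
  assumes K: "knots v m = {#h1, h2, h3, h4, h5, v 1, v 2, midpoint (v 1) (v 3)#}"
    and s: "0 < s1" "0 < s2" "0 < s3" "0 < s4" "0 < s5"
    and g: "cone_vol_is (map (\<lambda>(s, h). (s * (b 1 h - b 3 h), s * b 2 h, s * b 3 h)) [(s1, h1), (s2, h2), (s3, h3), (s4, h4), (s5, h5)]) g"
  shows "\<exists>\<kappa>>0. \<forall>x. simplex_spline v m x = \<kappa> * g (b 1 x - b 3 x) (b 2 x) (b 3 x)"
proof (rule simplex_spline_cone[OF noncollinear K, where ?L1.0 = "\<lambda>x. b 1 x - b 3 x" and ?L2.0 = "b 2" and ?L3.0 = "b 3"
      and ?c1.0 = 1 and ?c2.0 = 1 and ?c3.0 = 2])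
  fix x :: "real^2"
  show "1 * (b 1 x - b 3 x) + 1 * b 2 x + 2 * b 3 x = 1" using bary_sum[of x] by simp
  show "(1 * (b 1 x - b 3 x)) *\<^sub>R v 1 + (1 * b 2 x) *\<^sub>R v 2 + (2 * b 3 x) *\<^sub>R midpoint (v 1) (v 3) = x"
    using bary_comb[of x] by (simp add: midpoint_def algebra_simps)
next
  fix p q r :: real assume 1: "p + q + r = 1"
  have eq: "p *\<^sub>R v 1 + q *\<^sub>R v 2 + r *\<^sub>R midpoint (v 1) (v 3) = (p + r / 2) *\<^sub>R v 1 + q *\<^sub>R v 2 + (r / 2) *\<^sub>R v 3"
    by (simp add: midpoint_def algebra_simps)
  show "1 * (b 1 (p *\<^sub>R v 1 + q *\<^sub>R v 2 + r *\<^sub>R midpoint (v 1) (v 3)) - b 3 (p *\<^sub>R v 1 + q *\<^sub>R v 2 + r *\<^sub>R midpoint (v 1) (v 3))) = p \<and>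
    1 * b 2 (p *\<^sub>R v 1 + q *\<^sub>R v 2 + r *\<^sub>R midpoint (v 1) (v 3)) = q \<and> 2 * b 3 (p *\<^sub>R v 1 + q *\<^sub>R v 2 + r *\<^sub>R midpoint (v 1) (v 3)) = r"
    unfolding eq using bary_combination[of "p + r / 2" q "r / 2"] 1 by simp
qed (use s g in simp_all)

lemma spline_cone_146:
  assumes K: "knots v m = {#h1, h2, h3, h4, h5, v 1, midpoint (v 1) (v 2), midpoint (v 1) (v 3)#}"
    and s: "0 < s1" "0 < s2" "0 < s3" "0 < s4" "0 < s5"
    and g: "cone_vol_is (map (\<lambda>(s, h). (s * (b 1 h - b 2 h - b 3 h), s * b 2 h, s * b 3 h)) [(s1, h1), (s2, h2), (s3, h3), (s4, h4), (s5, h5)]) g"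
  shows "\<exists>\<kappa>>0. \<forall>x. simplex_spline v m x = \<kappa> * g (b 1 x - b 2 x - b 3 x) (b 2 x) (b 3 x)"
proof (rule simplex_spline_cone[OF noncollinear K, where ?L1.0 = "\<lambda>x. b 1 x - b 2 x - b 3 x" and ?L2.0 = "b 2" and ?L3.0 = "b 3"
      and ?c1.0 = 1 and ?c2.0 = 2 and ?c3.0 = 2])
  fix x :: "real^2"
  show "1 * (b 1 x - b 2 x - b 3 x) + 2 * b 2 x + 2 * b 3 x = 1" using bary_sum[of x] by simp
  show "(1 * (b 1 x - b 2 x - b 3 x)) *\<^sub>R v 1 + (2 * b 2 x) *\<^sub>R midpoint (v 1) (v 2) + (2 * b 3 x) *\<^sub>R midpoint (v 1) (v 3) = x"
    using bary_comb[of x] by (simp add: midpoint_def algebra_simps)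
next
  fix p q r :: real assume 1: "p + q + r = 1"
  let ?x = "p *\<^sub>R v 1 + q *\<^sub>R midpoint (v 1) (v 2) + r *\<^sub>R midpoint (v 1) (v 3)"
  have "?x = (p + q / 2 + r / 2) *\<^sub>R v 1 + (q / 2) *\<^sub>R v 2 + (r / 2) *\<^sub>R v 3"
    by (simp add: midpoint_def algebra_simps)
  then show "1 * (b 1 ?x - b 2 ?x - b 3 ?x) = p \<and> 2 * b 2 ?x = q \<and> 2 * b 3 ?x = r"
    using bary_combination[of "p + q / 2 + r / 2" "q / 2" "r / 2"] 1 by simp
qed (use s g in simp_all)

lemmas knots_simps = knots_def ps_point_def eval_nat_numeral lessThan_Suc One_nat_def add_mset_commute

lemma spline_600101:
  "\<exists>\<kappa>>0. \<forall>x. simplex_spline v [6,0,0,1,0,1] x = \<kappa> * (tp 5 (b 1 x - b 2 x - b 3 x) * (tp 0 (b 2 x) * tp 0 (b 3 x)))"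
proof -
  have K: "knots v [6,0,0,1,0,1] = {#v 1, v 1, v 1, v 1, v 1, v 1, midpoint (v 1) (v 2), midpoint (v 1) (v 3)#}"
    by (simp add: knots_simps)
  have "cone_vol_is [(1, 0, 0), (1, 0, 0), (1, 0, 0), (1, 0, 0), (1, 0, 0)] (\<lambda>x y z. tp 5 x * (tp 0 y * tp 0 z))"
    using cone_vol_e1_pow[of 5] by (simp add: numeral_eq_Suc One_nat_def)
  then show ?thesis
    by (intro spline_cone_146[OF K, where ?s1.0 = 1 and ?s2.0 = 1 and ?s3.0 = 1 and ?s4.0 = 1 and ?s5.0 = 1])
      (simp_all add: bary_midpoint)
qed

lemma spline_500201:
  "\<exists>\<kappa>>0. \<forall>x. simplex_spline v [5,0,0,2,0,1] x = \<kappa> * (tp 4 (b 1 x - b 2 x - b 3 x) * tp 0 (b 3 x) * tp 1 (b 2 x))"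
proof -
  have K: "knots v [5,0,0,2,0,1] = {#midpoint (v 1) (v 2), v 1, v 1, v 1, v 1, v 1, midpoint (v 1) (v 2), midpoint (v 1) (v 3)#}"
    by (simp add: knots_simps)
  have "cone_vol_is [(0, 1, 0), (1, 0, 0), (1, 0, 0), (1, 0, 0), (1, 0, 0)] (\<lambda>x y z. tp 4 x * tp 0 z * tp 1 y)"
    using cone_vol_e1_pow[of 4]
    by (intro cone_vol_e2) (simp add: numeral_eq_Suc One_nat_def mult_ac)
  then show ?thesis
    by (intro spline_cone_146[OF K, where ?s1.0 = 2 and ?s2.0 = 1 and ?s3.0 = 1 and ?s4.0 = 1 and ?s5.0 = 1])
      (simp_all add: bary_midpoint)
qed

lemma spline_410201:
  "\<exists>\<kappa>>0. \<forall>x. simplex_spline v [4,1,0,2,0,1] x = \<kappa> * ((tp 5 (b 1 x - b 3 x) - tp 5 ((b 1 x - b 3 x) - (b 2 x)) - (b 2 x) * tp 4 ((b 1 x - b 3 x) - (b 2 x))) * (tp 0 (b 2 x) * tp 0 (b 3 x)))"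
proof -
  have K: "knots v [4,1,0,2,0,1] = {#midpoint (v 1) (v 2), midpoint (v 1) (v 2), v 1, v 1, v 1, v 1, v 2, midpoint (v 1) (v 3)#}"
    by (simp add: knots_simps)
  have "cone_vol_is [(1, 1, 0), (1, 1, 0), (1, 0, 0), (1, 0, 0), (1, 0, 0)] (\<lambda>x y z. (tp 5 x - tp 5 (x - y) - y * tp 4 (x - y)) * (tp 0 y * tp 0 z))"
    using cone_vol_pow_diag2[OF cone_vol_pow_diag[OF cone_vol_e1_pow[of 3]]] by (simp add: numeral_eq_Suc One_nat_def)
  then show ?thesis
    by (intro spline_cone_126[OF K, where ?s1.0 = 2 and ?s2.0 = 2 and ?s3.0 = 1 and ?s4.0 = 1 and ?s5.0 = 1])
      (simp_all add: bary_midpoint)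
qed

lemma spline_320201:
  "\<exists>\<kappa>>0. \<forall>x. simplex_spline v [3,2,0,2,0,1] x = \<kappa> * (((b 2 x) * tp 4 (b 1 x - b 3 x) - 2 * tp 5 (b 1 x - b 3 x) + 2 * tp 5 ((b 1 x - b 3 x) - (b 2 x)) + (b 2 x) * tp 4 ((b 1 x - b 3 x) - (b 2 x))) * (tp 0 (b 2 x) * tp 0 (b 3 x)))"
proof -
  have K: "knots v [3,2,0,2,0,1] = {#midpoint (v 1) (v 2), midpoint (v 1) (v 2), v 2, v 1, v 1, v 1, v 2, midpoint (v 1) (v 3)#}"
    by (simp add: knots_simps)
  have "cone_vol_is [(1, 1, 0), (1, 1, 0), (0, 1, 0), (1, 0, 0), (1, 0, 0)] (\<lambda>x y z. (y * tp 4 x - 2 * tp 5 x + 2 * tp 5 (x - y) + y * tp 4 (x - y)) * (tp 0 y * tp 0 z))"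
    proof -
    have "cone_vol_is [(0, 1, 0), (1, 0, 0), (1, 0, 0)] (\<lambda>x y z. tp 2 x * tp 0 z * tp 1 y)"
      using cone_vol_e1_pow[of 2] by (intro cone_vol_e2) (simp add: numeral_eq_Suc One_nat_def mult_ac)
    from cone_vol_prod_diag2[OF cone_vol_prod_diag[OF this]] show ?thesis by (simp add: numeral_eq_Suc One_nat_def)
  qed
  then show ?thesis
    by (intro spline_cone_126[OF K, where ?s1.0 = 2 and ?s2.0 = 2 and ?s3.0 = 1 and ?s4.0 = 1 and ?s5.0 = 1])
      (simp_all add: bary_midpoint)
qed

lemma spline_220211:
  "\<exists>\<kappa>>0. \<forall>x. simplex_spline v [2,2,0,2,1,1] x = \<kappa> * ((((b 2 x) - min (b 2 x) (b 3 x)) * tp 4 ((b 1 x - b 3 x) + min (b 2 x) (b 3 x)) - tp 5 ((b 1 x - b 3 x) + min (b 2 x) (b 3 x)) + 5/4 * tp 5 ((b 1 x - b 3 x) - (b 2 x) + 2 * min (b 2 x) (b 3 x)) + ((b 2 x) - min (b 2 x) (b 3 x)) * tp 4 ((b 1 x - b 3 x) - (b 2 x) + 2 * min (b 2 x) (b 3 x)) / 2 - ((b 2 x) * tp 4 ((b 1 x - b 3 x)) - tp 5 ((b 1 x - b 3 x)) + 5/4 * tp 5 ((b 1 x - b 3 x) - (b 2 x)) + (b 2 x) * tp 4 ((b 1 x - b 3 x) - (b 2 x)) / 2)) * (tp 0 (b 2 x) * tp 0 (b 3 x)))"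
proof -
  have K: "knots v [2,2,0,2,1,1] = {#midpoint (v 2) (v 3), midpoint (v 1) (v 2), midpoint (v 1) (v 2), v 2, v 1, v 1, v 2, midpoint (v 1) (v 3)#}"
    by (simp add: knots_simps)
  have "cone_vol_is [(- 1, 1, 1), (1, 1, 0), (1, 1, 0), (0, 1, 0), (1, 0, 0)] (\<lambda>x y z. ((y - min y z) * tp 4 (x + min y z) - tp 5 (x + min y z) + 5/4 * tp 5 (x - y + 2 * min y z) + (y - min y z) * tp 4 (x - y + 2 * min y z) / 2 - (y * tp 4 x - tp 5 x + 5/4 * tp 5 (x - y) + y * tp 4 (x - y) / 2)) * (tp 0 y * tp 0 z))"
    proof -
    have "cone_vol_is [(0, 1, 0), (1, 0, 0)] (\<lambda>x y z. tp 1 x * tp 0 z * tp 1 y)"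
      using cone_vol_e1_pow[of 1] by (intro cone_vol_e2) (simp add: numeral_eq_Suc One_nat_def mult_ac)
    from cone_vol_prod_diag2_skew[OF cone_vol_prod_diag2[OF cone_vol_prod_diag[OF this]]] show ?thesis by (simp add: numeral_eq_Suc One_nat_def)
  qed
  then show ?thesis
    by (intro spline_cone_126[OF K, where ?s1.0 = 2 and ?s2.0 = 2 and ?s3.0 = 2 and ?s4.0 = 1 and ?s5.0 = 1])
      (simp_all add: bary_midpoint)
qed

lemma spline_141110:
  "\<exists>\<kappa>>0. \<forall>x. simplex_spline v [1,4,1,1,1,0] x = \<kappa> * ((tp 5 (b 2 x) - tp 5 ((b 2 x) - (b 1 x)) - tp 5 ((b 2 x) - (b 3 x)) + tp 5 ((b 2 x) - (b 1 x) - (b 3 x))) * (tp 0 (b 1 x) * tp 0 (b 3 x)))"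
proof -
  have K: "knots v [1,4,1,1,1,0] = {#midpoint (v 2) (v 3), midpoint (v 1) (v 2), v 2, v 2, v 2, v 2, v 1, v 3#}"
    by (simp add: knots_simps)
  have "cone_vol_is [(1, 0, 1), (1, 1, 0), (1, 0, 0), (1, 0, 0), (1, 0, 0)] (\<lambda>x y z. (tp 5 x - tp 5 (x - y) - tp 5 (x - z) + tp 5 (x - y - z)) * (tp 0 y * tp 0 z))"
    using cone_vol_diag_skew[OF cone_vol_pow_diag[OF cone_vol_e1_pow[of 3]]] by (simp add: numeral_eq_Suc One_nat_def)
  then show ?thesis
    by (intro spline_cone_123[OF K, where ?s1.0 = 2 and ?s2.0 = 2 and ?s3.0 = 1 and ?s4.0 = 1 and ?s5.0 = 1])
      (simp_all add: bary_midpoint)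
qed

lemma spline_131210:
  "\<exists>\<kappa>>0. \<forall>x. simplex_spline v [1,3,1,2,1,0] x = \<kappa> * ((tp 5 (b 2 x) - tp 5 ((b 2 x) - (b 1 x)) - tp 5 ((b 2 x) - (b 3 x)) + tp 5 ((b 2 x) - (b 1 x) - (b 3 x)) - (b 1 x) * (tp 4 ((b 2 x) - (b 1 x)) - tp 4 ((b 2 x) - (b 1 x) - (b 3 x)))) * (tp 0 (b 1 x) * tp 0 (b 3 x)))"
proof -
  have K: "knots v [1,3,1,2,1,0] = {#midpoint (v 2) (v 3), midpoint (v 1) (v 2), midpoint (v 1) (v 2), v 2, v 2, v 2, v 1, v 3#}"
    by (simp add: knots_simps)
  have "cone_vol_is [(1, 0, 1), (1, 1, 0), (1, 1, 0), (1, 0, 0), (1, 0, 0)] (\<lambda>x y z. (tp 5 x - tp 5 (x - y) - tp 5 (x - z) + tp 5 (x - y - z) - y * (tp 4 (x - y) - tp 4 (x - y - z))) * (tp 0 y * tp 0 z))"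
    using cone_vol_diag2_skew[OF cone_vol_pow_diag2[OF cone_vol_pow_diag[OF cone_vol_e1_pow[of 2]]]] by (simp add: numeral_eq_Suc One_nat_def)
  then show ?thesis
    by (intro spline_cone_123[OF K, where ?s1.0 = 2 and ?s2.0 = 2 and ?s3.0 = 2 and ?s4.0 = 1 and ?s5.0 = 1])
      (simp_all add: bary_midpoint)
qed

lemma spline_121211:
  "\<exists>\<kappa>>0. \<forall>x. simplex_spline v [1,2,1,2,1,1] x = \<kappa> * ((min (b 1 x) (b 3 x) * tp 4 (b 2 x) - 2 * tp 5 ((b 2 x) - (b 1 x) + min (b 1 x) (b 3 x)) - tp 5 ((b 2 x) - (b 3 x) + min (b 1 x) (b 3 x)) + 3/4 * tp 5 ((b 2 x) - (b 1 x) - (b 3 x) + 2 * min (b 1 x) (b 3 x)) - ((b 1 x) - min (b 1 x) (b 3 x)) * (tp 4 ((b 2 x) - (b 1 x) + min (b 1 x) (b 3 x)) - tp 4 ((b 2 x) - (b 1 x) - (b 3 x) + 2 * min (b 1 x) (b 3 x)) / 2) + 2 * tp 5 ((b 2 x) - (b 1 x)) + tp 5 ((b 2 x) - (b 3 x)) - 3/4 * tp 5 ((b 2 x) - (b 1 x) - (b 3 x)) + (b 1 x) * (tp 4 ((b 2 x) - (b 1 x)) - tp 4 ((b 2 x) - (b 1 x) - (b 3 x)) / 2)) * (tp 0 (b 1 x) * tp 0 (b 3 x)))"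
proof -
  have K: "knots v [1,2,1,2,1,1] = {#midpoint (v 1) (v 3), midpoint (v 2) (v 3), midpoint (v 1) (v 2), midpoint (v 1) (v 2), v 2, v 2, v 1, v 3#}"
    by (simp add: knots_simps)
  have "cone_vol_is [(0, 1, 1), (1, 0, 1), (1, 1, 0), (1, 1, 0), (1, 0, 0)] (\<lambda>x y z. (min y z * tp 4 x - 2 * tp 5 (x - y + min y z) - tp 5 (x - z + min y z) + 3/4 * tp 5 (x - y - z + 2 * min y z) - (y - min y z) * (tp 4 (x - y + min y z) - tp 4 (x - y - z + 2 * min y z) / 2) + 2 * tp 5 (x - y) + tp 5 (x - z) - 3/4 * tp 5 (x - y - z) + y * (tp 4 (x - y) - tp 4 (x - y - z) / 2)) * (tp 0 y * tp 0 z))"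
    using cone_vol_diag2_skew2[OF cone_vol_diag2_skew[OF cone_vol_pow_diag2[OF cone_vol_pow_diag[OF cone_vol_e1_pow[of 1]]]]] by (simp add: numeral_eq_Suc One_nat_def)
  then show ?thesis
    by (intro spline_cone_123[OF K, where ?s1.0 = 2 and ?s2.0 = 2 and ?s3.0 = 2 and ?s4.0 = 2 and ?s5.0 = 1])
      (simp_all add: bary_midpoint)
qed

end

section \<open>Functions of class C^k\<close>

lemma C_k_on_cong:
  assumes "\<And>x. x \<in> X \<Longrightarrow> f x = g x" "C_k_on k f X"
  shows "C_k_on k g X"
proof (cases k)
  case 0 then show ?thesis using assms by (simp cong: continuous_on_cong)
next
  case (Suc m)
  then obtain f' where f': "\<And>x. x \<in> X \<Longrightarrow> (f has_derivative f' x) (at x within X)"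
    "\<forall>b\<in>Basis. C_k_on m (\<lambda>x. f' x b) X" using assms(2) by auto
  have "(g has_derivative f' x) (at x within X)" if "x \<in> X" for x
    using f'(1)[OF that] by (rule has_derivative_transform[rotated 2]) (use that assms(1) in auto)
  with f'(2) Suc show ?thesis by auto
qed

lemma C_k_on_add:
  "C_k_on k f X \<Longrightarrow> C_k_on k g X \<Longrightarrow> C_k_on k (\<lambda>x. f x + g x) X"
proof (induction k arbitrary: f g)
  case 0 then show ?case by (simp add: continuous_on_add)
next
  case (Suc k)
  then obtain f' g' where
    "\<forall>x\<in>X. (f has_derivative f' x) (at x within X)" "\<forall>b\<in>Basis. C_k_on k (\<lambda>x. f' x b) X"
    "\<forall>x\<in>X. (g has_derivative g' x) (at x within X)" "\<forall>b\<in>Basis. C_k_on k (\<lambda>x. g' x b) X" by auto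
  then show ?case using Suc.IH
    by (auto intro!: exI[of _ "\<lambda>x h. f' x h + g' x h"] has_derivative_add)
qed

lemma C_k_on_Suc_imp: "C_k_on (Suc k) f X \<Longrightarrow> C_k_on k f X"
proof (induction k arbitrary: f)
  case 0 then show ?case by (auto simp: continuous_on_eq_continuous_within intro: has_derivative_continuous)
next
  case (Suc k) then show ?case by (metis C_k_on.simps(2))
qed

lemma C_k_on_mult:
  "C_k_on k f X \<Longrightarrow> C_k_on k g X \<Longrightarrow> C_k_on k (\<lambda>x. f x * g x) X"
proof (induction k arbitrary: f g)
  case 0 then show ?case by (simp add: continuous_on_mult)
next
  case (Suc k)
  then obtain f' g' where
    f: "\<forall>x\<in>X. (f has_derivative f' x) (at x within X)" "\<forall>b\<in>Basis. C_k_on k (\<lambda>x. f' x b) X" and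
    g: "\<forall>x\<in>X. (g has_derivative g' x) (at x within X)" "\<forall>b\<in>Basis. C_k_on k (\<lambda>x. g' x b) X" by auto
  have "C_k_on k f X" "C_k_on k g X" using Suc.prems by (blast intro: C_k_on_Suc_imp)+
  then have "C_k_on k (\<lambda>x. f x * g' x b + f' x b * g x) X" if "b \<in> Basis" for b
    using f(2) g(2) that by (intro C_k_on_add Suc.IH) auto
  then show ?case using f(1) g(1)
    by (auto intro!: exI[of _ "\<lambda>x h. f x * g' x h + f' x h * g x"] has_derivative_mult)
qed

lemma C_k_on_const: "C_k_on k (\<lambda>_. c) X"
proof (induction k arbitrary: c)
  case (Suc k) then show ?case by (auto intro!: exI[of _ "\<lambda>_ _. 0"])
qed simp

lemma C_k_on_sum:
  "(\<And>i. i \<in> I \<Longrightarrow> C_k_on k (f i) X) \<Longrightarrow> C_k_on k (\<lambda>x. \<Sum>i\<in>I. f i x) X"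
  by (induction I rule: infinite_finite_induct) (auto intro: C_k_on_const C_k_on_add)

lemma C_k_on_bounded_linear:
  assumes "bounded_linear l"
  shows "C_k_on k (\<lambda>x. l x + c) X"
proof (cases k)
  case 0 then show ?thesis
    by (auto intro!: continuous_on_add continuous_on_const linear_continuous_on[OF assms])
next
  case (Suc m)
  have "((\<lambda>x. l x + c) has_derivative l) (at x within X)" for x
    using has_derivative_add_const[OF bounded_linear_imp_has_derivative[OF assms]] .
  then show ?thesis unfolding Suc by (auto intro!: exI[of _ "\<lambda>_. l"] C_k_on_const)
qed

lemma C_k_on_power: "C_k_on k f X \<Longrightarrow> C_k_on k (\<lambda>x. f x ^ n) X"
  by (induction n) (auto intro: C_k_on_const C_k_on_mult)

text \<open>All derivatives of order less than \<open>n\<close> of a truncated \<open>n\<close>-th power vanish on the line, so the two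
  sides fit together up to order \<open>n - 1\<close>.\<close>

lemma C_k_on_tp:
  assumes "bounded_linear l" "k < n"
  shows "C_k_on k (\<lambda>x. tp n (l x + c)) X"
  using assms(2)
proof (induction k arbitrary: n)
  case 0 then show ?case
    by (auto intro!: continuous_on_tp continuous_on_add continuous_on_const linear_continuous_on[OF assms(1)])
next
  case (Suc k)
  have "((\<lambda>x. tp n (l x + c)) has_derivative (\<lambda>h. tp (n - 1) (l x + c) * l h)) (at x within X)" for x
  proof -
    have "(tp n has_derivative (*) (tp (n - 1) (l x + c))) (at (l x + c))"
      using DERIV_tp[of n "l x + c"] Suc.prems by (simp add: has_field_derivative_def)
    from has_derivative_compose[OF has_derivative_add_const[OF bounded_linear_imp_has_derivative[OF assms(1)]] this]
    show ?thesis by simp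
  qed
  moreover have "C_k_on k (\<lambda>x. tp (n - 1) (l x + c) * l h) X" for h
    using Suc by (intro C_k_on_mult C_k_on_const Suc.IH) auto
  ultimately show ?case
    by (auto intro!: exI[of _ "\<lambda>x h. tp (n - 1) (l x + c) * l h"])
qed

text \<open>Along a line that crosses an edge, the polynomials on the two sides agree with the same
  one-sided derivatives of \<open>f\<close>, so their Taylor coefficients coincide up to the order of
  smoothness.\<close>

lemma line_coeffs:
  fixes f :: "'a::euclidean_space \<Rightarrow> real"
  assumes "C_k_on k f X" "0 < e"
    and "\<And>t. \<bar>t\<bar> < e \<Longrightarrow> z + t *\<^sub>R u \<in> X"
    and "\<And>t. 0 \<le> t \<Longrightarrow> t < e \<Longrightarrow> f (z + t *\<^sub>R u) = poly P t"
    and "\<And>t. - e < t \<Longrightarrow> t \<le> 0 \<Longrightarrow> f (z + t *\<^sub>R u) = poly N t"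
    and "i \<le> k"
  shows "coeff P i = coeff N i"
  using assms
proof (induction k arbitrary: f P N i)
  case 0
  then have "poly P 0 = poly N 0" by (metis add.right_neutral less_eq_real_def neg_less_0_iff_less)
  with 0 show ?case by (simp add: poly_0_coeff_0)
next
  case (Suc k)
  from Suc.prems(1) obtain f' where f': "\<And>x. x \<in> X \<Longrightarrow> (f has_derivative f' x) (at x within X)"
    "\<And>b. b \<in> Basis \<Longrightarrow> C_k_on k (\<lambda>x. f' x b) X" by auto
  show ?case
  proof (cases i)
    case 0
    have "poly P 0 = poly N 0" using Suc.prems(2,4,5) by (metis less_eq_real_def neg_less_0_iff_less)
    with 0 show ?thesis by (simp add: poly_0_coeff_0)
  next
    case (Suc j)
    define h where "h x = f' x u" for x
    have "C_k_on k (\<lambda>x. \<Sum>b\<in>Basis. (u \<bullet> b) * f' x b) X"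
      by (intro C_k_on_sum C_k_on_mult C_k_on_const f'(2))
    moreover have "(\<Sum>b\<in>Basis. (u \<bullet> b) * f' x b) = h x" if "x \<in> X" for x
    proof -
      interpret linear "f' x" using f'(1)[OF that] has_derivative_linear by blast
      have "h x = f' x (\<Sum>b\<in>Basis. (u \<bullet> b) *\<^sub>R b)" by (simp add: h_def euclidean_representation)
      then show ?thesis by (simp add: sum scale)
    qed
    ultimately have h: "C_k_on k h X" by (rule C_k_on_cong[rotated])
    have der: "((\<lambda>t. f (z + t *\<^sub>R u)) has_real_derivative h (z + t *\<^sub>R u)) (at t within {- e<..<e})"
      if "\<bar>t\<bar> < e" for t
    proof -
      have "((\<lambda>t. z + t *\<^sub>R u) has_derivative (\<lambda>t. t *\<^sub>R u)) (at t within {- e<..<e})"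
        by (auto intro!: derivative_eq_intros)
      moreover have "(f has_derivative f' (z + t *\<^sub>R u)) (at (z + t *\<^sub>R u) within (\<lambda>t. z + t *\<^sub>R u) ` {- e<..<e})"
        by (rule has_derivative_subset[OF f'(1)]) (use Suc.prems(3) that in auto)
      ultimately have "((\<lambda>t. f (z + t *\<^sub>R u)) has_derivative (\<lambda>s. f' (z + t *\<^sub>R u) (s *\<^sub>R u))) (at t within {- e<..<e})"
        by (rule has_derivative_in_compose)
      moreover have "f' (z + t *\<^sub>R u) (s *\<^sub>R u) = h (z + t *\<^sub>R u) * s" for s
        using linear_cmul[OF has_derivative_linear[OF f'(1)[OF Suc.prems(3)[OF that]]]] by (simp add: h_def mult.commute)
      ultimately show ?thesis by (simp add: has_field_derivative_def)
    qed
    have side: "h (z + t *\<^sub>R u) = poly (pderiv Q) t"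
      if I: "I \<subseteq> {- e<..<e}" "t \<in> I" "connected I" "t' \<in> I" "t' \<noteq> t" and Q: "\<And>t. t \<in> I \<Longrightarrow> f (z + t *\<^sub>R u) = poly Q t"
      for I t t' Q
    proof (rule has_field_derivative_unique)
      have "t islimpt I" using I by (intro connected_imp_perfect) auto
      then show "at t within I \<noteq> bot" by (simp add: trivial_limit_within)
      have "\<bar>t\<bar> < e" using I(1,2) by (auto simp: abs_less_iff dest!: subsetD)
      have "((\<lambda>t. f (z + t *\<^sub>R u)) has_real_derivative h (z + t *\<^sub>R u)) (at t within I)"
        by (rule has_field_derivative_subset[OF der[OF \<open>\<bar>t\<bar> < e\<close>] I(1)])
      then show "(poly Q has_real_derivative h (z + t *\<^sub>R u)) (at t within I)"
        by (rule has_field_derivative_transform_within[where d = 1]) (use I Q in auto)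
      show "(poly Q has_real_derivative poly (pderiv Q) t) (at t within I)"
        by (rule has_field_derivative_at_within[OF poly_DERIV])
    qed
    have "coeff (pderiv P) j = coeff (pderiv N) j"
    proof (rule Suc.IH[OF h \<open>0 < e\<close> Suc.prems(3)])
      fix t assume t: "0 \<le> t" "t < e"
      show "h (z + t *\<^sub>R u) = poly (pderiv P) t"
        by (rule side[of "{0..<e}" t "if t = 0 then e / 2 else 0"]) (use t Suc.prems(2,4) in auto)
    next
      fix t assume t: "- e < t" "t \<le> 0"
      show "h (z + t *\<^sub>R u) = poly (pderiv N) t"
        by (rule side[of "{- e<..0}" t "if t = 0 then - e / 2 else 0"]) (use t Suc.prems(2,5) in auto)
    qed (use Suc.prems(6) Suc in auto)
    then show ?thesis by (simp add: coeff_pderiv Suc)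
  qed
qed

section \<open>Bivariate polynomials and smooth joins\<close>

text \<open>Total degree is measured with respect to two arbitrary coordinate functions, so that a
  polynomial can be moved between Cartesian coordinates, barycentric coordinates and coordinates adapted to an edge.\<close>

definition poly2 :: "('a \<Rightarrow> real) \<Rightarrow> ('a \<Rightarrow> real) \<Rightarrow> nat \<Rightarrow> ('a \<Rightarrow> real) \<Rightarrow> bool" where
  "poly2 X Y d F \<longleftrightarrow> (\<exists>c :: nat \<Rightarrow> nat \<Rightarrow> real. \<forall>z. F z = (\<Sum>i\<le>d. \<Sum>j\<le>d-i. c i j * X z ^ i * Y z ^ j))"

lemma poly2_add: "poly2 X Y d F \<Longrightarrow> poly2 X Y d G \<Longrightarrow> poly2 X Y d (\<lambda>z. F z + G z)"
proof -
  assume "poly2 X Y d F" "poly2 X Y d G"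
  then obtain c c' where "\<forall>z. F z = (\<Sum>i\<le>d. \<Sum>j\<le>d-i. c i j * X z ^ i * Y z ^ j)"
    "\<forall>z. G z = (\<Sum>i\<le>d. \<Sum>j\<le>d-i. c' i j * X z ^ i * Y z ^ j)" by (auto simp: poly2_def)
  then show ?thesis unfolding poly2_def
    by (intro exI[of _ "\<lambda>i j. c i j + c' i j"]) (simp add: sum.distrib algebra_simps)
qed

lemma poly2_cmult: "poly2 X Y d F \<Longrightarrow> poly2 X Y d (\<lambda>z. a * F z)"
proof -
  assume "poly2 X Y d F"
  then obtain c where "\<forall>z. F z = (\<Sum>i\<le>d. \<Sum>j\<le>d-i. c i j * X z ^ i * Y z ^ j)" by (auto simp: poly2_def)
  then show ?thesis unfolding poly2_def
    by (intro exI[of _ "\<lambda>i j. a * c i j"]) (simp add: sum_distrib_left mult_ac)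
qed

lemma poly2_const: "poly2 X Y d (\<lambda>_. a)"
proof -
  have "a = (\<Sum>i\<le>d. \<Sum>j\<le>d-i. (if i = 0 \<and> j = 0 then a else 0) * x ^ i * y ^ j)" for x y :: real
  proof -
    have "(\<Sum>i\<le>d. \<Sum>j\<le>d-i. (if i = 0 \<and> j = 0 then a else 0) * x ^ i * y ^ j)
      = (\<Sum>i\<le>d. if i = 0 then a else 0)"
      by (intro sum.cong refl) (auto simp: if_distrib[of "\<lambda>u. u * _"] sum.delta cong: if_cong)
    then show ?thesis by (simp add: sum.delta)
  qed
  then show ?thesis unfolding poly2_def by (intro exI[of _ "\<lambda>i j. if i = 0 \<and> j = 0 then a else 0"] allI)
qed

lemma poly2_mult_X: "poly2 X Y d F \<Longrightarrow> poly2 X Y (Suc d) (\<lambda>z. X z * F z)"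
proof -
  assume "poly2 X Y d F"
  then obtain c where F: "\<forall>z. F z = (\<Sum>i\<le>d. \<Sum>j\<le>d-i. c i j * X z ^ i * Y z ^ j)" by (auto simp: poly2_def)
  have "X z * F z = (\<Sum>i\<le>Suc d. \<Sum>j\<le>Suc d-i. (if i = 0 then 0 else c (i - 1) j) * X z ^ i * Y z ^ j)" for z
    by (simp add: sum.atMost_Suc_shift F sum_distrib_left mult_ac del: sum.atMost_Suc)
  then show ?thesis unfolding poly2_def by (intro exI[of _ "\<lambda>i j. if i = 0 then 0 else c (i - 1) j"]) simp
qed

lemma poly2_mult_Y: "poly2 X Y d F \<Longrightarrow> poly2 X Y (Suc d) (\<lambda>z. Y z * F z)"
proof -
  assume "poly2 X Y d F"
  then obtain c where F: "\<forall>z. F z = (\<Sum>i\<le>d. \<Sum>j\<le>d-i. c i j * X z ^ i * Y z ^ j)" by (auto simp: poly2_def)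
  have "Y z * F z = (\<Sum>i\<le>Suc d. \<Sum>j\<le>Suc d-i. (if j = 0 then 0 else c i (j - 1)) * X z ^ i * Y z ^ j)" for z
  proof -
    have "(\<Sum>j\<le>Suc d-i. (if j = 0 then 0 else c i (j - 1)) * X z ^ i * Y z ^ j) =
      (\<Sum>j\<le>d-i. Y z * (c i j * X z ^ i * Y z ^ j))" if "i \<le> d" for i
      using that by (simp add: Suc_diff_le sum.atMost_Suc_shift mult_ac del: sum.atMost_Suc)
    then show ?thesis by (simp add: F sum_distrib_left)
  qed
  then show ?thesis unfolding poly2_def by (intro exI[of _ "\<lambda>i j. if j = 0 then 0 else c i (j - 1)"]) simp
qed

lemma poly2_Suc: "poly2 X Y d F \<Longrightarrow> poly2 X Y (Suc d) F"
proof -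
  assume "poly2 X Y d F"
  then obtain c where F: "\<forall>z. F z = (\<Sum>i\<le>d. \<Sum>j\<le>d-i. c i j * X z ^ i * Y z ^ j)" by (auto simp: poly2_def)
  have "F z = (\<Sum>i\<le>Suc d. \<Sum>j\<le>Suc d-i. (if i + j \<le> d then c i j else 0) * X z ^ i * Y z ^ j)" for z
  proof -
    have "(\<Sum>j\<le>Suc d-i. (if i + j \<le> d then c i j else 0) * X z ^ i * Y z ^ j) =
      (\<Sum>j\<le>d-i. c i j * X z ^ i * Y z ^ j)" if "i \<le> d" for i
      using that by (intro sum.mono_neutral_cong_right) auto
    then show ?thesis by (simp add: F)
  qed
  then show ?thesis unfolding poly2_def by (intro exI[of _ "\<lambda>i j. if i + j \<le> d then c i j else 0"]) simp
qed

lemma poly2_mono: "d \<le> e \<Longrightarrow> poly2 X Y d F \<Longrightarrow> poly2 X Y e F"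
  by (induction e rule: dec_induct) (auto intro: poly2_Suc)

lemma poly2_mult_affine:
  "poly2 X Y d F \<Longrightarrow> poly2 X Y (Suc d) (\<lambda>z. (a + p * X z + q * Y z) * F z)"
  using poly2_add[OF poly2_add[OF poly2_cmult[OF poly2_Suc, of X Y d F a] poly2_cmult[OF poly2_mult_X, of X Y d F p]]
    poly2_cmult[OF poly2_mult_Y, of X Y d F q]]
  by (simp add: algebra_simps)

lemma poly2_sum: "(\<And>i. i \<in> I \<Longrightarrow> poly2 X Y d (F i)) \<Longrightarrow> poly2 X Y d (\<lambda>z. \<Sum>i\<in>I. F i z)"
  by (induction I rule: infinite_finite_induct) (auto intro: poly2_const poly2_add)

lemma poly2_subst:
  assumes "poly2 X' Y' d F"
    and X': "\<And>z. X' z = a + p * X z + q * Y z" and Y': "\<And>z. Y' z = a' + p' * X z + q' * Y z"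
  shows "poly2 X Y d F"
proof -
  obtain c where F: "F = (\<lambda>z. (\<Sum>i\<le>d. \<Sum>j\<le>d-i. c i j * (X' z ^ i * Y' z ^ j)))"
    using assms(1) by (auto simp: poly2_def mult.assoc)
  have pow: "poly2 X Y (i + j) (\<lambda>z. X' z ^ i * Y' z ^ j)" for i j
  proof (induction i)
    case 0
    show ?case
    proof (induction j)
      case 0 show ?case using poly2_const[of X Y 0 1] by simp
    next
      case (Suc j) then show ?case using poly2_mult_affine[OF Suc, of a' p' q'] by (simp add: Y')
    qed
  next
    case (Suc i) then show ?case using poly2_mult_affine[OF Suc, of a p q] by (simp add: X' mult.assoc)
  qed
  show ?thesis unfolding F
    by (intro poly2_sum poly2_cmult poly2_mono[OF _ pow]) auto
qed

definition poly_upto :: "nat \<Rightarrow> (real^2 \<Rightarrow> real) \<Rightarrow> bool" where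
  "poly_upto d = poly2 (\<lambda>x. x $ 1) (\<lambda>x. x $ 2) d"

lemma poly_deg_le_on_iff: "poly_deg_le_on d f S \<longleftrightarrow> (\<exists>p. poly_upto d p \<and> (\<forall>x\<in>S. f x = p x))"
proof
  assume "poly_deg_le_on d f S"
  then obtain c where "\<forall>x\<in>S. f x = (\<Sum>i\<le>d. \<Sum>j\<le>d-i. c i j * (x$1)^i * (x$2)^j)"
    by (auto simp: poly_deg_le_on_def)
  then show "\<exists>p. poly_upto d p \<and> (\<forall>x\<in>S. f x = p x)"
    by (intro exI[of _ "\<lambda>x. \<Sum>i\<le>d. \<Sum>j\<le>d-i. c i j * (x$1)^i * (x$2)^j"])
      (auto simp: poly_upto_def poly2_def)
qed (auto simp: poly_deg_le_on_def poly_upto_def poly2_def)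

lemma poly_upto_mult:
  assumes "poly_upto 1 l" "poly_upto d F"
  shows "poly_upto (Suc d) (\<lambda>x. l x * F x)"
proof -
  obtain c where "\<And>x. l x = (\<Sum>i\<le>1. \<Sum>j\<le>1-i. c i j * (x $ 1) ^ i * (x $ 2) ^ j)"
    using assms(1) unfolding poly_upto_def poly2_def by blast
  then have "l x = c 0 0 + c 1 0 * x $ 1 + c 0 1 * x $ 2" for x
    by (simp add: One_nat_def)
  then show ?thesis
    using poly2_mult_affine[of "\<lambda>x. x $ 1" "\<lambda>x. x $ 2" d F "c 0 0" "c 1 0" "c 0 1"] assms(2)
    by (simp add: poly_upto_def)
qed

lemma poly_upto_power: "poly_upto 1 l \<Longrightarrow> poly_upto n (\<lambda>x. l x ^ n)"
proof (induction n)
  case 0 show ?case by (simp add: poly_upto_def poly2_const)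
next
  case (Suc n) then show ?case using poly_upto_mult[of l n] by simp
qed

lemma C_k_on_poly:
  assumes "poly_upto d p" shows "C_k_on k p X"
proof -
  obtain c where p: "p = (\<lambda>x. \<Sum>i\<le>d. \<Sum>j\<le>d-i. c i j * (x $ 1) ^ i * (x $ 2) ^ j)"
    using assms unfolding poly_upto_def poly2_def by auto
  have "C_k_on k (\<lambda>x::real^2. x $ i) X" for i
    using C_k_on_bounded_linear[OF bounded_linear_vec_nth[of i], of k 0 X] by simp
  then show ?thesis unfolding p
    by (intro C_k_on_sum C_k_on_mult C_k_on_const C_k_on_power)
qed

lemma poly_zero_interval:
  fixes a :: "nat \<Rightarrow> real"
  assumes "0 < \<delta>" "\<And>x. \<bar>x\<bar> < \<delta> \<Longrightarrow> (\<Sum>i\<le>n. a i * x ^ i) = 0" "i \<le> n"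
  shows "a i = 0"
proof -
  define P where "P = (\<Sum>i\<le>n. monom (a i) i)"
  have "{- \<delta><..<\<delta>} \<subseteq> {x. poly P x = 0}"
    using assms(2) by (auto simp: P_def poly_sum poly_monom abs_less_iff)
  moreover have "infinite {- \<delta><..<\<delta>}" using assms(1) by (simp add: infinite_Ioo)
  ultimately have "P = 0" using poly_roots_finite finite_subset by blast
  moreover have "coeff P i = a i" using assms(3) by (simp add: P_def coeff_sum)
  ultimately show ?thesis by simp
qed

lemma coeff_slice:
  assumes "j \<le> d"
  shows "coeff (\<Sum>i\<le>d. \<Sum>k\<le>d-i. monom (c i k * r ^ i) k) j = (\<Sum>i\<le>d-j. c i j * (r::real) ^ i)"
proof -
  have "coeff (\<Sum>i\<le>d. \<Sum>k\<le>d-i. monom (c i k * r ^ i) k) j = (\<Sum>i\<le>d. if j \<le> d - i then c i j * r ^ i else 0)"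
    by (simp add: coeff_sum sum.delta)
  also have "\<dots> = (\<Sum>i\<le>d-j. c i j * r ^ i)"
    using assms by (intro sum.mono_neutral_cong_right) auto
  finally show ?thesis .
qed

text \<open>In coordinates along and across the line, each of the first four coefficients of the difference in the transversal
  direction is a polynomial that vanishes on an interval, by \<open>line_coeffs\<close>. What is left of a quintic is
  the fourth power of the transversal coordinate times an affine function.\<close>

lemma smooth_join:
  fixes s :: "real^2 \<Rightarrow> real"
  assumes C: "C_k_on 3 s X" and U: "open U" "U \<subseteq> X" "z \<in> U"
    and l: "\<And>x. l x = n \<bullet> x + m" "n \<noteq> 0" "l z = 0"
    and p: "poly_upto 5 p" "poly_upto 5 p'"
    and sp: "\<And>x. x \<in> U \<Longrightarrow> 0 \<le> l x \<Longrightarrow> s x = p x" "\<And>x. x \<in> U \<Longrightarrow> l x \<le> 0 \<Longrightarrow> s x = p' x"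
  shows "\<exists>q. poly_upto 1 q \<and> (\<forall>x. p x - p' x = l x ^ 4 * q x)"
proof -
  define D where "D = (n $ 1)\<^sup>2 + (n $ 2)\<^sup>2"
  have D: "D \<noteq> 0" using l(2) by (auto simp: D_def sum_power2_eq_zero_iff vec_eq_iff forall_2)
  define u :: "real^2" where "u = (\<chi> i. n $ i / D)"
  \<comment> \<open>w points along the line, u across it with unit rate of change of l\<close>
  define w :: "real^2" where "w = (\<chi> i. if i = 1 then - n $ 2 else n $ 1)"
  define r where "r x = ((x $ 2 - z $ 2) * n $ 1 - (x $ 1 - z $ 1) * n $ 2) / D" for x :: "real^2"
  have lx: "l x = n $ 1 * x $ 1 + n $ 2 * x $ 2 + m" for x by (simp add: l(1) inner_vec_def sum_2)
  have l2: "l x = n $ 1 * (x $ 1 - z $ 1) + n $ 2 * (x $ 2 - z $ 2)" for x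
    using l(3) unfolding lx by (simp add: algebra_simps)
  have Dr: "D * r x = (x $ 2 - z $ 2) * n $ 1 - (x $ 1 - z $ 1) * n $ 2" for x
    using D by (simp add: r_def)
  have x1: "x $ 1 = z $ 1 + (- n $ 2) * r x + (n $ 1 / D) * l x"
    and x2: "x $ 2 = z $ 2 + n $ 1 * r x + (n $ 2 / D) * l x" for x
  proof -
    have "D * (x $ 1 - z $ 1) = (- n $ 2) * (D * r x) + n $ 1 * l x"
      "D * (x $ 2 - z $ 2) = n $ 1 * (D * r x) + n $ 2 * l x"
      unfolding l2 Dr by (simp_all add: D_def power2_eq_square algebra_simps)
    then show "x $ 1 = z $ 1 + (- n $ 2) * r x + (n $ 1 / D) * l x"
      "x $ 2 = z $ 2 + n $ 1 * r x + (n $ 2 / D) * l x"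
      using D by (simp_all add: field_simps)
  qed
  have rt: "r (z + \<rho> *\<^sub>R w + t *\<^sub>R u) = \<rho>" "l (z + \<rho> *\<^sub>R w + t *\<^sub>R u) = t" for \<rho> t
  proof -
    have "D * r (z + \<rho> *\<^sub>R w + t *\<^sub>R u) = D * \<rho>" "D * l (z + \<rho> *\<^sub>R w + t *\<^sub>R u) = D * t"
      unfolding l2 Dr using D by (simp_all add: w_def u_def field_simps) (simp_all add: D_def power2_eq_square algebra_simps)
    then show "r (z + \<rho> *\<^sub>R w + t *\<^sub>R u) = \<rho>" "l (z + \<rho> *\<^sub>R w + t *\<^sub>R u) = t" using D by simp_all
  qed
  have "poly2 r l 5 p" "poly2 r l 5 p'"
    by (rule poly2_subst[where X' = "\<lambda>x. x $ 1" and Y' = "\<lambda>x. x $ 2", OF _ x1 x2];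
      use p in \<open>simp add: poly_upto_def\<close>)+
  then obtain c c' where c: "\<And>x. p x = (\<Sum>i\<le>5. \<Sum>j\<le>5-i. c i j * r x ^ i * l x ^ j)"
    and c': "\<And>x. p' x = (\<Sum>i\<le>5. \<Sum>j\<le>5-i. c' i j * r x ^ i * l x ^ j)"
    unfolding poly2_def by blast
  obtain e where e: "0 < e" "ball z e \<subseteq> U" using U by (meson open_contains_ball)
  define \<delta> where "\<delta> = e / (norm w + norm u + 1)"
  have pos: "0 < norm w + norm u + 1" by (smt (verit) norm_ge_zero)
  then have \<delta>: "0 < \<delta>" using e by (simp add: \<delta>_def)
  have inU: "z + \<rho> *\<^sub>R w + t *\<^sub>R u \<in> U" if "\<bar>\<rho>\<bar> < \<delta>" "\<bar>t\<bar> < \<delta>" for \<rho> t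
  proof -
    have "norm (\<rho> *\<^sub>R w + t *\<^sub>R u) \<le> \<bar>\<rho>\<bar> * norm w + \<bar>t\<bar> * norm u"
      by (metis norm_scaleR norm_triangle_ineq)
    also have "\<dots> \<le> \<delta> * norm w + \<delta> * norm u"
      using that by (intro add_mono mult_right_mono) auto
    also have "\<dots> < \<delta> * (norm w + norm u + 1)" using \<delta> by (simp add: algebra_simps)
    also have "\<dots> = e" using pos by (simp add: \<delta>_def)
    finally have "z + \<rho> *\<^sub>R w + t *\<^sub>R u \<in> ball z e"
      by (simp add: dist_norm add.assoc norm_minus_commute add.commute)
    then show ?thesis using e(2) by blast
  qed
  have "c i j = c' i j" if "j \<le> 3" "i \<le> 5 - j" for i j
  proof -
    have "(\<Sum>i\<le>5-j. (c i j - c' i j) * \<rho> ^ i) = 0" if \<rho>: "\<bar>\<rho>\<bar> < \<delta>" for \<rho>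
    proof -
      let ?P = "\<lambda>c. \<Sum>i\<le>5. \<Sum>k\<le>5-i. monom (c i k * \<rho> ^ i) k"
      have "coeff (?P c) j = coeff (?P c') j"
      proof (rule line_coeffs[OF C \<delta>])
        show "z + \<rho> *\<^sub>R w + t *\<^sub>R u \<in> X" if "\<bar>t\<bar> < \<delta>" for t
          using inU[OF \<rho> that] U(2) by blast
        show "s (z + \<rho> *\<^sub>R w + t *\<^sub>R u) = poly (?P c) t" if "0 \<le> t" "t < \<delta>" for t
          using inU[OF \<rho>, of t] sp(1)[of "z + \<rho> *\<^sub>R w + t *\<^sub>R u"] that by (simp add: rt c poly_sum poly_monom)
        show "s (z + \<rho> *\<^sub>R w + t *\<^sub>R u) = poly (?P c') t" if "- \<delta> < t" "t \<le> 0" for t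
          using inU[OF \<rho>, of t] sp(2)[of "z + \<rho> *\<^sub>R w + t *\<^sub>R u"] that by (simp add: rt c' poly_sum poly_monom)
      qed (use \<open>j \<le> 3\<close> in simp)
      then show ?thesis using \<open>j \<le> 3\<close> by (simp add: coeff_slice left_diff_distrib sum_subtractf)
    qed
    from poly_zero_interval[OF \<delta> this \<open>i \<le> 5 - j\<close>] show ?thesis by simp
  qed
  then have diff: "p x - p' x = l x ^ 4 * ((c 0 4 - c' 0 4) + (c 1 4 - c' 1 4) * r x + (c 0 5 - c' 0 5) * l x)" for x
    unfolding c c' by (simp add: eval_nat_numeral algebra_simps One_nat_def)
  define q where "q x = (c 0 4 - c' 0 4) + (c 1 4 - c' 1 4) * r x + (c 0 5 - c' 0 5) * l x" for x
  have "poly2 r l 1 q"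
    unfolding q_def using poly2_mult_affine[OF poly2_const[of r l 0 1]] by (simp add: One_nat_def)
  moreover have "r x = ((z $ 1 * n $ 2 - z $ 2 * n $ 1) / D) + (- n $ 2 / D) * x $ 1 + (n $ 1 / D) * x $ 2" for x
    by (simp add: r_def field_simps diff_divide_distrib add_divide_distrib)
  moreover have "l x = m + n $ 1 * x $ 1 + n $ 2 * x $ 2" for x by (simp add: lx)
  ultimately have "poly_upto 1 q" unfolding poly_upto_def by (rule poly2_subst[where X' = r and Y' = l])
  then show ?thesis using diff unfolding q_def by blast
qed

section \<open>Half-planes and the segments of the split\<close>

definition affine_fun :: "(real^2 \<Rightarrow> real) \<Rightarrow> bool" where
  "affine_fun l \<longleftrightarrow> (\<exists>n m. \<forall>x. l x = n \<bullet> x + m)"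

lemma affine_fun_add: "affine_fun f \<Longrightarrow> affine_fun g \<Longrightarrow> affine_fun (\<lambda>x. f x + g x)"
proof -
  assume "affine_fun f" "affine_fun g"
  then obtain n m n' m' where "\<forall>x. f x = n \<bullet> x + m" "\<forall>x. g x = n' \<bullet> x + m'" by (auto simp: affine_fun_def)
  then show ?thesis unfolding affine_fun_def
    by (intro exI[of _ "n + n'"] exI[of _ "m + m'"]) (simp add: inner_add_left)
qed

lemma affine_fun_cmult: "affine_fun f \<Longrightarrow> affine_fun (\<lambda>x. c * f x)"
proof -
  assume "affine_fun f"
  then obtain n m where "\<forall>x. f x = n \<bullet> x + m" by (auto simp: affine_fun_def)
  then show ?thesis unfolding affine_fun_def
    by (intro exI[of _ "c *\<^sub>R n"] exI[of _ "c * m"]) (simp add: algebra_simps)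
qed

lemma affine_fun_const: "affine_fun (\<lambda>_. c)"
  unfolding affine_fun_def by (intro exI[of _ 0] exI[of _ c]) simp

lemma affine_fun_diff: "affine_fun f \<Longrightarrow> affine_fun g \<Longrightarrow> affine_fun (\<lambda>x. f x - g x)"
  using affine_fun_add[of f "\<lambda>x. (- 1) * g x"] affine_fun_cmult[of g "- 1"] by simp

lemmas affine_fun_intros = affine_fun_add affine_fun_diff affine_fun_cmult affine_fun_const

lemma affine_fun_poly: "affine_fun l \<longleftrightarrow> poly_upto 1 l"
proof
  assume "affine_fun l"
  then obtain n m where l: "\<And>x. l x = n \<bullet> x + m" by (auto simp: affine_fun_def)
  have "poly2 (\<lambda>x. x $ 1) (\<lambda>x. x $ 2) (Suc 0) (\<lambda>x::real^2. (m + n $ 1 * x $ 1 + n $ 2 * x $ 2) * 1)"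
    by (intro poly2_mult_affine poly2_const)
  then show "poly_upto 1 l" by (simp add: poly_upto_def l[abs_def] inner_vec_def sum_2 One_nat_def algebra_simps)
next
  assume "poly_upto 1 l"
  then obtain c where "\<And>x. l x = (\<Sum>i\<le>1. \<Sum>j\<le>1-i. c i j * (x $ 1) ^ i * (x $ 2) ^ j)"
    unfolding poly_upto_def poly2_def by blast
  then have "l x = vector [c 1 0, c 0 1] \<bullet> x + c 0 0" for x
    by (simp add: One_nat_def inner_vec_def sum_2)
  then show "affine_fun l" unfolding affine_fun_def by blast
qed

lemma affine_fun_combination:
  assumes "affine_fun l" "p + q = 1"
  shows "l (p *\<^sub>R x + q *\<^sub>R y) = p * l x + q * l y"
proof -
  obtain n m where l: "\<And>x. l x = n \<bullet> x + m" using assms(1) by (auto simp: affine_fun_def)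
  have "p * l x + q * l y = p * (n \<bullet> x) + q * (n \<bullet> y) + (p + q) * m"
    unfolding l by (simp add: algebra_simps)
  then show ?thesis unfolding l using assms(2) by (simp add: inner_add_right)
qed

lemma affine_fun_continuous: "affine_fun l \<Longrightarrow> continuous_on S l"
proof -
  assume "affine_fun l"
  then obtain n m where "l = (\<lambda>x. n \<bullet> x + m)" by (auto simp: affine_fun_def)
  then show ?thesis by (auto intro!: continuous_intros)
qed

lemma C_k_on_tp_affine: "affine_fun l \<Longrightarrow> k < n \<Longrightarrow> C_k_on k (\<lambda>x. tp n (l x)) X"
proof -
  assume "affine_fun l" and k: "k < n"
  then obtain a m where l: "l = (\<lambda>x. a \<bullet> x + m)" by (auto simp: affine_fun_def)
  show ?thesis unfolding l by (intro C_k_on_tp k bounded_linear_inner_right)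
qed

definition half_planes :: "(real^2 \<Rightarrow> real) set \<Rightarrow> (real^2) set" where
  "half_planes A = {x. \<forall>l\<in>A. 0 < l x}"

lemma convex_half_planes:
  assumes "\<And>l. l \<in> A \<Longrightarrow> affine_fun l"
  shows "convex (half_planes A)"
  unfolding convex_def half_planes_def
proof (intro ballI allI impI CollectI)
  fix x y l and u w :: real
  assume x: "x \<in> {x. \<forall>l\<in>A. 0 < l x}" and y: "y \<in> {x. \<forall>l\<in>A. 0 < l x}" and u: "0 \<le> u" "0 \<le> w" "u + w = 1" and l: "l \<in> A"
  have "0 < l x" "0 < l y" using x y l by auto
  then have "0 < u * l x + w * l y"
    using u by (cases "u = 0") (auto intro: add_pos_nonneg)
  then show "0 < l (u *\<^sub>R x + w *\<^sub>R y)" using affine_fun_combination[OF assms[OF l] u(3)] by simp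
qed

lemma open_half_planes:
  assumes "finite A" "\<And>l. l \<in> A \<Longrightarrow> affine_fun l"
  shows "open (half_planes A)"
proof -
  have "half_planes A = (\<Inter>l\<in>A. {x. 0 < l x})" by (auto simp: half_planes_def)
  moreover have "open {x. 0 < l x}" if "l \<in> A" for l
    using affine_fun_continuous[OF assms(2)[OF that]] by (intro open_Collect_less continuous_on_const)
  ultimately show ?thesis using assms(1) by auto
qed

lemma closure_half_planes:
  assumes A: "\<And>l. l \<in> A \<Longrightarrow> affine_fun l" and c: "c \<in> half_planes A" and x: "\<And>l. l \<in> A \<Longrightarrow> 0 \<le> l x"
  shows "x \<in> closure (half_planes A)"
  unfolding closure_approachable
proof (intro allI impI)
  fix e :: real assume e: "0 < e"
  define t where "t = min 1 (e / (norm (c - x) + 1))"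
  have pos: "0 < norm (c - x) + 1" by (smt (verit) norm_ge_zero)
  then have t: "0 < t" "t \<le> 1" "t * (norm (c - x) + 1) \<le> e"
    using e by (simp_all add: t_def pos_le_divide_eq[symmetric])
  define y where "y = (1 - t) *\<^sub>R x + t *\<^sub>R c"
  have "y \<in> half_planes A"
    unfolding half_planes_def mem_Collect_eq
  proof
    fix l assume l: "l \<in> A"
    have "0 < t * l c" using c l t by (simp add: half_planes_def)
    moreover have "0 \<le> (1 - t) * l x" using x[OF l] t by simp
    ultimately show "0 < l y" unfolding y_def by (subst affine_fun_combination[OF A[OF l]]) auto
  qed
  moreover have "dist y x < e"
  proof -
    have "y - x = t *\<^sub>R (c - x)" by (simp add: y_def algebra_simps)
    then have "dist y x = t * norm (c - x)" using t by (simp add: dist_norm)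
    also have "\<dots> < t * (norm (c - x) + 1)" using t by simp
    finally show ?thesis using t(3) by linarith
  qed
  ultimately show "\<exists>y\<in>half_planes A. dist y x < e" by blast
qed

text \<open>Only finitely many points are needed, since the unknown coefficients enter linearly.\<close>

lemma quartic_indep2:
  fixes a0 a1 a2 c0 c1 c2 :: real
  assumes eq: "\<And>x y. x ^ 4 * (a0 + a1 * x + a2 * y) = y ^ 4 * (c0 + c1 * x + c2 * y)"
  shows "a0 = 0" "a1 = 0" "a2 = 0"
proof -
  have "a0 + a1 = 0" using eq[of 1 0] by simp
  moreover have "a0 - a1 = 0" using eq[of "-1" 0] by simp
  moreover have "c0 + c2 = 0" using eq[of 0 1] by simp
  moreover have "c0 - c2 = 0" using eq[of 0 "-1"] by simp
  moreover have "a0 + a1 + a2 = c0 + c1 + c2" using eq[of 1 1] by simp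
  moreover have "a0 + a1 - a2 = c0 + c1 - c2" using eq[of 1 "-1"] by simp
  ultimately show "a0 = 0" "a1 = 0" "a2 = 0" by linarith+
qed

lemma quartic_indep3:
  fixes a0 a1 a2 c0 c1 c2 d0 d1 d2 :: real
  assumes eq: "\<And>x y. x ^ 4 * (a0 + a1 * x + a2 * y) + y ^ 4 * (c0 + c1 * x + c2 * y) + (x + y) ^ 4 * (d0 + d1 * x + d2 * y) = 0"
  shows "a0 = 0 \<and> a1 = 0 \<and> a2 = 0 \<and> c0 = 0 \<and> c1 = 0 \<and> c2 = 0 \<and> d0 = 0 \<and> d1 = 0 \<and> d2 = 0"
proof -
  have "1 * a0 + 1 * a1 + 1 * d0 + 1 * d1 = 0"
    using eq[of 1 0] by (simp add: algebra_simps)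
  moreover have "1 * a0 + (-1) * a1 + 1 * d0 + (-1) * d1 = 0"
    using eq[of "-1" 0] by (simp add: algebra_simps)
  moreover have "1 * c0 + 1 * c2 + 1 * d0 + 1 * d2 = 0"
    using eq[of 0 1] by (simp add: algebra_simps)
  moreover have "1 * c0 + (-1) * c2 + 1 * d0 + (-1) * d2 = 0"
    using eq[of 0 "-1"] by (simp add: algebra_simps)
  moreover have "1 * a0 + 1 * a1 + (-1) * a2 + 1 * c0 + 1 * c1 + (-1) * c2 = 0"
    using eq[of 1 "-1"] by (simp add: algebra_simps)
  moreover have "1 * a0 + (-1) * a1 + 1 * a2 + 1 * c0 + (-1) * c1 + 1 * c2 = 0"
    using eq[of "-1" 1] by (simp add: algebra_simps)
  moreover have "1 * a0 + 1 * a1 + 1 * a2 + 1 * c0 + 1 * c1 + 1 * c2 + 16 * d0 + 16 * d1 + 16 * d2 = 0"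
    using eq[of 1 1] by (simp add: algebra_simps)
  moreover have "1 * a0 + (-1) * a1 + (-1) * a2 + 1 * c0 + (-1) * c1 + (-1) * c2 + 16 * d0 + (-16) * d1 + (-16) * d2 = 0"
    using eq[of "-1" "-1"] by (simp add: algebra_simps)
  moreover have "1 * a0 + 1 * a1 + (-2) * a2 + 16 * c0 + 16 * c1 + (-32) * c2 + 1 * d0 + 1 * d1 + (-2) * d2 = 0"
    using eq[of 1 "-2"] by (simp add: algebra_simps)
  moreover have "16 * a0 + 32 * a1 + (-16) * a2 + 1 * c0 + 2 * c1 + (-1) * c2 + 1 * d0 + 2 * d1 + (-1) * d2 = 0"
    using eq[of 2 "-1"] by (simp add: algebra_simps)
  ultimately show ?thesis by (intro conjI; linarith)
qed

context triangle
begin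

lemma affine_fun_bary: "affine_fun (b i)"
proof -
  have "affine_fun (\<lambda>x. det3 x p q)" "affine_fun (\<lambda>x. det3 p x q)" "affine_fun (\<lambda>x. det3 p q x)" for p q
  proof -
    show "affine_fun (\<lambda>x. det3 x p q)" unfolding affine_fun_def
      by (intro exI[of _ "vector [p $ 2 - q $ 2, q $ 1 - p $ 1]"] exI[of _ "p $ 1 * q $ 2 - p $ 2 * q $ 1"])
        (simp add: det3_def inner_vec_def sum_2 algebra_simps)
    show "affine_fun (\<lambda>x. det3 p x q)" unfolding affine_fun_def
      by (intro exI[of _ "vector [q $ 2 - p $ 2, p $ 1 - q $ 1]"] exI[of _ "q $ 1 * p $ 2 - q $ 2 * p $ 1"])
        (simp add: det3_def inner_vec_def sum_2 algebra_simps)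
    show "affine_fun (\<lambda>x. det3 p q x)" unfolding affine_fun_def
      by (intro exI[of _ "vector [p $ 2 - q $ 2, q $ 1 - p $ 1]"] exI[of _ "p $ 1 * q $ 2 - p $ 2 * q $ 1"])
        (simp add: det3_def inner_vec_def sum_2 algebra_simps)
  qed
  note aff = this affine_fun_const
  have "b i = (\<lambda>x. (1 / det3 (v 1) (v 2) (v 3)) * det3 (if i = 1 then x else v 1) (if i = 2 then x else v 2) (if i = 3 then x else v 3))"
    by (simp add: fun_eq_iff bary_def)
  moreover have "affine_fun (\<lambda>x. (1 / det3 (v 1) (v 2) (v 3)) * det3 (if i = 1 then x else v 1) (if i = 2 then x else v 2) (if i = 3 then x else v 3))"
    by (intro affine_fun_cmult) (cases "i = 1"; cases "i = 2"; cases "i = 3"; simp add: aff)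
  ultimately show ?thesis by simp
qed

definition perm3 :: "nat \<Rightarrow> nat \<Rightarrow> nat \<Rightarrow> bool" where
  "perm3 i j k \<longleftrightarrow> (i, j, k) \<in> {(1,2,3),(1,3,2),(2,1,3),(2,3,1),(3,1,2),(3,2,1)}"

lemma perm3_cases:
  assumes "perm3 i j k"
  obtains "i = 1" "j = 2" "k = 3" | "i = 1" "j = 3" "k = 2" | "i = 2" "j = 1" "k = 3"
    | "i = 2" "j = 3" "k = 1" | "i = 3" "j = 1" "k = 2" | "i = 3" "j = 2" "k = 1"
  using assms unfolding perm3_def by auto

lemma perm3_swap: "perm3 i j k \<Longrightarrow> perm3 j i k" "perm3 i j k \<Longrightarrow> perm3 i k j"
  by (auto elim!: perm3_cases simp: perm3_def)

lemma perm3_sum: "perm3 i j k \<Longrightarrow> b i x + b j x + b k x = 1"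
  using bary_sum[of x] by (auto elim!: perm3_cases)

lemma perm3_triangle: "perm3 i j k \<Longrightarrow> x \<in> T \<longleftrightarrow> 0 \<le> b i x \<and> 0 \<le> b j x \<and> 0 \<le> b k x"
  by (auto elim!: perm3_cases simp: triangle_bary)

lemma perm3_comb: "perm3 i j k \<Longrightarrow> b i x *\<^sub>R v i + b j x *\<^sub>R v j + b k x *\<^sub>R v k = x"
  using bary_comb[of x] by (auto elim!: perm3_cases simp: add_ac)

lemma ex_bary:
  assumes "perm3 i j k" "p + q + r = 1"
  shows "\<exists>x. b i x = p \<and> b j x = q \<and> b k x = r"
proof -
  have *: "\<exists>x. b 1 x = p1 \<and> b 2 x = p2 \<and> b 3 x = p3" if "p1 + p2 + p3 = 1" for p1 p2 p3
    using bary_combination[OF that] by blast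
  from assms(1) show ?thesis
  proof (cases rule: perm3_cases)
    case 1 then show ?thesis using *[of p q r] assms(2) by auto
  next
    case 2 then show ?thesis using *[of p r q] assms(2) by (auto simp: add_ac)
  next
    case 3 then show ?thesis using *[of q p r] assms(2) by (auto simp: add_ac)
  next
    case 4 then show ?thesis using *[of r p q] assms(2) by (auto simp: add_ac)
  next
    case 5 then show ?thesis using *[of q r p] assms(2) by (auto simp: add_ac)
  next
    case 6 then show ?thesis using *[of r q p] assms(2) by (auto simp: add_ac)
  qed
qed

text \<open>Along a segment between two of the six points one of nine affine functions vanishes identically.\<close>

lemma segments_bary:
  assumes "x \<in> ps12_segments v"
  shows "b 1 x = b 2 x \<or> b 1 x = b 3 x \<or> b 2 x = b 3 x \<or> 2 * b 1 x = 1 \<or> 2 * b 2 x = 1 \<or> 2 * b 3 x = 1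
    \<or> b 1 x = 0 \<or> b 2 x = 0 \<or> b 3 x = 0"
proof -
  obtain i j u where ij: "i \<in> {1..6}" "j \<in> {1..6}" and x: "x = (1 - u) *\<^sub>R ps_point v i + u *\<^sub>R ps_point v j"
    using assms unfolding ps12_segments_def closed_segment_def by blast
  have bx: "b l x = (1 - u) * b l (ps_point v i) + u * b l (ps_point v j)" for l
    unfolding x by (rule affine_fun_combination[OF affine_fun_bary]) simp
  have "{1..6::nat} = {1, 2, 3, 4, 5, 6}" by auto
  with ij have "i = 1 \<or> i = 2 \<or> i = 3 \<or> i = 4 \<or> i = 5 \<or> i = 6" "j = 1 \<or> j = 2 \<or> j = 3 \<or> j = 4 \<or> j = 5 \<or> j = 6" by auto
  then show ?thesis
    by (elim disjE; simp add: bx ps_point_def bary_midpoint field_simps)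
qed

lemma in_segmentsI:
  "x \<in> closed_segment (ps_point v m) (ps_point v m') \<Longrightarrow> m \<in> {1..6} \<Longrightarrow> m' \<in> {1..6} \<Longrightarrow> x \<in> ps12_segments v"
  unfolding ps12_segments_def by blast

text \<open>Conversely the medians and midlines meet the triangle only in segments of the split, so none of
  the six lines passes through the interior of a face.\<close>

lemma median_in_segments:
  assumes "perm3 i j k" "x \<in> T" "b i x = b j x"
  shows "x \<in> ps12_segments v"
proof -
  have k: "1 - 2 * b i x = b k x" using perm3_sum[OF assms(1), of x] assms(3) by simp
  have "x = (1 - 2 * b i x) *\<^sub>R v k + (2 * b i x) *\<^sub>R midpoint (v i) (v j)"
    unfolding k using perm3_comb[OF assms(1), of x] assms(3) by (simp add: midpoint_def scaleR_add_right add_ac)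
  moreover have "0 \<le> 2 * b i x" "2 * b i x \<le> 1"
    using perm3_sum[OF assms(1), of x] assms by (auto simp: perm3_triangle)
  ultimately have "x \<in> closed_segment (v k) (midpoint (v i) (v j))"
    unfolding closed_segment_def by blast
  moreover have "v k = ps_point v k" "k \<in> {1..6}" using assms(1) by (auto elim!: perm3_cases simp: ps_point_def)
  moreover obtain m where "midpoint (v i) (v j) = ps_point v m" "m \<in> {1..6}"
  proof -
    have "midpoint (v i) (v j) = ps_point v 4 \<or> midpoint (v i) (v j) = ps_point v 5 \<or> midpoint (v i) (v j) = ps_point v 6"
      using assms(1) by (elim perm3_cases) (simp_all add: ps_point_def midpoint_sym)
    then show ?thesis using that[of 4] that[of 5] that[of 6] by auto
  qed
  ultimately show ?thesis by (metis in_segmentsI)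
qed

lemma midline_in_segments:
  assumes "perm3 i j k" "x \<in> T" "2 * b i x = 1"
  shows "x \<in> ps12_segments v"
proof -
  have s: "1 - 2 * b k x = 2 * b j x" "b i x = b j x + b k x" using perm3_sum[OF assms(1), of x] assms(3) by auto
  have "x = (1 - 2 * b k x) *\<^sub>R midpoint (v i) (v j) + (2 * b k x) *\<^sub>R midpoint (v i) (v k)"
    unfolding s(1) using perm3_comb[OF assms(1), of x]
    by (simp add: s(2) midpoint_def scaleR_add_right scaleR_add_left add_ac)
  moreover have "0 \<le> 2 * b k x" "2 * b k x \<le> 1"
    using s assms by (auto simp: perm3_triangle)
  ultimately have "x \<in> closed_segment (midpoint (v i) (v j)) (midpoint (v i) (v k))"
    unfolding closed_segment_def by blast
  moreover have "\<exists>m\<in>{1..6}. midpoint (v a) (v c) = ps_point v m" if "perm3 a c d" for a c d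
  proof -
    have "midpoint (v a) (v c) = ps_point v 4 \<or> midpoint (v a) (v c) = ps_point v 5 \<or> midpoint (v a) (v c) = ps_point v 6"
      using that by (elim perm3_cases) (simp_all add: ps_point_def midpoint_sym)
    then show ?thesis by auto
  qed
  from this[OF assms(1)] this[OF perm3_swap(2)[OF assms(1)]]
  obtain m m' where "midpoint (v i) (v j) = ps_point v m" "m \<in> {1..6}" "midpoint (v i) (v k) = ps_point v m'" "m' \<in> {1..6}" by blast
  ultimately show ?thesis by (metis in_segmentsI)
qed

end

section \<open>Every spline is a combination of truncated powers\<close>

context triangle
begin

text \<open>The faces are closures of connected components; it suffices that an open convex region misses the segments, as it
  then lies inside a single component.\<close>

lemma region_poly:
  assumes s: "s \<in> spline_space v" and A: "\<And>l. l \<in> A \<Longrightarrow> affine_fun l" and c: "c \<in> half_planes A"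
    and sub: "half_planes A \<subseteq> T - ps12_segments v"
  shows "\<exists>p. poly_upto 5 p \<and> (\<forall>x. (\<forall>l\<in>A. 0 \<le> l x) \<longrightarrow> s x = p x)"
proof -
  have "connected (half_planes A)" using convex_half_planes[OF A] convex_connected by blast
  then obtain C where C: "C \<in> components (T - ps12_segments v)" "half_planes A \<subseteq> C"
    using exists_component_superset[of "half_planes A" "T - ps12_segments v"] sub c by auto
  then have "closure C \<in> ps12_split v" by (simp add: ps12_split_def)
  then obtain p where p: "poly_upto 5 p" "\<forall>x\<in>closure C. s x = p x"
    using s unfolding spline_space_def poly_deg_le_on_iff by blast
  have "x \<in> closure C" if "\<forall>l\<in>A. 0 \<le> l x" for x
    using closure_half_planes[OF A c, of x] that closure_mono[OF C(2)] by blast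
  with p show ?thesis by blast
qed

lemma not_in_segments:
  assumes "perm3 i j k" "b j x < b i x" "b k x < b j x" "0 < b k x" "2 * b i x \<noteq> 1"
  shows "x \<in> T - ps12_segments v"
proof -
  have "x \<in> T" using assms by (auto simp: perm3_triangle)
  moreover have "x \<notin> ps12_segments v"
    using segments_bary[of x] assms perm3_sum[OF assms(1), of x] by (elim perm3_cases) auto
  ultimately show ?thesis by simp
qed

text \<open>For a permutation \<open>(i, j, k)\<close> the inner face is the part of the midpoint triangle on which the
  coordinates decrease in this order, and the outer face is the part of the corner at vertex \<open>i\<close>
  on the side of \<open>j\<close>.\<close>

definition inner_fun :: "(real^2 \<Rightarrow> real) \<Rightarrow> nat \<Rightarrow> nat \<Rightarrow> nat \<Rightarrow> (real^2 \<Rightarrow> real) \<Rightarrow> bool" where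
  "inner_fun s i j k p \<longleftrightarrow> poly_upto 5 p \<and>
    (\<forall>x. 0 \<le> b k x \<longrightarrow> b k x \<le> b j x \<longrightarrow> b j x \<le> b i x \<longrightarrow> 2 * b i x \<le> 1 \<longrightarrow> s x = p x)"

definition outer_fun :: "(real^2 \<Rightarrow> real) \<Rightarrow> nat \<Rightarrow> nat \<Rightarrow> nat \<Rightarrow> (real^2 \<Rightarrow> real) \<Rightarrow> bool" where
  "outer_fun s i j k p \<longleftrightarrow> poly_upto 5 p \<and>
    (\<forall>x. 0 \<le> b k x \<longrightarrow> b k x \<le> b j x \<longrightarrow> 1 \<le> 2 * b i x \<longrightarrow> s x = p x)"

lemmas affine_bary_intros = affine_fun_bary affine_fun_diff affine_fun_cmult affine_fun_const

lemma ex_inner_fun: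
  assumes s: "s \<in> spline_space v" and perm: "perm3 i j k"
  shows "\<exists>p. inner_fun s i j k p"
proof -
  let ?A = "{b k, \<lambda>x. b j x - b k x, \<lambda>x. b i x - b j x, \<lambda>x. 1 - 2 * b i x}"
  \<comment> \<open>any interior point of the face serves\<close>
  obtain c where "b i c = 9/20" "b j c = 7/20" "b k c = 1/5" using ex_bary[OF perm, of "9/20" "7/20" "1/5"] by auto
  then have c: "c \<in> half_planes ?A" by (simp add: half_planes_def)
  have "\<exists>p. poly_upto 5 p \<and> (\<forall>x. (\<forall>l\<in>?A. 0 \<le> l x) \<longrightarrow> s x = p x)"
    by (rule region_poly[OF s _ c]) (auto simp: half_planes_def intro!: affine_bary_intros
        dest: not_in_segments[OF perm])
  then show ?thesis unfolding inner_fun_def by auto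
qed

lemma ex_outer_fun:
  assumes s: "s \<in> spline_space v" and perm: "perm3 i j k"
  shows "\<exists>p. outer_fun s i j k p"
proof -
  let ?A = "{b k, \<lambda>x. b j x - b k x, \<lambda>x. 2 * b i x - 1}"
  obtain c where "b i c = 6/10" "b j c = 3/10" "b k c = 1/10" using ex_bary[OF perm, of "6/10" "3/10" "1/10"] by auto
  then have c: "c \<in> half_planes ?A" by (simp add: half_planes_def)
  have sub: "x \<in> T - ps12_segments v" if "0 < b k x" "b k x < b j x" "1 < 2 * b i x" for x
    using not_in_segments[OF perm, of x] that perm3_sum[OF perm, of x] by force
  have "\<exists>p. poly_upto 5 p \<and> (\<forall>x. (\<forall>l\<in>?A. 0 \<le> l x) \<longrightarrow> s x = p x)"
    by (rule region_poly[OF s _ c]) (use sub in \<open>auto simp: half_planes_def intro!: affine_bary_intros\<close>)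
  then show ?thesis unfolding outer_fun_def by auto
qed

lemma join_across:
  assumes s: "s \<in> spline_space v" and A: "finite A" "\<And>l. l \<in> A \<Longrightarrow> affine_fun l" "half_planes A \<subseteq> T"
    and l: "affine_fun l" "l z = 0" "l z' \<noteq> 0" and z: "z \<in> half_planes A"
    and p: "poly_upto 5 p" "poly_upto 5 p'"
    and sp: "\<And>x. x \<in> half_planes A \<Longrightarrow> 0 \<le> l x \<Longrightarrow> s x = p x" "\<And>x. x \<in> half_planes A \<Longrightarrow> l x \<le> 0 \<Longrightarrow> s x = p' x"
  shows "\<exists>q. affine_fun q \<and> (\<forall>x. p x - p' x = l x ^ 4 * q x)"
proof -
  obtain n m where nm: "\<And>x. l x = n \<bullet> x + m" using l(1) by (auto simp: affine_fun_def)
  have "n \<noteq> 0" using l(2,3) nm by auto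
  moreover have "C_k_on 3 s T" using s by (simp add: spline_space_def)
  ultimately show ?thesis
    using smooth_join[OF _ open_half_planes[OF A(1,2)] A(3) z nm _ l(2) p sp] affine_fun_poly by auto
qed

lemma join_first:
  assumes s: "s \<in> spline_space v" and perm: "perm3 i j k" and p: "inner_fun s i j k p" "inner_fun s j i k p'"
  shows "\<exists>q. affine_fun q \<and> (\<forall>x. p x - p' x = (b i x - b j x) ^ 4 * q x)"
proof -
  let ?A = "{b k, \<lambda>x. b i x - b k x, \<lambda>x. b j x - b k x, \<lambda>x. 1 - 2 * b i x, \<lambda>x. 1 - 2 * b j x}"
  obtain z where z: "b i z = 2/5" "b j z = 2/5" "b k z = 1/5" using ex_bary[OF perm, of "2/5" "2/5" "1/5"] by auto
  obtain z' where z': "b i z' = 1" "b j z' = 0" using ex_bary[OF perm, of 1 0 0] by auto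
  show ?thesis
    by (rule join_across[OF s, of ?A _ z z'])
      (use z z' p in \<open>auto simp: half_planes_def inner_fun_def perm3_triangle[OF perm] intro!: affine_bary_intros\<close>)
qed

lemma join_last:
  assumes s: "s \<in> spline_space v" and perm: "perm3 i j k" and p: "inner_fun s i j k p" "inner_fun s i k j p'"
  shows "\<exists>q. affine_fun q \<and> (\<forall>x. p x - p' x = (b j x - b k x) ^ 4 * q x)"
proof -
  let ?A = "{b j, b k, \<lambda>x. b i x - b j x, \<lambda>x. b i x - b k x, \<lambda>x. 1 - 2 * b i x}"
  obtain z where z: "b i z = 2/5" "b j z = 3/10" "b k z = 3/10" using ex_bary[OF perm, of "2/5" "3/10" "3/10"] by auto
  obtain z' where z': "b j z' = 1" "b k z' = 0" using ex_bary[OF perm, of 0 1 0] by auto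
  show ?thesis
    by (rule join_across[OF s, of ?A _ z z'])
      (use z z' p in \<open>auto simp: half_planes_def inner_fun_def perm3_triangle[OF perm] intro!: affine_bary_intros\<close>)
qed

lemma join_corner:
  assumes s: "s \<in> spline_space v" and perm: "perm3 i j k" and p: "outer_fun s i j k p" "inner_fun s i j k p'"
  shows "\<exists>q. affine_fun q \<and> (\<forall>x. p x - p' x = (2 * b i x - 1) ^ 4 * q x)"
proof -
  let ?A = "{b k, \<lambda>x. b j x - b k x, \<lambda>x. b i x - b j x}"
  obtain z where z: "b i z = 1/2" "b j z = 3/10" "b k z = 1/5" using ex_bary[OF perm, of "1/2" "3/10" "1/5"] by auto
  obtain z' where z': "b i z' = 1" using ex_bary[OF perm, of 1 0 0] by auto
  show ?thesis
    by (rule join_across[OF s, of ?A _ z z'])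
      (use z z' p in \<open>auto simp: half_planes_def inner_fun_def outer_fun_def perm3_triangle[OF perm] intro!: affine_bary_intros\<close>)
qed

lemma join_outer:
  assumes s: "s \<in> spline_space v" and perm: "perm3 i j k" and p: "outer_fun s i j k p" "outer_fun s i k j p'"
  shows "\<exists>q. affine_fun q \<and> (\<forall>x. p x - p' x = (b j x - b k x) ^ 4 * q x)"
proof -
  let ?A = "{b j, b k, \<lambda>x. 2 * b i x - 1}"
  obtain z where z: "b i z = 3/5" "b j z = 1/5" "b k z = 1/5" using ex_bary[OF perm, of "3/5" "1/5" "1/5"] by auto
  obtain z' where z': "b j z' = 1" "b k z' = 0" using ex_bary[OF perm, of 0 1 0] by auto
  show ?thesis
    by (rule join_across[OF s, of ?A _ z z'])
      (use z z' p in \<open>auto simp: half_planes_def outer_fun_def perm3_triangle[OF perm] intro!: affine_bary_intros\<close>)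
qed

lemma affine_fun_bary_form:
  assumes "affine_fun q" "perm3 i j k"
  shows "q x = q (v k) + (q (v i) - q (v k)) * b i x + (q (v j) - q (v k)) * b j x"
proof -
  obtain n m where q: "\<And>x. q x = n \<bullet> x + m" using assms(1) by (auto simp: affine_fun_def)
  have k: "b k x = 1 - b i x - b j x" using perm3_sum[OF assms(2), of x] by simp
  have "n \<bullet> x = b i x * (n \<bullet> v i) + b j x * (n \<bullet> v j) + b k x * (n \<bullet> v k)"
    by (subst perm3_comb[OF assms(2), of x, symmetric]) (simp add: inner_add_right)
  then show ?thesis unfolding q k by (simp add: algebra_simps)
qed

text \<open>The fourth powers of two independent linear forms have no common multiple of degree five, so a
  jump that is divisible by both vanishes.\<close>

lemma corner_cofactor_eq:
  assumes perm: "perm3 i j k" and q: "affine_fun q" "affine_fun q'"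
    and eq: "\<And>x. (2 * b i x - 1) ^ 4 * q x = (b j x - b k x) ^ 4 * q' x"
  shows "q x = 0"
proof -
  define B where "B i = q (v i)" for i
  define B' where "B' i = q' (v i)" for i
  let ?a0 = "(B i + (B j + B k) / 2) / 2" and ?a1 = "(B i - (B j + B k) / 2) / 2" and ?a2 = "(B j - B k) / 2"
  let ?c0 = "(B' i + (B' j + B' k) / 2) / 2" and ?c1 = "(B' i - (B' j + B' k) / 2) / 2" and ?c2 = "(B' j - B' k) / 2"
  have form: "q x = ?a0 + ?a1 * (2 * b i x - 1) + ?a2 * (b j x - b k x)"
    "q' x = ?c0 + ?c1 * (2 * b i x - 1) + ?c2 * (b j x - b k x)" for x
  proof -
    have k: "b k x = 1 - b i x - b j x" using perm3_sum[OF perm, of x] by simp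
    show "q x = ?a0 + ?a1 * (2 * b i x - 1) + ?a2 * (b j x - b k x)"
      unfolding affine_fun_bary_form[OF q(1) perm, of x] B_def k by (simp add: field_simps)
    show "q' x = ?c0 + ?c1 * (2 * b i x - 1) + ?c2 * (b j x - b k x)"
      unfolding affine_fun_bary_form[OF q(2) perm, of x] B'_def k by (simp add: field_simps)
  qed
  have "X ^ 4 * (?a0 + ?a1 * X + ?a2 * Y) = Y ^ 4 * (?c0 + ?c1 * X + ?c2 * Y)" for X Y
  proof -
    obtain x where "b i x = (1 + X) / 2" "b j x = (1 - X) / 4 + Y / 2" "b k x = (1 - X) / 4 - Y / 2"
      using ex_bary[OF perm, of "(1 + X) / 2" "(1 - X) / 4 + Y / 2" "(1 - X) / 4 - Y / 2"] by (auto simp: field_simps)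
    then have XY: "2 * b i x - 1 = X" "b j x - b k x = Y" by simp_all
    show ?thesis using eq[of x] unfolding form XY .
  qed
  from quartic_indep2[OF this] show ?thesis unfolding form by simp
qed

text \<open>The six jumps met on a circuit around the barycentre add up to zero, and opposite rays of a median contribute the
  same fourth power. The products of the fourth powers of three lines through a point with
  affine functions are linearly independent, so the jumps on opposite rays cancel.\<close>

lemma centre_cofactor_eq:
  assumes q: "affine_fun q1" "affine_fun q2" "affine_fun q3"
    and eq: "\<And>x. (b 1 x - b 2 x) ^ 4 * q1 x + (b 2 x - b 3 x) ^ 4 * q2 x + (b 1 x - b 3 x) ^ 4 * q3 x = 0"
  shows "q1 x = 0" "q2 x = 0" "q3 x = 0"
proof -
  have perm: "perm3 1 2 3" by (simp add: perm3_def)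
  have form: "q x = (q (v 1) + q (v 2) + q (v 3)) / 3 + (2 * q (v 1) - q (v 2) - q (v 3)) / 3 * (b 1 x - b 2 x)
     + (q (v 1) + q (v 2) - 2 * q (v 3)) / 3 * (b 2 x - b 3 x)" if "affine_fun q" for q x
  proof -
    have k: "b 3 x = 1 - b 1 x - b 2 x" using perm3_sum[OF perm, of x] by simp
    show ?thesis unfolding affine_fun_bary_form[OF that perm, of x] k by (simp add: field_simps)
  qed
  let ?a0 = "\<lambda>q. (q (v 1) + q (v 2) + q (v 3)) / 3" and ?a1 = "\<lambda>q. (2 * q (v 1) - q (v 2) - q (v 3)) / 3"
    and ?a2 = "\<lambda>q. (q (v 1) + q (v 2) - 2 * q (v 3)) / 3"
  have "X ^ 4 * (?a0 q1 + ?a1 q1 * X + ?a2 q1 * Y) + Y ^ 4 * (?a0 q2 + ?a1 q2 * X + ?a2 q2 * Y)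
    + (X + Y) ^ 4 * (?a0 q3 + ?a1 q3 * X + ?a2 q3 * Y) = 0" for X Y
  proof -
    obtain x where "b 1 x = (1 + 2 * X + Y) / 3" "b 2 x = (1 - X + Y) / 3" "b 3 x = (1 - X - 2 * Y) / 3"
      using ex_bary[OF perm, of "(1 + 2 * X + Y) / 3" "(1 - X + Y) / 3" "(1 - X - 2 * Y) / 3"] by (auto simp: field_simps)
    then have XY: "b 1 x - b 2 x = X" "b 2 x - b 3 x = Y" "b 1 x - b 3 x = X + Y" by simp_all
    show ?thesis using eq[of x] unfolding form[OF q(1), of x] form[OF q(2), of x] form[OF q(3), of x] XY .
  qed
  from quartic_indep3[OF this] show "q1 x = 0" "q2 x = 0" "q3 x = 0"
    unfolding form[OF q(1), of x] form[OF q(2), of x] form[OF q(3), of x] by simp_all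
qed

text \<open>Starting from the face with \<open>b 1 \<le> b 2 \<le> b 3\<close>, every further inner face is reached by crossing
  medians, and a corner by crossing one midline in addition. The cofactor collected at a line depends only
  on the line, so the jumps assemble into truncated powers on the whole triangle.\<close>

lemma spline_truncated_form:
  assumes s: "s \<in> spline_space v"
  shows "\<exists>p q1 q2 q3 r1 r2 r3. poly_upto 5 p \<and> (\<forall>q\<in>{q1, q2, q3, r1, r2, r3}. affine_fun q) \<and>
    (\<forall>x\<in>T. s x = p x + tp 4 (b 1 x - b 2 x) * q1 x + tp 4 (b 2 x - b 3 x) * q2 x + tp 4 (b 1 x - b 3 x) * q3 x
      + tp 4 (2 * b 1 x - 1) * r1 x + tp 4 (2 * b 2 x - 1) * r2 x + tp 4 (2 * b 3 x - 1) * r3 x)"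
proof -
  have perms: "perm3 1 2 3" "perm3 1 3 2" "perm3 2 1 3" "perm3 2 3 1" "perm3 3 1 2" "perm3 3 2 1"
    by (simp_all add: perm3_def)
  obtain P where P: "\<And>i j k. perm3 i j k \<Longrightarrow> inner_fun s i j k (P i j k)"
    using ex_inner_fun[OF s] by metis
  obtain Q where Q: "\<And>i j k. perm3 i j k \<Longrightarrow> outer_fun s i j k (Q i j k)"
    using ex_outer_fun[OF s] by metis
  obtain qa where qa: "affine_fun qa" "\<And>x. P 1 2 3 x - P 2 1 3 x = (b 1 x - b 2 x) ^ 4 * qa x"
    using join_first[OF s perms(1) P P] perms by blast
  obtain qb where qb: "affine_fun qb" "\<And>x. P 2 1 3 x - P 2 3 1 x = (b 1 x - b 3 x) ^ 4 * qb x"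
    using join_last[OF s perms(3) P P] perms by blast
  obtain qc where qc: "affine_fun qc" "\<And>x. P 2 3 1 x - P 3 2 1 x = (b 2 x - b 3 x) ^ 4 * qc x"
    using join_first[OF s perms(4) P P] perms by blast
  obtain qd where qd: "affine_fun qd" "\<And>x. P 3 1 2 x - P 3 2 1 x = (b 1 x - b 2 x) ^ 4 * qd x"
    using join_last[OF s perms(5) P P] perms by blast
  obtain qe where qe: "affine_fun qe" "\<And>x. P 1 3 2 x - P 3 1 2 x = (b 1 x - b 3 x) ^ 4 * qe x"
    using join_first[OF s perms(2) P P] perms by blast
  obtain qf where qf: "affine_fun qf" "\<And>x. P 1 2 3 x - P 1 3 2 x = (b 2 x - b 3 x) ^ 4 * qf x"
    using join_last[OF s perms(1) P P] perms by blast
  \<comment> \<open>two ways around the barycentre from one face to the opposite one\<close>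
  have "(b 1 x - b 2 x) ^ 4 * (qa x - qd x) + (b 2 x - b 3 x) ^ 4 * (qc x - qf x) + (b 1 x - b 3 x) ^ 4 * (qb x - qe x) = 0" for x
    using qa(2)[of x] qb(2)[of x] qc(2)[of x] qd(2)[of x] qe(2)[of x] qf(2)[of x] by (simp only: right_diff_distrib)
  note zero = centre_cofactor_eq[OF affine_fun_diff[OF qa(1) qd(1)] affine_fun_diff[OF qc(1) qf(1)] affine_fun_diff[OF qb(1) qe(1)] this]
  have eqs: "qa x = qd x" "qc x = qf x" "qb x = qe x" for x
    using zero(1)[of x] zero(2)[of x] zero(3)[of x] by simp_all
  define I where "I x = P 3 2 1 x + tp 4 (b 1 x - b 2 x) * (24 * qa x) + tp 4 (b 2 x - b 3 x) * (24 * qc x)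
     + tp 4 (b 1 x - b 3 x) * (24 * qb x)" for x
  have tp4: "tp 4 z * (24 * w) = (if 0 \<le> z then z ^ 4 * w else 0)" for z w by (simp add: tp_def fact_numeral)
  have zero4: "tp 4 z = 0" if "z \<le> 0" for z using that by (simp add: tp_def)
  have P_eqs: "P 2 3 1 x = P 3 2 1 x + (b 2 x - b 3 x) ^ 4 * qc x"
    "P 2 1 3 x = P 3 2 1 x + (b 2 x - b 3 x) ^ 4 * qc x + (b 1 x - b 3 x) ^ 4 * qb x"
    "P 1 2 3 x = P 3 2 1 x + (b 2 x - b 3 x) ^ 4 * qc x + (b 1 x - b 3 x) ^ 4 * qb x + (b 1 x - b 2 x) ^ 4 * qa x"
    "P 3 1 2 x = P 3 2 1 x + (b 1 x - b 2 x) ^ 4 * qa x"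
    "P 1 3 2 x = P 3 2 1 x + (b 1 x - b 2 x) ^ 4 * qa x + (b 1 x - b 3 x) ^ 4 * qb x" for x
    using qa(2)[of x] qb(2)[of x] qc(2)[of x] qd(2)[of x] qe(2)[of x] unfolding eqs[of x] by linarith+
  have I: "P i j k x = I x" if perm: "perm3 i j k" and le: "b k x \<le> b j x" "b j x \<le> b i x" for i j k x
    using perm le unfolding I_def by (elim perm3_cases) (simp_all add: P_eqs tp4 zero4)
  have corner: "\<exists>r. affine_fun r \<and> (\<forall>x. Q i j k x = P i j k x + (2 * b i x - 1) ^ 4 * r x
      \<and> Q i k j x = P i k j x + (2 * b i x - 1) ^ 4 * r x)" if perm: "perm3 i j k" for i j k
  proof -
    have perm': "perm3 i k j" using perm by (rule perm3_swap(2))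
    obtain r where r: "affine_fun r" "\<And>x. Q i j k x - P i j k x = (2 * b i x - 1) ^ 4 * r x"
      using join_corner[OF s perm Q[OF perm] P[OF perm]] by blast
    obtain r' where r': "affine_fun r'" "\<And>x. Q i k j x - P i k j x = (2 * b i x - 1) ^ 4 * r' x"
      using join_corner[OF s perm' Q[OF perm'] P[OF perm']] by blast
    obtain p where p: "affine_fun p" "\<And>x. P i j k x - P i k j x = (b j x - b k x) ^ 4 * p x"
      using join_last[OF s perm P[OF perm] P[OF perm']] by blast
    obtain p' where p': "affine_fun p'" "\<And>x. Q i j k x - Q i k j x = (b j x - b k x) ^ 4 * p' x"
      using join_outer[OF s perm Q[OF perm] Q[OF perm']] by blast
    have "(2 * b i x - 1) ^ 4 * (r x - r' x) = (b j x - b k x) ^ 4 * (p' x - p x)" for x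
      unfolding right_diff_distrib using r(2)[of x] r'(2)[of x] p(2)[of x] p'(2)[of x] by linarith
    from corner_cofactor_eq[OF perm affine_fun_diff[OF r(1) r'(1)] affine_fun_diff[OF p'(1) p(1)] this]
    have "r x = r' x" for x by simp
    then show ?thesis using r r' by (intro exI[of _ r]) (simp add: algebra_simps)
  qed
  obtain r where r: "\<And>i j k. perm3 i j k \<Longrightarrow> affine_fun (r i) \<and> (\<forall>x. Q i j k x = P i j k x + (2 * b i x - 1) ^ 4 * r i x)"
  proof -
    obtain r1 where "affine_fun r1" "\<And>x. Q 1 2 3 x = P 1 2 3 x + (2 * b 1 x - 1) ^ 4 * r1 x
      \<and> Q 1 3 2 x = P 1 3 2 x + (2 * b 1 x - 1) ^ 4 * r1 x" using corner[OF perms(1)] by blast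
    moreover obtain r2 where "affine_fun r2" "\<And>x. Q 2 1 3 x = P 2 1 3 x + (2 * b 2 x - 1) ^ 4 * r2 x
      \<and> Q 2 3 1 x = P 2 3 1 x + (2 * b 2 x - 1) ^ 4 * r2 x" using corner[OF perms(3)] by blast
    moreover obtain r3 where "affine_fun r3" "\<And>x. Q 3 1 2 x = P 3 1 2 x + (2 * b 3 x - 1) ^ 4 * r3 x
      \<and> Q 3 2 1 x = P 3 2 1 x + (2 * b 3 x - 1) ^ 4 * r3 x" using corner[OF perms(5)] by blast
    ultimately show ?thesis
      by (intro that[of "\<lambda>i. if i = 1 then r1 else if i = 2 then r2 else r3"]) (elim perm3_cases; simp)
  qed
  have form: "s x = I x + tp 4 (2 * b 1 x - 1) * (24 * r 1 x) + tp 4 (2 * b 2 x - 1) * (24 * r 2 x) + tp 4 (2 * b 3 x - 1) * (24 * r 3 x)"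
    if x: "x \<in> T" for x
  proof -
    obtain i j k where perm: "perm3 i j k" and le: "b k x \<le> b j x" "b j x \<le> b i x"
    proof -
      have "b 3 x \<le> b 2 x \<and> b 2 x \<le> b 1 x \<or> b 2 x \<le> b 3 x \<and> b 3 x \<le> b 1 x \<or> b 3 x \<le> b 1 x \<and> b 1 x \<le> b 2 x
        \<or> b 1 x \<le> b 3 x \<and> b 3 x \<le> b 2 x \<or> b 2 x \<le> b 1 x \<and> b 1 x \<le> b 3 x \<or> b 1 x \<le> b 2 x \<and> b 2 x \<le> b 3 x"
        by linarith
      then show ?thesis using that perms by blast
    qed
    have pos: "0 \<le> b k x" "0 \<le> b j x" using x by (simp_all add: perm3_triangle[OF perm])
    have sum: "b i x + b j x + b k x = 1" by (rule perm3_sum[OF perm])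
    have small: "2 * b j x \<le> 1" "2 * b k x \<le> 1" using sum pos le by linarith+
    have tail: "tp 4 (2 * b 1 x - 1) * (24 * r 1 x) + tp 4 (2 * b 2 x - 1) * (24 * r 2 x) + tp 4 (2 * b 3 x - 1) * (24 * r 3 x)
       = (if 1 \<le> 2 * b i x then (2 * b i x - 1) ^ 4 * r i x else 0)"
    proof -
      have "tp 4 (2 * b j x - 1) = 0" "tp 4 (2 * b k x - 1) = 0"
        using small by (auto simp: tp_def)
      then show ?thesis using perm by (elim perm3_cases) (auto simp: tp4)
    qed
    show ?thesis
    proof (cases "1 \<le> 2 * b i x")
      case True
      then have "s x = Q i j k x" using Q[OF perm] pos le by (simp add: outer_fun_def)
      then show ?thesis using r[OF perm] I[OF perm le] tail True by simp
    next
      case False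
      then have "s x = P i j k x" using P[OF perm] pos le by (simp add: inner_fun_def)
      then show ?thesis using I[OF perm le] tail False by simp
    qed
  qed
  have "affine_fun (r i)" if "i \<in> {1, 2, 3}" for i
    using r[OF perms(1)] r[OF perms(3)] r[OF perms(5)] that by blast
  then have aff: "\<forall>q\<in>{\<lambda>x. 24 * qa x, \<lambda>x. 24 * qc x, \<lambda>x. 24 * qb x, \<lambda>x. 24 * r 1 x, \<lambda>x. 24 * r 2 x, \<lambda>x. 24 * r 3 x}. affine_fun q"
    using qa(1) qb(1) qc(1) by (simp add: affine_fun_cmult)
  show ?thesis
  proof (intro exI conjI)
    show "poly_upto 5 (P 3 2 1)" using P[OF perms(6)] by (simp add: inner_fun_def)
    show "\<forall>q\<in>{\<lambda>x. 24 * qa x, \<lambda>x. 24 * qc x, \<lambda>x. 24 * qb x, \<lambda>x. 24 * r 1 x, \<lambda>x. 24 * r 2 x, \<lambda>x. 24 * r 3 x}. affine_fun q"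
      by (rule aff)
    show "\<forall>x\<in>T. s x = P 3 2 1 x + tp 4 (b 1 x - b 2 x) * (24 * qa x) + tp 4 (b 2 x - b 3 x) * (24 * qc x)
      + tp 4 (b 1 x - b 3 x) * (24 * qb x) + tp 4 (2 * b 1 x - 1) * (24 * r 1 x)
      + tp 4 (2 * b 2 x - 1) * (24 * r 2 x) + tp 4 (2 * b 3 x - 1) * (24 * r 3 x)"
      using form by (simp add: I_def)
  qed
qed

end

section \<open>Generating splines as homogeneous quintic profiles\<close>

definition pos_pow :: "nat \<Rightarrow> 'a::linordered_idom \<Rightarrow> 'a" where
  "pos_pow n z = max 0 z ^ n"

lemma pos_pow_tp: "0 < n \<Longrightarrow> pos_pow n z = fact n * tp n z"
  by (simp add: pos_pow_def tp_eq_max)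

text \<open>The cone volumes of the eight generators, multiplied by 480 to clear denominators, as functions of
  the barycentric coordinates of a point of the triangle. The type is left open because the same
  expression is evaluated on reals and on integers.\<close>

definition profile :: "nat \<Rightarrow> 'a::linordered_idom \<Rightarrow> 'a \<Rightarrow> 'a \<Rightarrow> 'a" where
  "profile g x y z =
    (if g = 0 then 4 * pos_pow 5 (x - y - z)
     else if g = 1 then pos_pow 4 (x - y - z) * (20 * y)
     else if g = 2 then 4 * pos_pow 5 (x - z) - 4 * pos_pow 5 (x - z - y) - pos_pow 4 (x - z - y) * (20 * y)
     else if g = 3 then pos_pow 4 (x - z) * (20 * y) - 8 * pos_pow 5 (x - z) + 8 * pos_pow 5 (x - z - y) + pos_pow 4 (x - z - y) * (20 * y)
     else if g = 4 then 4 * pos_pow 5 (y - z) - pos_pow 4 (y - z) * (20 * x) + 4 * pos_pow 5 (x - z) - pos_pow 4 (x - z) * (20 * y)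
       - pos_pow 4 (x - y - z) * (5 * (x + y - z)) - pos_pow 4 (y - x - z) * (5 * (x + y - z)) + pos_pow 5 (x + y - z)
     else if g = 5 then 4 * y ^ 5 - 4 * pos_pow 5 (y - x) - 4 * pos_pow 5 (y - z) + 4 * pos_pow 5 (y - x - z)
     else if g = 6 then 4 * y ^ 5 - 4 * pos_pow 5 (y - x) - 4 * pos_pow 5 (y - z) + 4 * pos_pow 5 (y - x - z)
       - pos_pow 4 (y - x) * (20 * x) + pos_pow 4 (y - x - z) * (20 * x)
     else z * (20 * y ^ 4) - 4 * y ^ 5 + 8 * pos_pow 5 (y - x) + pos_pow 4 (y - x) * (20 * x) + 4 * pos_pow 5 (y - z)
       - 4 * pos_pow 5 (z - x) - pos_pow 4 (z - x) * (20 * y) + pos_pow 4 (y + z - x) * (5 * (z - x - y))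
       - 3 * pos_pow 5 (y - x - z) - pos_pow 4 (y - x - z) * (10 * x) - pos_pow 5 (z - x - y))"

lemma pos_pow_of_int: "pos_pow n (of_int z) = of_int (pos_pow n z)"
  by (simp add: pos_pow_def of_int_max)

lemma profile_of_int: "profile g (real_of_int x) (real_of_int y) (real_of_int z) = real_of_int (profile g x y z)"
proof -
  have "pos_pow n (real_of_int a - of_int b) = of_int (pos_pow n (a - b))" "pos_pow n (real_of_int a + of_int b - of_int c) = of_int (pos_pow n (a + b - c))"
    "pos_pow n (real_of_int a - of_int b - of_int c) = of_int (pos_pow n (a - b - c))" for n a b c
    by (simp_all flip: pos_pow_of_int)
  then show ?thesis by (simp add: profile_def)
qed

lemma pos_pow_scale: "0 \<le> c \<Longrightarrow> pos_pow n (c * z) = c ^ n * pos_pow n z"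
proof -
  assume "0 \<le> c"
  then have "max 0 (c * z) = c * max 0 z" by (auto simp: max_def zero_le_mult_iff mult_le_0_iff)
  then show ?thesis by (simp add: pos_pow_def power_mult_distrib)
qed

lemma profile_scale:
  fixes c :: real
  assumes "0 \<le> c"
  shows "profile g (c * x) (c * y) (c * z) = c ^ 5 * profile g x y z"
proof -
  have pos_pow: "pos_pow n (c * x - c * y) = c ^ n * pos_pow n (x - y)" "pos_pow n (c * x + c * y - c * z) = c ^ n * pos_pow n (x + y - z)"
    "pos_pow n (c * x - c * y - c * z) = c ^ n * pos_pow n (x - y - z)" for n x y z
    using pos_pow_scale[OF assms, of n "x - y"] pos_pow_scale[OF assms, of n "x + y - z"] pos_pow_scale[OF assms, of n "x - y - z"]
    by (simp_all add: right_diff_distrib distrib_left)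
  have c5: "c ^ 5 = c * c ^ 4" using power_Suc[of c 4] by simp
  consider "g = 0" | "g = 1" | "g = 2" | "g = 3" | "g = 4" | "g = 5" | "g = 6" | "g \<noteq> 0 \<and> g \<noteq> 1 \<and> g \<noteq> 2 \<and> g \<noteq> 3 \<and> g \<noteq> 4 \<and> g \<noteq> 5 \<and> g \<noteq> 6" by argo
  then show ?thesis
  proof cases
    case 1 then show ?thesis by (simp add: profile_def pos_pow)
  next
    case 2 then show ?thesis by (simp add: profile_def pos_pow c5)
  next
    case 3 then show ?thesis by (simp add: profile_def pos_pow c5) (simp add: right_diff_distrib distrib_left mult_ac)
  next
    case 4 then show ?thesis by (simp add: profile_def pos_pow c5) (simp add: right_diff_distrib distrib_left mult_ac)
  next
    case 5 then show ?thesis by (simp add: profile_def pos_pow c5) (simp add: right_diff_distrib distrib_left mult_ac)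
  next
    case 6 then show ?thesis by (simp add: profile_def pos_pow c5 power_mult_distrib) (simp add: right_diff_distrib distrib_left mult_ac)
  next
    case 7 then show ?thesis by (simp add: profile_def pos_pow c5 power_mult_distrib) (simp add: right_diff_distrib distrib_left mult_ac)
  next
    case 8 then show ?thesis by (simp add: profile_def pos_pow c5 power_mult_distrib) (simp add: right_diff_distrib distrib_left mult_ac)
  qed
qed
lemma tp_num: "tp 4 z = (if 0 \<le> z then z ^ 4 / 24 else 0)" "tp 5 z = (if 0 \<le> z then z ^ 5 / 120 else 0)"
  by (simp_all add: tp_def fact_numeral)


lemma tp_5: "tp 5 z = z * tp 4 z / 5"
  using power_Suc[of z 4] by (simp add: tp_num)

lemma pos_pow_4_5: "pos_pow 4 z = 24 * tp 4 z" "pos_pow 5 z = 24 * (z * tp 4 z)"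
  by (simp_all add: pos_pow_tp fact_numeral tp_5)

lemma tp_4_pair: "tp 4 z = z ^ 4 / 24 - tp 4 (- z)"
  by (simp add: tp_num)

lemma tp_4_pos: "0 \<le> z \<Longrightarrow> tp 4 z = z ^ 4 / 24" and tp_4_neg: "z \<le> 0 \<Longrightarrow> tp 4 z = 0"
  by (simp_all add: tp_num)

text \<open>In one of the two cases of \<open>profile_4\<close> and \<open>profile_7\<close> the truncated powers of
  nonnegative quantities become ordinary powers, and these polynomial identities remain.\<close>

lemma quintic_id_4:
  fixes x d :: real
  shows "d * (x ^ 4 / 24) - x * (x ^ 4 / 24) / 5 + (x + d) * ((x - d) ^ 4 / 24) / 4
     = d * (d ^ 4 / 24) / 5 - x * (d ^ 4 / 24) + (x + d) * ((x + d) ^ 4 / 24) / 20"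
proof -
  have "20 * d * x ^ 4 - 4 * x * x ^ 4 + 5 * (x + d) * (x - d) ^ 4
     = 4 * d * d ^ 4 - 20 * x * d ^ 4 + (x + d) * (x + d) ^ 4"
    by algebra
  then show ?thesis by linarith
qed

lemma quintic_id_7:
  fixes x y d :: real
  shows "x * (y ^ 4 / 24) - 2 * (y * (y ^ 4 / 24) / 5) = (x + d) * (y ^ 4 / 24) - y * (y ^ 4 / 24) / 5
    - d * (d ^ 4 / 24) / 5 - y * (d ^ 4 / 24) + (d - y) * ((y + d) ^ 4 / 24) / 4
    - (d - y) * ((y - d) ^ 4 / 24) / 20"
proof -
  have "20 * x * y ^ 4 - 8 * y * y ^ 4 = 20 * (x + d) * y ^ 4 - 4 * y * y ^ 4
    - 4 * d * d ^ 4 - 20 * y * d ^ 4 + 5 * (d - y) * (y + d) ^ 4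
    - (d - y) * (y - d) ^ 4"
    by algebra
  then show ?thesis by linarith
qed

text \<open>The integration produced a minimum of two coordinates; on both sides of the line where it switches, the expression is the
  same sum of truncated powers of the six lines.\<close>

lemma profile_4:
  fixes x y z :: real
  assumes "0 \<le> x" "0 \<le> y" "0 \<le> z"
  shows "(y - min y z) * tp 4 (x - z + min y z) - tp 5 (x - z + min y z) + 5/4 * tp 5 (x - z - y + 2 * min y z)
     + (y - min y z) * tp 4 (x - z - y + 2 * min y z) / 2 - (y * tp 4 (x - z) - tp 5 (x - z) + 5/4 * tp 5 (x - z - y) + y * tp 4 (x - z - y) / 2)
    = profile 4 x y z / 480"
proof (cases "y \<le> z")
  case True
  then have m: "min y z = y" by simp
  have e: "x - z - y + 2 * y = x + y - z" "x - z + y = x + y - z" "x - z - y = x - y - z" by simp_all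
  have n: "tp 4 (y - z) = 0" "tp 4 (y - x - z) = 0"
    using True assms by (simp_all add: tp_4_neg)
  show ?thesis unfolding m e
    by (simp add: profile_def pos_pow_4_5 tp_5 n) (simp add: algebra_simps add_divide_distrib diff_divide_distrib)
next
  case False
  then have m: "min y z = z" by simp
  have e: "x - y - z + 2 * z = x + z - y" "x - z + z = x" "x - z - y = x - y - z" by simp_all
  have n: "tp 4 x = x ^ 4 / 24" "tp 4 (y - z) = (y - z) ^ 4 / 24" "tp 4 (x + y - z) = (x + y - z) ^ 4 / 24"
    using False assms by (simp_all add: tp_4_pos)
  have h: "tp 4 (y - x - z) = (x + z - y) ^ 4 / 24 - tp 4 (x + z - y)"
    using tp_4_pair[of "x + z - y"] by (simp add: algebra_simps)
  have id: "(y - z) * (x ^ 4 / 24) - x * (x ^ 4 / 24) / 5 + (x + y - z) * ((x + z - y) ^ 4 / 24) / 4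
     = (y - z) * ((y - z) ^ 4 / 24) / 5 - x * ((y - z) ^ 4 / 24) + (x + y - z) * ((x + y - z) ^ 4 / 24) / 20"
    using quintic_id_4[of "y - z" x] by (simp only: diff_diff_eq2 add_diff_eq)
  have "profile 4 x y z / 480 = (y - z) * ((y - z) ^ 4 / 24) / 5 - x * ((y - z) ^ 4 / 24) + (x + y - z) * ((x + y - z) ^ 4 / 24) / 20
    + (x - z) * tp 4 (x - z) / 5 - y * tp 4 (x - z) - (x + y - z) * tp 4 (x - y - z) / 4
    - (x + y - z) * ((x + z - y) ^ 4 / 24 - tp 4 (x + z - y)) / 4"
    by (simp add: profile_def pos_pow_4_5 n h) (simp add: algebra_simps add_divide_distrib diff_divide_distrib)
  also have "\<dots> = (y - z) * (x ^ 4 / 24) - x * (x ^ 4 / 24) / 5 + (x + y - z) * tp 4 (x + z - y) / 4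
    + (x - z) * tp 4 (x - z) / 5 - y * tp 4 (x - z) - (x + y - z) * tp 4 (x - y - z) / 4"
    unfolding id[symmetric] by (simp add: right_diff_distrib diff_divide_distrib)
  also have "\<dots> = (y - z) * tp 4 x - tp 5 x + 5/4 * tp 5 (x + z - y) + (y - z) * tp 4 (x + z - y) / 2
    - (y * tp 4 (x - z) - tp 5 (x - z) + 5/4 * tp 5 (x - y - z) + y * tp 4 (x - y - z) / 2)"
    unfolding tp_5 n by (simp add: algebra_simps add_divide_distrib diff_divide_distrib)
  finally show ?thesis unfolding m e ..
qed

lemma profile_7:
  fixes x y z :: real
  assumes "0 \<le> x" "0 \<le> y" "0 \<le> z"
  shows "min x z * tp 4 y - 2 * tp 5 (y - x + min x z) - tp 5 (y - z + min x z) + 3/4 * tp 5 (y - x - z + 2 * min x z)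
      - (x - min x z) * (tp 4 (y - x + min x z) - tp 4 (y - x - z + 2 * min x z) / 2) + 2 * tp 5 (y - x) + tp 5 (y - z)
      - 3/4 * tp 5 (y - x - z) + x * (tp 4 (y - x) - tp 4 (y - x - z) / 2)
    = profile 7 x y z / 480"
proof (cases "z \<le> x")
  case True
  then have m: "min x z = z" by simp
  have e: "y - x - z + 2 * z = y + z - x" "y - x + z = y + z - x" "y - z + z = y" by simp_all
  have n: "tp 4 (z - x) = 0" "tp 4 (z - x - y) = 0" "tp 4 y = y ^ 4 / 24"
    using True assms by (simp_all add: tp_4_neg tp_4_pos)
  have y5: "y ^ 5 = y * y ^ 4" using power_Suc[of y 4] by simp
  show ?thesis unfolding m e
    by (simp add: profile_def pos_pow_4_5 tp_5 n y5) (simp add: algebra_simps add_divide_distrib diff_divide_distrib)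
next
  case False
  then have m: "min x z = x" by simp
  have e: "y - x - z + 2 * x = y + x - z" "y - x + x = y" "y - z + x = y + x - z" by simp_all
  have n: "tp 4 y = y ^ 4 / 24" "tp 4 (z - x) = (z - x) ^ 4 / 24" "tp 4 (y + z - x) = (y + z - x) ^ 4 / 24"
    using False assms by (simp_all add: tp_4_pos)
  have h: "tp 4 (z - x - y) = (y + x - z) ^ 4 / 24 - tp 4 (y + x - z)"
    using tp_4_pair[of "y + x - z"] by (simp add: algebra_simps)
  have y5: "y ^ 5 = y * y ^ 4" using power_Suc[of y 4] by simp
  have id: "x * (y ^ 4 / 24) - 2 * (y * (y ^ 4 / 24) / 5) = z * (y ^ 4 / 24) - y * (y ^ 4 / 24) / 5
    - (z - x) * ((z - x) ^ 4 / 24) / 5 - y * ((z - x) ^ 4 / 24) + (z - x - y) * ((y + z - x) ^ 4 / 24) / 4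
    - (z - x - y) * ((y + x - z) ^ 4 / 24) / 20"
    using quintic_id_7[of x y "z - x"] by (simp only: diff_diff_eq2 add_diff_eq add_diff_cancel_left')
  have "profile 7 x y z / 480 = z * (y ^ 4 / 24) - y * (y ^ 4 / 24) / 5
    - (z - x) * ((z - x) ^ 4 / 24) / 5 - y * ((z - x) ^ 4 / 24) + (z - x - y) * ((y + z - x) ^ 4 / 24) / 4
    - (z - x - y) * ((y + x - z) ^ 4 / 24) / 20 + (z - x - y) * tp 4 (y + x - z) / 20
    + 2 * ((y - x) * tp 4 (y - x) / 5) + x * tp 4 (y - x) + (y - z) * tp 4 (y - z) / 5
    - 3/4 * ((y - x - z) * tp 4 (y - x - z) / 5) - x * tp 4 (y - x - z) / 2"
    by (simp add: profile_def pos_pow_4_5 n h y5) (simp add: algebra_simps add_divide_distrib diff_divide_distrib)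
  also have "\<dots> = x * (y ^ 4 / 24) - 2 * (y * (y ^ 4 / 24) / 5) + (z - x - y) * tp 4 (y + x - z) / 20
    + 2 * ((y - x) * tp 4 (y - x) / 5) + x * tp 4 (y - x) + (y - z) * tp 4 (y - z) / 5
    - 3/4 * ((y - x - z) * tp 4 (y - x - z) / 5) - x * tp 4 (y - x - z) / 2"
    unfolding id ..
  also have "\<dots> = x * tp 4 y - 2 * tp 5 y - tp 5 (y + x - z) + 3/4 * tp 5 (y + x - z)
      - (x - x) * (tp 4 y - tp 4 (y + x - z) / 2) + 2 * tp 5 (y - x) + tp 5 (y - z)
      - 3/4 * tp 5 (y - x - z) + x * (tp 4 (y - x) - tp 4 (y - x - z) / 2)"
    unfolding tp_5 n by (simp add: algebra_simps add_divide_distrib diff_divide_distrib)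
  finally show ?thesis unfolding m e ..
qed

section \<open>The 39-dimensional space of truncated powers\<close>

definition feature_index :: "((nat \<times> nat) + (nat \<times> nat)) set" where
  "feature_index = (SIGMA i:{..5}. {..5 - i}) <+> ({1..6} \<times> {1..3})"

lemma card_feature_index: "card feature_index = 39" and finite_feature_index: "finite feature_index"
proof -
  have "(\<Sum>i\<le>5::nat. Suc (5 - i)) = 21" by code_simp
  then have "card (SIGMA i:{..5::nat}. {..5 - i}) = 21" by simp
  then show "card feature_index = 39" unfolding feature_index_def
    by (simp add: card_Plus)
  show "finite feature_index" by (simp add: feature_index_def)
qed

context triangle
begin

definition line :: "nat \<Rightarrow> real^2 \<Rightarrow> real" where
  "line l x = (if l = 1 then b 1 x - b 2 x else if l = 2 then b 2 x - b 3 x else if l = 3 then b 1 x - b 3 x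
     else if l = 4 then 2 * b 1 x - 1 else if l = 5 then 2 * b 2 x - 1 else 2 * b 3 x - 1)"

text \<open>The spanning functions: monomials of degree at most five in two barycentric coordinates, and for each of the six lines a truncated
  fourth power times each barycentric coordinate.\<close>

definition feature :: "(nat \<times> nat) + (nat \<times> nat) \<Rightarrow> real^2 \<Rightarrow> real" where
  "feature e x = (case e of Inl (i, j) \<Rightarrow> b 1 x ^ i * b 2 x ^ j | Inr (l, k) \<Rightarrow> tp 4 (line l x) * b k x)"

definition truncated_span :: "(real^2 \<Rightarrow> real) \<Rightarrow> bool" where
  "truncated_span F \<longleftrightarrow> (\<exists>d. \<forall>x\<in>T. F x = (\<Sum>e\<in>feature_index. d e * feature e x))"

lemma truncated_span_cong: "truncated_span F \<Longrightarrow> (\<And>x. x \<in> T \<Longrightarrow> F x = G x) \<Longrightarrow> truncated_span G"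
  unfolding truncated_span_def by simp

lemma truncated_span_add: "truncated_span F \<Longrightarrow> truncated_span G \<Longrightarrow> truncated_span (\<lambda>x. F x + G x)"
proof -
  assume "truncated_span F" "truncated_span G"
  then obtain d d' where "\<forall>x\<in>T. F x = (\<Sum>e\<in>feature_index. d e * feature e x)"
    "\<forall>x\<in>T. G x = (\<Sum>e\<in>feature_index. d' e * feature e x)" by (auto simp: truncated_span_def)
  then show ?thesis unfolding truncated_span_def
    by (intro exI[of _ "\<lambda>e. d e + d' e"]) (simp add: distrib_right sum.distrib)
qed

lemma truncated_span_cmult: "truncated_span F \<Longrightarrow> truncated_span (\<lambda>x. c * F x)"
proof -
  assume "truncated_span F"
  then obtain d where "\<forall>x\<in>T. F x = (\<Sum>e\<in>feature_index. d e * feature e x)" by (auto simp: truncated_span_def)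
  then show ?thesis unfolding truncated_span_def
    by (intro exI[of _ "\<lambda>e. c * d e"]) (simp add: sum_distrib_left mult.assoc)
qed

lemma truncated_span_diff: "truncated_span F \<Longrightarrow> truncated_span G \<Longrightarrow> truncated_span (\<lambda>x. F x - G x)"
  using truncated_span_add[of F "\<lambda>x. (- 1) * G x"] truncated_span_cmult[of G "- 1"] by simp

lemma truncated_span_sum: "finite J \<Longrightarrow> (\<And>j. j \<in> J \<Longrightarrow> truncated_span (F j)) \<Longrightarrow> truncated_span (\<lambda>x. \<Sum>j\<in>J. F j x)"
proof (induction J rule: finite_induct)
  case empty
  show ?case unfolding truncated_span_def by (intro exI[of _ "\<lambda>_. 0"]) simp
qed (simp add: truncated_span_add)

lemma truncated_span_poly:
  assumes "poly_upto 5 p" shows "truncated_span p"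
proof -
  have perm: "perm3 1 2 3" by (simp add: perm3_def)
  have coord: "x $ i = v 3 $ i + (v 1 $ i - v 3 $ i) * b 1 x + (v 2 $ i - v 3 $ i) * b 2 x" for x i
  proof -
    have "affine_fun (\<lambda>x. x $ i)" unfolding affine_fun_def
      by (intro exI[of _ "axis i 1"] exI[of _ 0]) (simp add: inner_axis')
    from affine_fun_bary_form[OF this perm] show ?thesis .
  qed
  have "poly2 (b 1) (b 2) 5 p"
    by (rule poly2_subst[OF assms[unfolded poly_upto_def] coord coord])
  then obtain c where c: "\<And>x. p x = (\<Sum>i\<le>5. \<Sum>j\<le>5 - i. c i j * b 1 x ^ i * b 2 x ^ j)"
    by (auto simp: poly2_def)
  have "p x = (\<Sum>e\<in>feature_index. case_sum (\<lambda>(i, j). c i j) (\<lambda>_. 0) e * feature e x)" for x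
    unfolding c feature_index_def
    by (simp add: sum.Plus feature_def sum.Sigma split_beta mult.assoc)
  then show ?thesis unfolding truncated_span_def by blast
qed

lemma truncated_span_line:
  assumes "l \<in> {1..6}" "affine_fun q" shows "truncated_span (\<lambda>x. tp 4 (line l x) * q x)"
proof -
  have perm: "perm3 1 2 3" by (simp add: perm3_def)
  have q: "q x = q (v 1) * b 1 x + q (v 2) * b 2 x + q (v 3) * b 3 x" for x
  proof -
    have k: "b 3 x = 1 - b 1 x - b 2 x" using perm3_sum[OF perm, of x] by simp
    show ?thesis unfolding affine_fun_bary_form[OF assms(2) perm, of x] k by (simp add: algebra_simps)
  qed
  have "tp 4 (line l x) * q x = (\<Sum>e\<in>feature_index. case_sum (\<lambda>_. 0) (\<lambda>(l', k). if l' = l then q (v k) else 0) e * feature e x)" for x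
  proof -
    have "(\<Sum>e\<in>feature_index. case_sum (\<lambda>_. 0) (\<lambda>(l', k). if l' = l then q (v k) else 0) e * feature e x)
      = (\<Sum>l'\<in>{1..6}. \<Sum>k\<in>{1..3}. (if l' = l then q (v k) else 0) * (tp 4 (line l' x) * b k x))"
      unfolding feature_index_def by (simp add: sum.Plus feature_def sum.cartesian_product split_beta)
    also have "\<dots> = (\<Sum>l'\<in>{1..6}. if l' = l then (\<Sum>k\<in>{1..3}. q (v k) * (tp 4 (line l x) * b k x)) else 0)"
      by (intro sum.cong refl) auto
    also have "\<dots> = (\<Sum>k\<in>{1..3}. q (v k) * (tp 4 (line l x) * b k x))" using assms(1) by (simp add: sum.delta)
    also have "{1..3::nat} = {1, 2, 3}" by auto
    finally show ?thesis unfolding q[of x] by (simp add: algebra_simps)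
  qed
  then show ?thesis unfolding truncated_span_def by blast
qed

lemma affine_fun_line: "affine_fun (line l)"
  unfolding line_def[abs_def]
  by (cases "l = 1"; cases "l = 2"; cases "l = 3"; cases "l = 4"; cases "l = 5") (simp_all add: affine_bary_intros)

lemma spline_imp_truncated_span:
  assumes "s \<in> spline_space v" shows "truncated_span s"
proof -
  obtain p q1 q2 q3 r1 r2 r3 where p: "poly_upto 5 p" and aff: "\<forall>q\<in>{q1, q2, q3, r1, r2, r3}. affine_fun q"
    and s: "\<forall>x\<in>T. s x = p x + tp 4 (b 1 x - b 2 x) * q1 x + tp 4 (b 2 x - b 3 x) * q2 x + tp 4 (b 1 x - b 3 x) * q3 x
      + tp 4 (2 * b 1 x - 1) * r1 x + tp 4 (2 * b 2 x - 1) * r2 x + tp 4 (2 * b 3 x - 1) * r3 x"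
    using spline_truncated_form[OF assms] by blast
  have "truncated_span (\<lambda>x. p x + tp 4 (line 1 x) * q1 x + tp 4 (line 2 x) * q2 x + tp 4 (line 3 x) * q3 x
      + tp 4 (line 4 x) * r1 x + tp 4 (line 5 x) * r2 x + tp 4 (line 6 x) * r3 x)"
    using p aff by (intro truncated_span_add truncated_span_poly truncated_span_line) auto
  then show ?thesis by (rule truncated_span_cong) (simp add: s line_def)
qed

lemma line_nonzero:
  assumes "x \<in> T - ps12_segments v" "l \<in> {1..6}"
  shows "line l x \<noteq> 0"
proof
  assume 0: "line l x = 0"
  have perms: "perm3 1 2 3" "perm3 1 3 2" "perm3 2 1 3" "perm3 2 3 1" "perm3 3 1 2" "perm3 3 2 1"
    by (simp_all add: perm3_def)
  have x: "x \<in> T" using assms by simp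
  have "{1..6::nat} = {1, 2, 3, 4, 5, 6}" by auto
  with assms(2) have "l = 1 \<or> l = 2 \<or> l = 3 \<or> l = 4 \<or> l = 5 \<or> l = 6" by auto
  then have "b 1 x = b 2 x \<or> b 2 x = b 3 x \<or> b 1 x = b 3 x \<or> 2 * b 1 x = 1 \<or> 2 * b 2 x = 1 \<or> 2 * b 3 x = 1"
    using 0 by (elim disjE) (simp_all add: line_def)
  then have "x \<in> ps12_segments v"
    using median_in_segments[OF perms(1) x] median_in_segments[OF perms(4) x] median_in_segments[OF perms(2) x]
      midline_in_segments[OF perms(1) x] midline_in_segments[OF perms(3) x] midline_in_segments[OF perms(5) x] by blast
  then show False using assms by simp
qed

text \<open>A face is connected and no line meets its interior, so on it each truncated power is a polynomial.\<close>

lemma face_line_sign: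
  assumes C: "C \<in> components (T - ps12_segments v)" and l: "l \<in> {1..6}"
  shows "(\<forall>x\<in>closure C. 0 \<le> line l x) \<or> (\<forall>x\<in>closure C. line l x \<le> 0)"
proof -
  have sub: "C \<subseteq> T - ps12_segments v" using C by (rule in_components_subset)
  have cont: "continuous_on S (line l)" for S by (rule affine_fun_continuous[OF affine_fun_line])
  have conn: "connected (line l ` C)"
    using in_components_connected[OF C] cont connected_continuous_image by blast
  have nz: "0 \<notin> line l ` C" using line_nonzero[OF _ l] sub by force
  have "(\<forall>x\<in>C. 0 \<le> line l x) \<or> (\<forall>x\<in>C. line l x \<le> 0)"
  proof (rule ccontr)
    assume "\<not> ?thesis"
    then obtain x y where "x \<in> C" "line l x < 0" "y \<in> C" "0 < line l y" by force
    then have "0 \<in> line l ` C" using connected_contains_Icc[OF conn, of "line l x" "line l y"] by auto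
    with nz show False by simp
  qed
  moreover have "closed {x. 0 \<le> line l x}" "closed {x. line l x \<le> 0}"
    by (intro closed_Collect_le cont continuous_on_const)+
  then have "C \<subseteq> {x. 0 \<le> line l x} \<Longrightarrow> closure C \<subseteq> {x. 0 \<le> line l x}"
    "C \<subseteq> {x. line l x \<le> 0} \<Longrightarrow> closure C \<subseteq> {x. line l x \<le> 0}" by (simp_all add: closure_minimal)
  ultimately show ?thesis by blast
qed

lemma poly_upto_bary: "poly_upto 1 (b i)"
  using affine_fun_bary affine_fun_poly by blast

lemma poly_upto_feature_Inl:
  assumes "i + j \<le> 5" shows "poly_upto 5 (\<lambda>x. b 1 x ^ i * b 2 x ^ j)"
proof -
  have "poly_upto (i + j) (\<lambda>x. b 1 x ^ i * b 2 x ^ j)"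
  proof (induction i)
    case 0 show ?case using poly_upto_power[OF poly_upto_bary, of j 2] by simp
  next
    case (Suc i) then show ?case using poly_upto_mult[OF poly_upto_bary Suc, of 1] by (simp add: mult.assoc)
  qed
  then show ?thesis using assms poly2_mono unfolding poly_upto_def by blast
qed

lemma poly_upto_quartic_mult:
  assumes "affine_fun l" "affine_fun q" shows "poly_upto 5 (\<lambda>x. l x ^ 4 * q x)"
proof -
  have "poly_upto (Suc 4) (\<lambda>x. q x * l x ^ 4)"
    using assms by (intro poly_upto_mult poly_upto_power) (simp_all add: affine_fun_poly)
  then show ?thesis by (simp add: mult.commute)
qed

lemma feature_spline:
  assumes "e \<in> feature_index"
  shows "C_k_on 3 (feature e) T" "\<tau> \<in> ps12_split v \<Longrightarrow> poly_deg_le_on 5 (feature e) \<tau>"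
proof -
  have "C_k_on 3 (feature e) T \<and> (\<tau> \<in> ps12_split v \<longrightarrow> poly_deg_le_on 5 (feature e) \<tau>)"
  proof (cases e)
    case (Inl ij)
    then obtain i j where ij: "e = Inl (i, j)" by (cases ij) auto
    then have "poly_upto 5 (\<lambda>x. b 1 x ^ i * b 2 x ^ j)"
      using assms by (intro poly_upto_feature_Inl) (auto simp: feature_index_def)
    moreover have "feature e = (\<lambda>x. b 1 x ^ i * b 2 x ^ j)" by (simp add: fun_eq_iff feature_def ij)
    ultimately show ?thesis using C_k_on_poly poly_deg_le_on_iff by metis
  next
    case (Inr lk)
    then obtain l k where lk: "e = Inr (l, k)" by (cases lk) auto
    then have l: "l \<in> {1..6}" using assms by (auto simp: feature_index_def)
    have f: "feature e = (\<lambda>x. tp 4 (line l x) * b k x)" by (simp add: fun_eq_iff feature_def lk)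
    have "C_k_on 3 (feature e) T" unfolding f
      by (intro C_k_on_mult C_k_on_tp_affine affine_fun_line C_k_on_poly[OF poly_upto_bary]) simp
    moreover have "poly_deg_le_on 5 (feature e) \<tau>" if \<tau>: "\<tau> \<in> ps12_split v"
    proof -
      obtain C where C: "C \<in> components (T - ps12_segments v)" "\<tau> = closure C" using \<tau> by (auto simp: ps12_split_def)
      have pos: "poly_upto 5 (\<lambda>x. (1/24) * (line l x ^ 4 * b k x))"
        using poly2_cmult poly_upto_quartic_mult[OF affine_fun_line affine_fun_bary] unfolding poly_upto_def by blast
      have neg: "poly_upto 5 (\<lambda>x. 0)" unfolding poly_upto_def by (rule poly2_const)
      from face_line_sign[OF C(1) l] show ?thesis
      proof
        assume "\<forall>x\<in>closure C. 0 \<le> line l x"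
        then show ?thesis unfolding poly_deg_le_on_iff C(2) f
          by (intro exI[of _ "\<lambda>x. (1/24) * (line l x ^ 4 * b k x)"] conjI pos) (simp add: tp_4_pos)
      next
        assume "\<forall>x\<in>closure C. line l x \<le> 0"
        then show ?thesis unfolding poly_deg_le_on_iff C(2) f
          by (intro exI[of _ "\<lambda>x. 0"] conjI neg) (simp add: tp_4_neg)
      qed
    qed
    ultimately show ?thesis by blast
  qed
  then show "C_k_on 3 (feature e) T" "\<tau> \<in> ps12_split v \<Longrightarrow> poly_deg_le_on 5 (feature e) \<tau>" by blast+
qed

lemma truncated_span_spline:
  assumes "truncated_span F" shows "restrict F T \<in> spline_space v"
proof -
  obtain d where d: "\<forall>x\<in>T. F x = (\<Sum>e\<in>feature_index. d e * feature e x)" using assms by (auto simp: truncated_span_def)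
  have "C_k_on 3 (\<lambda>x. \<Sum>e\<in>feature_index. d e * feature e x) T"
    by (intro C_k_on_sum C_k_on_mult C_k_on_const feature_spline)
  then have "C_k_on 3 (restrict F T) T" by (rule C_k_on_cong[rotated]) (simp add: d)
  moreover have "poly_deg_le_on 5 (restrict F T) \<tau>" if \<tau>: "\<tau> \<in> ps12_split v" for \<tau>
  proof -
    have "closed T" unfolding macro_triangle_def by (simp add: compact_imp_closed compact_convex_hull finite_imp_compact)
    moreover obtain C where C: "C \<in> components (T - ps12_segments v)" "\<tau> = closure C" using \<tau> by (auto simp: ps12_split_def)
    moreover have "C \<subseteq> T" using in_components_subset[OF C(1)] by blast
    ultimately have sub: "\<tau> \<subseteq> T" by (simp add: closure_minimal)
    have "\<forall>e\<in>feature_index. \<exists>p. poly_upto 5 p \<and> (\<forall>x\<in>\<tau>. feature e x = p x)"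
      using feature_spline(2)[OF _ \<tau>] by (auto simp: poly_deg_le_on_iff)
    then obtain p where p: "\<And>e. e \<in> feature_index \<Longrightarrow> poly_upto 5 (p e) \<and> (\<forall>x\<in>\<tau>. feature e x = p e x)" by metis
    have "poly_upto 5 (\<lambda>x. \<Sum>e\<in>feature_index. d e * p e x)"
      using p unfolding poly_upto_def by (intro poly2_sum poly2_cmult) auto
    moreover have "restrict F T x = (\<Sum>e\<in>feature_index. d e * p e x)" if "x \<in> \<tau>" for x
      using that sub d p by (auto intro!: sum.cong)
    ultimately show ?thesis unfolding poly_deg_le_on_iff by blast
  qed
  ultimately show ?thesis by (simp add: spline_space_def)
qed

definition is_line :: "(real^2 \<Rightarrow> real) \<Rightarrow> bool" where
  "is_line L \<longleftrightarrow> (\<exists>l\<in>{1..6}. (\<forall>x. L x = line l x) \<or> (\<forall>x. L x = - line l x))"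

lemma is_line_bary:
  assumes "perm3 i j k"
  shows "is_line (\<lambda>x. b i x - b j x)" "is_line (\<lambda>x. b i x - b j x - b k x)" "is_line (\<lambda>x. b i x + b j x - b k x)"
proof -
  have k: "b k x = 1 - b i x - b j x" for x using perm3_sum[OF assms, of x] by simp
  have "\<exists>l\<in>{1, 2, 3, 4, 5, 6}. (\<forall>x. b i x - b j x = line l x) \<or> (\<forall>x. b i x - b j x = - line l x)"
    using assms by (elim perm3_cases) (simp_all add: line_def)
  moreover have "\<exists>l\<in>{1, 2, 3, 4, 5, 6}. \<forall>x. 2 * b c x - 1 = line l x" if "c \<in> {1, 2, 3}" for c
    using that by (auto simp: line_def)
  then have "\<exists>l\<in>{1, 2, 3, 4, 5, 6}. \<forall>x. 2 * b i x - 1 = line l x" "\<exists>l\<in>{1, 2, 3, 4, 5, 6}. \<forall>x. 2 * b k x - 1 = line l x"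
    using assms by (auto elim!: perm3_cases)
  moreover have "b i x - b j x - b k x = 2 * b i x - 1" "b i x + b j x - b k x = - (2 * b k x - 1)" for x
    by (simp_all add: k)
  moreover have "{1, 2, 3, 4, 5, 6} = {1..6::nat}" by auto
  ultimately show "is_line (\<lambda>x. b i x - b j x)" "is_line (\<lambda>x. b i x - b j x - b k x)" "is_line (\<lambda>x. b i x + b j x - b k x)"
    unfolding is_line_def by metis+
qed

text \<open>The orientation of a line does not matter, since the truncated powers of the two orientations add
  up to a polynomial.\<close>

lemma truncated_span_quartic:
  assumes "is_line L" "affine_fun q" shows "truncated_span (\<lambda>x. pos_pow 4 (L x) * q x)"
proof -
  obtain l where l: "l \<in> {1..6}" "(\<forall>x. L x = line l x) \<or> (\<forall>x. L x = - line l x)"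
    using assms(1) by (auto simp: is_line_def)
  have V: "truncated_span (\<lambda>x. 24 * (tp 4 (line l x) * q x))" by (intro truncated_span_cmult truncated_span_line l(1) assms(2))
  from l(2) show ?thesis
  proof
    assume "\<forall>x. L x = line l x"
    then show ?thesis by (intro truncated_span_cong[OF V]) (simp add: pos_pow_4_5)
  next
    assume L: "\<forall>x. L x = - line l x"
    have "truncated_span (\<lambda>x. line l x ^ 4 * q x - 24 * (tp 4 (line l x) * q x))"
      by (intro truncated_span_diff V truncated_span_poly poly_upto_quartic_mult affine_fun_line assms(2))
    then show ?thesis
    proof (rule truncated_span_cong)
      fix x
      have "24 * tp 4 (- line l x) = line l x ^ 4 - 24 * tp 4 (line l x)"
        using tp_4_pair[of "line l x"] by simp
      then show "line l x ^ 4 * q x - 24 * (tp 4 (line l x) * q x) = pos_pow 4 (L x) * q x"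
        using L by (simp add: pos_pow_4_5 left_diff_distrib)
    qed
  qed
qed

lemma truncated_span_quintic: assumes "is_line L" shows "truncated_span (\<lambda>x. pos_pow 5 (L x))"
proof -
  have "affine_fun L"
    using assms affine_fun_line affine_fun_cmult[OF affine_fun_line, of "- 1"] unfolding is_line_def
    by (auto simp: fun_eq_iff[symmetric])
  from truncated_span_quartic[OF assms this] show ?thesis
    by (rule truncated_span_cong) (simp add: pos_pow_4_5)
qed

lemma truncated_span_profile:
  assumes perm: "perm3 i j k"
  shows "truncated_span (\<lambda>x. profile g (b i x) (b j x) (b k x))"
proof -
  note swap = perm3_swap[OF perm] perm3_swap(2)[OF perm3_swap(1)[OF perm]] perm3_swap(1)[OF perm3_swap(2)[OF perm]]
  have perms: "perm3 j i k" "perm3 i k j" "perm3 j k i" "perm3 k i j" "perm3 k j i"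
    using swap perm3_swap(1)[OF swap(3)] by simp_all
  note lines = is_line_bary[OF perm] is_line_bary[OF perms(1)] is_line_bary[OF perms(2)] is_line_bary[OF perms(3)]
    is_line_bary[OF perms(4)] is_line_bary[OF perms(5)]
  have "poly_upto 5 (\<lambda>x. b j x ^ 5)" by (intro poly_upto_power poly_upto_bary)
  then have y5: "truncated_span (\<lambda>x. b j x ^ 5)" by (rule truncated_span_poly)
  have "truncated_span (\<lambda>x. b j x ^ 4 * b k x)" by (intro truncated_span_poly poly_upto_quartic_mult affine_fun_bary)
  from truncated_span_cmult[OF this, of 20] have y4z: "truncated_span (\<lambda>x. b k x * (20 * b j x ^ 4))"
    by (rule truncated_span_cong) simp
  note rules = truncated_span_quartic truncated_span_quintic truncated_span_cmult lines y5 y4z truncated_span_add truncated_span_diff affine_fun_bary affine_fun_intros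
  consider "g = 0" | "g = 1" | "g = 2" | "g = 3" | "g = 4" | "g = 5" | "g = 6"
    | "g \<noteq> 0 \<and> g \<noteq> 1 \<and> g \<noteq> 2 \<and> g \<noteq> 3 \<and> g \<noteq> 4 \<and> g \<noteq> 5 \<and> g \<noteq> 6" by argo
  then show ?thesis
    by cases (simp_all add: profile_def, (intro rules)+)
qed

text \<open>The generators are numbered as in \<^const>\<open>label_gens\<close>.\<close>

lemma spline_profile:
  assumes "g < 8"
  shows "\<exists>\<kappa>>0. \<forall>x\<in>T. simplex_spline v (fst (snd (label_gens ! g))) x = \<kappa> * profile g (b 1 x) (b 2 x) (b 3 x)"
proof -
  have scale: "\<exists>\<kappa>>0. \<forall>x\<in>T. f x = \<kappa> * profile g (b 1 x) (b 2 x) (b 3 x)"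
    if "\<exists>\<kappa>>0. \<forall>x. f x = \<kappa> * h x" and eq: "\<And>x. x \<in> T \<Longrightarrow> h x = profile g (b 1 x) (b 2 x) (b 3 x) / 480" for f h
  proof -
    from that(1) obtain \<kappa> where k: "\<kappa> > 0 \<and> (\<forall>x. f x = \<kappa> * h x)" ..
    have "f x = \<kappa> / 480 * profile g (b 1 x) (b 2 x) (b 3 x)" if "x \<in> T" for x
      using k eq[OF that] by simp
    with k show ?thesis by (intro exI[of _ "\<kappa> / 480"]) simp
  qed
  have pos: "0 \<le> b 1 x" "0 \<le> b 2 x" "0 \<le> b 3 x" if "x \<in> T" for x using that by (simp_all add: triangle_bary)
  have tp0: "tp 0 (b 1 x) = 1" "tp 0 (b 2 x) = 1" "tp 0 (b 3 x) = 1" "tp 1 (b 2 x) = b 2 x" "tp 4 (b 2 x) = b 2 x ^ 4 / 24"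
    if "x \<in> T" for x using pos[OF that] by (simp_all add: tp_def fact_numeral)
  have y5: "y ^ 5 = y * y ^ 4" for y :: real using power_Suc[of y 4] by simp
  have "g = 0 \<or> g = 1 \<or> g = 2 \<or> g = 3 \<or> g = 4 \<or> g = 5 \<or> g = 6 \<or> g = 7" using assms by linarith
  then show ?thesis
  proof (elim disjE)
    assume g: "g = 0"
    have m: "fst (snd (label_gens ! 0)) = [6,0,0,1,0,1]" by (simp add: label_gens_def)
    show ?thesis unfolding g m
    proof (rule scale[unfolded g, OF spline_600101], goal_cases)
      case (1 x)
      note that = this
      then show ?case by (auto simp: profile_def pos_pow_4_5 tp_5 tp0[OF that] y5 algebra_simps add_divide_distrib diff_divide_distrib)
    qed
  next
    assume g: "g = 1"
    have m: "fst (snd (label_gens ! 1)) = [5,0,0,2,0,1]" by (simp add: label_gens_def)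
    show ?thesis unfolding g m
    proof (rule scale[unfolded g, OF spline_500201], goal_cases)
      case (1 x)
      note that = this
      then show ?case by (auto simp: profile_def pos_pow_4_5 tp_5 tp0[OF that] y5 algebra_simps add_divide_distrib diff_divide_distrib)
    qed
  next
    assume g: "g = 2"
    have m: "fst (snd (label_gens ! 2)) = [4,1,0,2,0,1]" by (simp add: label_gens_def)
    show ?thesis unfolding g m
    proof (rule scale[unfolded g, OF spline_410201], goal_cases)
      case (1 x)
      note that = this
      then show ?case by (auto simp: profile_def pos_pow_4_5 tp_5 tp0[OF that] y5 algebra_simps add_divide_distrib diff_divide_distrib)
    qed
  next
    assume g: "g = 3"
    have m: "fst (snd (label_gens ! 3)) = [3,2,0,2,0,1]" by (simp add: label_gens_def)
    show ?thesis unfolding g m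
    proof (rule scale[unfolded g, OF spline_320201], goal_cases)
      case (1 x)
      note that = this
      then show ?case by (auto simp: profile_def pos_pow_4_5 tp_5 tp0[OF that] y5 algebra_simps add_divide_distrib diff_divide_distrib)
    qed
  next
    assume g: "g = 4"
    have m: "fst (snd (label_gens ! 4)) = [2,2,0,2,1,1]" by (simp add: label_gens_def)
    show ?thesis unfolding g m
    proof (rule scale[unfolded g, OF spline_220211], goal_cases)
      case (1 x)
      note that = this
      then show ?case using profile_4[OF pos[OF that]] by (simp add: tp0[OF that])
    qed
  next
    assume g: "g = 5"
    have m: "fst (snd (label_gens ! 5)) = [1,4,1,1,1,0]" by (simp add: label_gens_def)
    show ?thesis unfolding g m
    proof (rule scale[unfolded g, OF spline_141110], goal_cases)
      case (1 x)
      note that = this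
      then show ?case by (auto simp: profile_def pos_pow_4_5 tp_5 tp0[OF that] y5 algebra_simps add_divide_distrib diff_divide_distrib)
    qed
  next
    assume g: "g = 6"
    have m: "fst (snd (label_gens ! 6)) = [1,3,1,2,1,0]" by (simp add: label_gens_def)
    show ?thesis unfolding g m
    proof (rule scale[unfolded g, OF spline_131210], goal_cases)
      case (1 x)
      note that = this
      then show ?case by (auto simp: profile_def pos_pow_4_5 tp_5 tp0[OF that] y5 algebra_simps add_divide_distrib diff_divide_distrib)
    qed
  next
    assume g: "g = 7"
    have m: "fst (snd (label_gens ! 7)) = [1,2,1,2,1,1]" by (simp add: label_gens_def)
    show ?thesis unfolding g m
    proof (rule scale[unfolded g, OF spline_121211], goal_cases)
      case (1 x)
      note that = this
      then show ?case using profile_7[OF pos[OF that]] by (simp add: tp0[OF that])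
    qed
  qed
qed

end

section \<open>The collocation matrix modulo 7\<close>

text \<open>One permutation and one generator for each of the 39 basis functions; several of the 48 combinations
  give the same function.\<close>

definition basis_index :: "(nat list \<times> nat) list" where
  "basis_index = [([1,2,3], 0), ([2,1,3], 0), ([3,1,2], 0), ([1,2,3], 1), ([1,3,2], 1), ([2,1,3], 1), ([2,3,1], 1), ([3,1,2], 1), ([3,2,1], 1), ([1,2,3], 2), ([1,3,2], 2), ([2,1,3], 2), ([2,3,1], 2), ([3,1,2], 2), ([3,2,1], 2), ([1,2,3], 3), ([1,3,2], 3), ([2,1,3], 3), ([2,3,1], 3), ([3,1,2], 3), ([3,2,1], 3), ([1,2,3], 4), ([1,3,2], 4), ([2,3,1], 4), ([1,2,3], 5), ([1,3,2], 5), ([2,1,3], 5), ([1,2,3], 6), ([1,3,2], 6), ([2,1,3], 6), ([2,3,1], 6), ([3,1,2], 6), ([3,2,1], 6), ([1,2,3], 7), ([1,3,2], 7), ([2,1,3], 7), ([2,3,1], 7), ([3,1,2], 7), ([3,2,1], 7)]"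

text \<open>Six times the barycentric coordinate of a labelled point; the sum of five of them is thirty times that of a domain point.\<close>

definition label_coord :: "nat \<Rightarrow> nat \<Rightarrow> int" where
  "label_coord c i = (if i = 10 then 2 else if i \<le> 3 then (if i = c then 6 else 0)
     else if (i = 4 \<and> c = 3) \<or> (i = 5 \<and> c = 1) \<or> (i = 6 \<and> c = 2) then 0 else 3)"

definition point_coord :: "nat list \<times> nat \<Rightarrow> nat \<Rightarrow> int" where
  "point_coord e c = sum_list (map (\<lambda>i. label_coord c (relabel (fst e) i)) (snd (snd (label_gens ! snd e))))"

definition colloc_entry :: "int list \<Rightarrow> nat list \<times> nat \<Rightarrow> int" where
  "colloc_entry X e = profile (snd e) (X ! (fst e ! 0 - 1)) (X ! (fst e ! 1 - 1)) (X ! (fst e ! 2 - 1))"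

definition point_coords :: "nat list \<times> nat \<Rightarrow> int list" where
  "point_coords e = [point_coord e 1, point_coord e 2, point_coord e 3]"

text \<open>The reduction of the matrix modulo 7, stored by columns.\<close>

definition colloc_cols_mod7 :: "int list list" where
  "colloc_cols_mod7 = [[2,0,0,6,6,0,0,0,0,1,1,0,0,0,0,3,3,0,0,0,0,0,0,0,0,0,1,0,0,3,0,3,0,0,0,0,0,0,0],
   [0,2,0,0,0,6,6,0,0,0,0,1,1,0,0,0,0,3,3,0,0,0,0,0,1,0,0,3,0,0,0,0,3,0,0,0,0,0,0],
   [0,0,2,0,0,0,0,6,6,0,0,0,0,1,1,0,0,0,0,3,3,0,0,0,0,1,0,0,3,0,3,0,0,0,0,0,0,0,0],
   [0,0,0,2,0,0,0,0,0,4,0,0,0,0,0,2,0,0,0,0,0,0,0,0,0,0,2,0,0,5,0,4,0,0,0,0,0,0,0],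
   [0,0,0,0,2,0,0,0,0,0,4,0,0,0,0,0,2,0,0,0,0,0,0,0,0,0,2,0,0,4,0,5,0,0,0,0,0,0,0],
   [0,0,0,0,0,2,0,0,0,0,0,4,0,0,0,0,0,2,0,0,0,0,0,0,2,0,0,5,0,0,0,0,4,0,0,0,0,0,0],
   [0,0,0,0,0,0,2,0,0,0,0,0,4,0,0,0,0,0,2,0,0,0,0,0,2,0,0,4,0,0,0,0,5,0,0,0,0,0,0],
   [0,0,0,0,0,0,0,2,0,0,0,0,0,4,0,0,0,0,0,2,0,0,0,0,0,2,0,0,5,0,4,0,0,0,0,0,0,0,0],
   [0,0,0,0,0,0,0,0,2,0,0,0,0,0,4,0,0,0,0,0,2,0,0,0,0,2,0,0,4,0,5,0,0,0,0,0,0,0,0],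
   [0,0,0,2,0,6,0,0,0,1,0,3,0,0,0,3,0,5,0,0,0,5,0,0,0,0,4,3,0,3,0,2,0,3,0,2,0,6,0],
   [0,0,0,0,2,0,0,6,0,0,1,0,0,3,0,0,3,0,0,5,0,0,5,0,0,0,4,0,3,2,0,3,0,0,3,6,0,2,0],
   [0,0,0,6,0,2,0,0,0,3,0,1,0,0,0,5,0,3,0,0,0,5,0,0,4,0,0,3,0,3,0,0,2,2,0,3,0,0,6],
   [0,0,0,0,0,0,2,0,6,0,0,0,1,0,3,0,0,0,3,0,5,0,0,5,4,0,0,2,0,0,3,0,3,6,0,0,3,0,2],
   [0,0,0,0,6,0,0,2,0,0,3,0,0,1,0,0,5,0,0,3,0,0,5,0,0,4,0,0,3,0,2,3,0,0,2,0,6,3,0],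
   [0,0,0,0,0,0,6,0,2,0,0,0,3,0,1,0,0,0,5,0,3,0,0,5,0,4,0,0,2,0,3,0,3,0,6,0,2,0,3],
   [0,0,0,5,0,6,0,0,0,5,0,5,0,0,0,0,0,3,0,0,0,4,0,0,0,0,4,4,0,1,0,0,0,1,0,2,0,3,0],
   [0,0,0,0,5,0,0,6,0,0,5,0,0,5,0,0,0,0,0,3,0,0,4,0,0,0,4,0,4,0,0,1,0,0,1,3,0,2,0],
   [0,0,0,6,0,5,0,0,0,5,0,5,0,0,0,3,0,0,0,0,0,4,0,0,4,0,0,1,0,4,0,0,0,2,0,1,0,0,3],
   [0,0,0,0,0,0,5,0,6,0,0,0,5,0,5,0,0,0,0,0,3,0,0,4,4,0,0,0,0,0,4,0,1,3,0,0,1,0,2],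
   [0,0,0,0,6,0,0,5,0,0,5,0,0,5,0,0,3,0,0,0,0,0,4,0,0,4,0,0,1,0,0,4,0,0,2,0,3,1,0],
   [0,0,0,0,0,0,6,0,5,0,0,0,5,0,5,0,0,0,3,0,0,0,0,4,0,4,0,0,0,0,1,0,4,0,3,0,2,0,1],
   [0,0,0,0,0,0,0,0,0,0,0,0,0,0,0,0,0,0,0,0,0,6,4,4,1,0,1,3,0,3,0,0,0,5,4,5,4,6,6],
   [0,0,0,0,0,0,0,0,0,0,0,0,0,0,0,0,0,0,0,0,0,4,6,4,0,1,1,0,3,0,0,3,0,4,5,6,6,5,4],
   [0,0,0,0,0,0,0,0,0,0,0,0,0,0,0,0,0,0,0,0,0,4,4,6,1,1,0,0,0,0,3,0,3,6,6,4,5,4,5],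
   [0,0,0,0,0,0,0,0,0,0,0,0,0,0,0,0,0,0,0,0,0,2,2,2,0,6,6,5,6,6,6,6,5,6,5,5,5,5,6],
   [0,0,0,0,0,0,0,0,0,0,0,0,0,0,0,0,0,0,0,0,0,2,2,2,6,0,6,6,5,6,5,6,6,5,6,5,6,5,5],
   [0,0,0,0,0,0,0,0,0,0,0,0,0,0,0,0,0,0,0,0,0,2,2,2,6,6,0,6,6,5,6,5,6,5,5,6,5,6,5],
   [0,0,0,0,0,0,0,0,0,0,0,0,0,0,0,0,0,0,0,0,0,2,2,6,2,6,6,0,6,6,2,6,5,1,5,5,3,5,2],
   [0,0,0,0,0,0,0,0,0,0,0,0,0,0,0,0,0,0,0,0,0,2,2,6,6,2,6,6,0,6,5,6,2,5,1,5,2,5,3],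
   [0,0,0,0,0,0,0,0,0,0,0,0,0,0,0,0,0,0,0,0,0,2,6,2,6,6,2,6,2,0,6,5,6,5,3,1,5,2,5],
   [0,0,0,0,0,0,0,0,0,0,0,0,0,0,0,0,0,0,0,0,0,2,6,2,6,2,6,6,5,6,0,2,6,5,2,5,1,3,5],
   [0,0,0,0,0,0,0,0,0,0,0,0,0,0,0,0,0,0,0,0,0,6,2,2,6,6,2,2,6,5,6,0,6,3,5,2,5,1,5],
   [0,0,0,0,0,0,0,0,0,0,0,0,0,0,0,0,0,0,0,0,0,6,2,2,2,6,6,5,6,2,6,6,0,2,5,3,5,5,1],
   [0,0,0,0,0,0,0,0,0,0,0,0,0,0,0,0,0,0,0,0,0,4,6,2,6,4,3,0,1,2,0,0,5,3,6,6,3,5,6],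
   [0,0,0,0,0,0,0,0,0,0,0,0,0,0,0,0,0,0,0,0,0,6,4,2,4,6,3,1,0,0,5,2,0,6,3,5,6,6,3],
   [0,0,0,0,0,0,0,0,0,0,0,0,0,0,0,0,0,0,0,0,0,4,2,6,3,4,6,2,0,0,1,5,0,6,3,3,6,6,5],
   [0,0,0,0,0,0,0,0,0,0,0,0,0,0,0,0,0,0,0,0,0,6,2,4,3,6,4,0,5,1,0,0,2,5,6,6,3,3,6],
   [0,0,0,0,0,0,0,0,0,0,0,0,0,0,0,0,0,0,0,0,0,2,4,6,4,3,6,0,2,5,0,0,1,3,6,6,5,3,6],
   [0,0,0,0,0,0,0,0,0,0,0,0,0,0,0,0,0,0,0,0,0,2,6,4,6,3,4,5,0,0,2,1,0,6,5,3,6,6,3]]"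

text \<open>Found by Gaussian elimination modulo 7, the smallest prime that does not divide the determinant.\<close>

definition colloc_inv_mod7 :: "int list list" where
  "colloc_inv_mod7 = [[4,0,0,0,0,0,0,0,0,0,0,0,0,0,0,0,0,0,0,0,0,0,0,0,0,0,0,0,0,0,0,0,0,0,0,0,0,0,0],
   [0,4,0,0,0,0,0,0,0,0,0,0,0,0,0,0,0,0,0,0,0,0,0,0,0,0,0,0,0,0,0,0,0,0,0,0,0,0,0],
   [0,0,4,0,0,0,0,0,0,0,0,0,0,0,0,0,0,0,0,0,0,0,0,0,0,0,0,0,0,0,0,0,0,0,0,0,0,0,0],
   [4,5,0,6,0,4,0,0,0,2,0,3,0,0,0,1,0,4,0,0,0,0,0,0,0,0,0,0,0,0,0,0,0,0,0,0,0,0,0],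
   [4,0,5,0,6,0,0,4,0,0,2,0,0,3,0,0,1,0,0,4,0,0,0,0,0,0,0,0,0,0,0,0,0,0,0,0,0,0,0],
   [5,4,0,4,0,6,0,0,0,3,0,2,0,0,0,4,0,1,0,0,0,0,0,0,0,0,0,0,0,0,0,0,0,0,0,0,0,0,0],
   [0,4,5,0,0,0,6,0,4,0,0,0,2,0,3,0,0,0,1,0,4,0,0,0,0,0,0,0,0,0,0,0,0,0,0,0,0,0,0],
   [5,0,4,0,4,0,0,6,0,0,3,0,0,2,0,0,4,0,0,1,0,0,0,0,0,0,0,0,0,0,0,0,0,0,0,0,0,0,0],
   [0,5,4,0,0,0,4,0,6,0,0,0,3,0,2,0,0,0,4,0,1,0,0,0,0,0,0,0,0,0,0,0,0,0,0,0,0,0,0],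
   [3,3,0,1,0,4,0,0,0,6,0,5,0,0,0,1,0,0,0,0,0,0,0,0,0,0,0,0,0,0,0,0,0,0,0,0,0,0,0],
   [3,0,3,0,1,0,0,4,0,0,6,0,0,5,0,0,1,0,0,0,0,0,0,0,0,0,0,0,0,0,0,0,0,0,0,0,0,0,0],
   [3,3,0,4,0,1,0,0,0,5,0,6,0,0,0,0,0,1,0,0,0,0,0,0,0,0,0,0,0,0,0,0,0,0,0,0,0,0,0],
   [0,3,3,0,0,0,1,0,4,0,0,0,6,0,5,0,0,0,1,0,0,0,0,0,0,0,0,0,0,0,0,0,0,0,0,0,0,0,0],
   [3,0,3,0,4,0,0,1,0,0,5,0,0,6,0,0,0,0,0,1,0,0,0,0,0,0,0,0,0,0,0,0,0,0,0,0,0,0,0],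
   [0,3,3,0,0,0,4,0,1,0,0,0,5,0,6,0,0,0,0,0,1,0,0,0,0,0,0,0,0,0,0,0,0,0,0,0,0,0,0],
   [5,4,0,1,0,0,0,0,0,4,0,3,0,0,0,5,0,1,0,0,0,0,0,0,0,0,0,0,0,0,0,0,0,0,0,0,0,0,0],
   [5,0,4,0,1,0,0,0,0,0,4,0,0,3,0,0,5,0,0,1,0,0,0,0,0,0,0,0,0,0,0,0,0,0,0,0,0,0,0],
   [4,5,0,0,0,1,0,0,0,3,0,4,0,0,0,1,0,5,0,0,0,0,0,0,0,0,0,0,0,0,0,0,0,0,0,0,0,0,0],
   [0,5,4,0,0,0,1,0,0,0,0,0,4,0,3,0,0,0,5,0,1,0,0,0,0,0,0,0,0,0,0,0,0,0,0,0,0,0,0],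
   [4,0,5,0,0,0,0,1,0,0,3,0,0,4,0,0,1,0,0,5,0,0,0,0,0,0,0,0,0,0,0,0,0,0,0,0,0,0,0],
   [0,4,5,0,0,0,0,0,1,0,0,0,3,0,4,0,0,0,1,0,5,0,0,0,0,0,0,0,0,0,0,0,0,0,0,0,0,0,0],
   [5,5,2,5,6,5,6,1,1,4,4,4,4,4,4,1,1,1,1,4,4,4,6,6,2,1,2,2,0,2,0,0,0,1,2,1,2,4,4],
   [5,2,5,6,5,1,1,5,6,4,4,4,4,4,4,1,1,4,4,1,1,6,4,6,1,2,2,0,2,0,0,2,0,2,1,4,4,1,2],
   [2,5,5,1,1,6,5,6,5,4,4,4,4,4,4,4,4,1,1,1,1,6,6,4,2,2,1,0,0,0,2,0,2,4,4,2,1,2,1],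
   [1,5,1,3,1,0,0,1,3,3,2,6,6,2,3,2,5,5,5,5,2,3,4,3,4,2,2,0,6,4,4,6,0,0,5,6,6,5,0],
   [1,1,5,1,3,1,3,0,0,2,3,2,3,6,6,5,2,5,2,5,5,4,3,3,2,4,2,6,0,6,0,4,4,5,0,5,0,6,6],
   [5,1,1,0,0,3,1,3,1,6,6,3,2,3,2,5,5,2,5,2,5,3,3,4,2,2,4,4,4,0,6,0,6,6,6,0,5,0,5],
   [2,0,0,0,0,1,2,6,4,6,0,2,2,6,2,0,5,5,5,1,5,3,3,1,2,5,6,6,1,3,6,3,4,4,5,2,4,5,4],
   [2,0,0,0,0,6,4,1,2,0,6,6,2,2,2,5,0,1,5,5,5,3,3,1,5,2,6,1,6,3,4,3,6,5,4,5,4,2,4],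
   [0,2,0,1,2,0,0,4,6,2,2,6,0,2,6,5,5,0,5,5,1,3,1,3,6,5,2,3,6,6,1,4,3,2,4,4,5,4,5],
   [0,2,0,6,4,0,0,2,1,6,2,0,6,2,2,1,5,5,0,5,5,3,1,3,6,2,5,3,4,1,6,6,3,5,4,5,4,4,2],
   [0,0,2,2,1,4,6,0,0,2,2,2,6,6,0,5,5,5,1,0,5,1,3,3,5,6,2,6,3,4,3,6,1,4,2,4,5,4,5],
   [0,0,2,4,6,2,1,0,0,2,6,2,2,0,6,5,1,5,5,5,0,1,3,3,2,6,5,4,3,6,3,1,6,4,5,4,2,5,4],
   [1,1,6,1,4,4,0,6,3,6,0,5,2,6,2,5,6,0,5,3,0,1,6,6,0,4,3,1,3,3,3,5,4,5,5,2,2,1,5],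
   [1,6,1,4,1,6,3,4,0,0,6,6,2,5,2,6,5,3,0,0,5,6,1,6,4,0,3,3,1,5,4,3,3,5,5,1,5,2,2],
   [1,1,6,4,0,1,4,3,6,5,2,6,0,2,6,0,5,5,6,0,3,1,6,6,3,4,0,3,3,1,3,4,5,2,2,5,5,5,1],
   [6,1,1,6,3,4,1,0,4,6,2,0,6,2,5,3,0,6,5,5,0,6,6,1,3,0,4,5,4,3,1,3,3,1,5,5,5,2,2],
   [1,6,1,0,4,3,6,1,4,2,5,2,6,6,0,5,0,0,3,5,6,6,1,6,4,3,0,3,3,4,5,1,3,2,2,5,1,5,5],
   [6,1,1,3,6,0,4,4,1,2,6,2,5,0,6,0,3,5,0,6,5,6,6,1,0,3,4,4,5,3,3,3,1,5,1,2,2,5,5]]"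

lemma basis_index_labels: "set (map (\<lambda>(q, g). relabel_gen q (label_gens ! g)) basis_index) = set label_basis"
proof -
  have "list_all (\<lambda>x. List.member label_basis x) (map (\<lambda>(q, g). relabel_gen q (label_gens ! g)) basis_index)
     \<and> list_all (\<lambda>x. List.member (map (\<lambda>(q, g). relabel_gen q (label_gens ! g)) basis_index) x) label_basis"
    by code_simp
  then show ?thesis by (auto simp: list_all_iff List.member_iff)
qed

lemma colloc_cols_mod7: "map (\<lambda>e. map (\<lambda>X. colloc_entry X e mod 7) (map point_coords basis_index)) basis_index = colloc_cols_mod7"
  by code_simp

lemma colloc_inv_mod7:
  "map (\<lambda>r. map (\<lambda>c. sum_list (map2 (*) r c) mod 7) colloc_cols_mod7) colloc_inv_mod7
    = map (\<lambda>i. map (\<lambda>j. if i = j then 1 else 0) [0..<39]) [0..<39]"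
  by code_simp

lemma length_colloc_inv: "length colloc_inv_mod7 = 39" "\<forall>r\<in>set colloc_inv_mod7. length r = 39"
  by (simp_all add: colloc_inv_mod7_def)

lemma basis_index_wf:
  "length basis_index = 39 \<and> (\<forall>(q, g)\<in>set basis_index. q \<in> set label_perms \<and> g < 8)"
  by (simp add: basis_index_def label_perms_def)

lemma label_gens_wf:
  "\<forall>(n, m, d)\<in>set label_gens. 0 < n \<and> length d = 5"
  by (simp add: label_gens_def)

section \<open>Unisolvence\<close>

lemma label_gens_length: "g < 8 \<Longrightarrow> g < length label_gens"
  by (simp add: label_gens_def)

lemma det_mod_cong:
  fixes A B :: "int^'n^'n"
  assumes "\<And>i j. A $ i $ j mod m = B $ i $ j mod m"
  shows "det A mod m = det B mod m"
proof -
  have prod: "prod f UNIV mod m = prod g UNIV mod m" if "\<And>i. f i mod m = g i mod m" for f g :: "'n \<Rightarrow> int"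
    using mod_prod_eq[of f m UNIV] mod_prod_eq[of g m UNIV] that by simp
  have "(of_int (sign p) * (\<Prod>i\<in>UNIV. A $ i $ p i)) mod m = (of_int (sign p) * (\<Prod>i\<in>UNIV. B $ i $ p i)) mod m" for p
    by (rule mod_mult_cong[OF refl prod]) (rule assms)
  then show ?thesis unfolding det_def
    by (subst (1 2) mod_sum_eq[symmetric]) simp
qed

text \<open>Invertibility modulo \<open>m\<close> keeps the determinant away from zero, and the entries to be multiplied are
  single digits.\<close>

lemma det_nonzero_mod:
  fixes A B :: "int^'n^'n"
  assumes "1 < m" "\<And>i j. (B ** A) $ i $ j mod m = (if i = j then 1 else 0)"
  shows "det A \<noteq> 0"
proof
  assume "det A = 0"
  have "(B ** A) $ i $ j mod m = (mat 1 :: int^'n^'n) $ i $ j mod m" for i j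
    using assms by (simp add: mat_def)
  then have "det (B ** A) mod m = det (mat 1 :: int^'n^'n) mod m" by (rule det_mod_cong)
  with \<open>det A = 0\<close> assms(1) show False by (simp add: det_mul)
qed

lemma det_of_int_matrix: "det (\<chi> i j. real_of_int (A $ i $ j)) = real_of_int (det A)"
  by (simp add: det_def)

lemma affine_fun_mean:
  assumes "affine_fun l" "length xs = 5"
  shows "l ((1/5) *\<^sub>R sum_list xs) = (1/5) * sum_list (map l xs)"
proof -
  obtain n m where l: "\<And>x. l x = n \<bullet> x + m" using assms(1) by (auto simp: affine_fun_def)
  have "sum_list (map l xs) = n \<bullet> sum_list xs + real (length xs) * m" for xs
    by (induction xs) (simp_all add: l inner_add_right algebra_simps)
  then show ?thesis using assms(2) by (simp add: l)
qed

lemma point_coords_nth: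
  assumes "c \<in> {1, 2, 3}" shows "point_coords e ! (c - 1) = point_coord e c"
proof -
  consider "c = 1" | "c = 2" | "c = 3" using assms by blast
  then show ?thesis by cases (simp_all add: point_coords_def numeral_eq_Suc One_nat_def)
qed

definition colloc_mat :: "nat \<Rightarrow> nat \<Rightarrow> int" where
  "colloc_mat i j = colloc_entry (point_coords (basis_index ! i)) (basis_index ! j)"

lemma colloc_mat_inverse:
  assumes "i < 39" "j < 39"
  shows "(\<Sum>k<39. colloc_inv_mod7 ! i ! k * colloc_mat k j) mod 7 = (if i = j then 1 else 0)"
proof -
  have len: "length basis_index = 39" using basis_index_wf by blast
  have lenI: "length (colloc_inv_mod7 ! i) = 39" using length_colloc_inv assms(1) by simp
  have col: "colloc_cols_mod7 ! j = map (\<lambda>X. colloc_entry X (basis_index ! j) mod 7) (map point_coords basis_index)"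
    unfolding colloc_cols_mod7[symmetric] using assms(2) len by simp
  have lenC: "length colloc_cols_mod7 = 39" unfolding colloc_cols_mod7[symmetric] using len by simp
  have "sum_list (map2 (*) (colloc_inv_mod7 ! i) (colloc_cols_mod7 ! j)) mod 7 =
    (map (\<lambda>r. map (\<lambda>c. sum_list (map2 (*) r c) mod 7) colloc_cols_mod7) colloc_inv_mod7) ! i ! j"
    using assms lenC length_colloc_inv(1) by simp
  also have "\<dots> = (if i = j then 1 else 0)"
    unfolding colloc_inv_mod7 using assms by simp
  also have "sum_list (map2 (*) (colloc_inv_mod7 ! i) (colloc_cols_mod7 ! j)) =
    (\<Sum>k<39. colloc_inv_mod7 ! i ! k * (colloc_mat k j mod 7))"
    by (simp add: sum_list_sum_nth lenI col len colloc_mat_def atLeast0LessThan)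
  also have "\<dots> mod 7 = (\<Sum>k<39. colloc_inv_mod7 ! i ! k * colloc_mat k j) mod 7"
    by (subst (1 2) mod_sum_eq[symmetric]) (simp add: mod_mult_right_eq)
  finally show ?thesis .
qed

lemma colloc_det:
  fixes r :: "'n::finite \<Rightarrow> nat"
  assumes r: "bij_betw r UNIV {..<39}"
  shows "det (\<chi> i j. colloc_mat (r i) (r j) :: int^'n^'n) \<noteq> 0"
proof (rule det_nonzero_mod[where m = 7])
  let ?B = "\<chi> i j. colloc_inv_mod7 ! r i ! r j :: int^'n^'n"
  have lt: "r i < 39" for i using bij_betwE[OF r] by auto
  have inj: "r i = r j \<longleftrightarrow> i = j" for i j using bij_betw_imp_inj_on[OF r] by (auto dest: injD)
  fix i j :: 'n
  have "(?B ** (\<chi> i j. colloc_mat (r i) (r j))) $ i $ j = (\<Sum>k\<in>UNIV. colloc_inv_mod7 ! r i ! r k * colloc_mat (r k) (r j))"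
    by (simp add: matrix_matrix_mult_def)
  also have "\<dots> = (\<Sum>k<39. colloc_inv_mod7 ! r i ! k * colloc_mat k (r j))"
    using r by (rule sum.reindex_bij_betw)
  finally show "(?B ** (\<chi> i j. colloc_mat (r i) (r j))) $ i $ j mod 7 = (if i = j then 1 else 0)"
    using colloc_mat_inverse[OF lt lt, of i j] by (simp add: inj)
qed simp

context triangle
begin

lemma label_perms_perm3:
  assumes "q \<in> set label_perms" shows "perm3 (q ! 0) (q ! 1) (q ! 2)"
proof -
  have "list_all (\<lambda>q. List.member [(1,2,3),(1,3,2),(2,1,3),(2,3,1),(3,1,2),(3,2,1)] (q ! 0, q ! 1, q ! 2)) label_perms"
    by code_simp
  then have "(q ! 0, q ! 1, q ! 2) \<in> set [(1,2,3),(1,3,2),(2,1,3),(2,3,1),(3,1,2),(3,2,1)]"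
    using assms unfolding list_all_iff List.member_iff by (rule bspec)
  then show ?thesis unfolding perm3_def by (simp only: list.set)
qed

lemma bary_ps_point:
  assumes "i \<in> {1, 2, 3, 4, 5, 6, 10}" "c \<in> {1, 2, 3}"
  shows "b c (ps_point v i) = real_of_int (label_coord c i) / 6"
proof -
  have centre: "b c ((1/3) *\<^sub>R (v 1 + v 2 + v 3)) = 1/3"
    if "c \<in> {1, 2, 3}" for c :: nat
    using bary_combination[of "1/3" "1/3" "1/3"] that by (auto simp: scaleR_add_right)
  have "i = 1 \<or> i = 2 \<or> i = 3 \<or> i = 4 \<or> i = 5 \<or> i = 6 \<or> i = 10" "c = 1 \<or> c = 2 \<or> c = 3" using assms by auto
  then show ?thesis
    by (elim disjE; simp add: ps_point_def label_coord_def bary_midpoint centre)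
qed

lemma relabel_label:
  assumes "q \<in> set label_perms" "i \<in> {1, 2, 3, 4, 5, 6, 10}"
  shows "relabel q i \<in> {1, 2, 3, 4, 5, 6, 10}"
proof -
  have "list_all (\<lambda>q. list_all (\<lambda>i. List.member [1, 2, 3, 4, 5, 6, 10] (relabel q i)) [1, 2, 3, 4, 5, 6, 10]) label_perms"
    by code_simp
  then have "\<forall>q\<in>set label_perms. \<forall>i\<in>{1, 2, 3, 4, 5, 6, 10}. relabel q i \<in> {1, 2, 3, 4, 5, 6, 10}"
    by (simp only: list_all_iff List.member_iff list.set)
  from bspec[OF bspec[OF this assms(1)] assms(2)] show ?thesis .
qed

lemma bary_domain_point:
  assumes q: "q \<in> set label_perms" and g: "g < 8" and c: "c \<in> {1, 2, 3}"
  shows "b c (domain_point (snd (labels_spline v (relabel_gen q (label_gens ! g))))) = (1/30) * real_of_int (point_coord (q, g) c)"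
proof -
  obtain n m d where gen: "label_gens ! g = (n, m, d)" by (cases "label_gens ! g") auto
  have mem: "(n, m, d) \<in> set label_gens" using g gen by (metis nth_mem label_gens_length)
  then have d: "length d = 5" "set d \<subseteq> {1, 2, 3, 4, 5, 6, 10}"
    using label_gens_wf label_gens_duals by auto
  have "snd (labels_spline v (relabel_gen q (label_gens ! g))) = mset (map (ps_point v) (map (relabel q) d))"
    by (simp add: gen labels_spline_def relabel_gen_def multiset.map_comp)
  then have "domain_point (snd (labels_spline v (relabel_gen q (label_gens ! g)))) = (1/5) *\<^sub>R sum_list (map (ps_point v) (map (relabel q) d))"
    by (simp only: domain_point_def sum_mset_sum_list)
  then have "b c (domain_point (snd (labels_spline v (relabel_gen q (label_gens ! g))))) =
    (1/5) * sum_list (map (b c) (map (ps_point v) (map (relabel q) d)))"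
    using affine_fun_mean[OF affine_fun_bary, of "map (ps_point v) (map (relabel q) d)" c] d(1) by simp
  also have "map (b c) (map (ps_point v) (map (relabel q) d)) = map (\<lambda>i. real_of_int (label_coord c (relabel q i)) / 6) d"
    using d(2) relabel_label[OF q] bary_ps_point[OF _ c] by auto
  also have "sum_list (map (\<lambda>i. real_of_int (label_coord c (relabel q i)) / 6) d) = real_of_int (point_coord (q, g) c) / 6"
  proof -
    have "sum_list (map (\<lambda>i. real_of_int (f i) / 6) d) = real_of_int (sum_list (map f d)) / 6" for f
      by (induction d) (simp_all add: add_divide_distrib)
    then show ?thesis by (simp add: point_coord_def gen)
  qed
  finally show ?thesis by simp
qed

lemma triangle_permuted:
  assumes "p permutes {1, 2, 3}" shows "triangle (v \<circ> p)"
proof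
  have "{(v \<circ> p) 1, (v \<circ> p) 2, (v \<circ> p) 3} = v ` p ` {1,2,3}" by simp
  also have "\<dots> = {v 1, v 2, v 3}" unfolding permutes_image[OF assms] by simp
  finally show "\<not> collinear {(v \<circ> p) 1, (v \<circ> p) 2, (v \<circ> p) 3}"
    using noncollinear by (simp only: not_False_eq_True)
qed

text \<open>Relabelling the triangle only permutes the barycentric coordinates, so the eight generators
  determine all 39 functions.\<close>

lemma bary_permuted:
  assumes p: "p permutes {1, 2, 3}" and j: "j \<in> {1, 2, 3}"
  shows "bary (v \<circ> p) j x = b (p j) x"
proof -
  have "[p 1, p 2, p 3] \<in> set label_perms" using perm_labels p by blast
  from label_perms_perm3[OF this] have perm: "perm3 (p 1) (p 2) (p 3)" by (simp add: numeral_2_eq_2 One_nat_def)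
  interpret P: triangle "v \<circ> p" by (rule triangle_permuted[OF p])
  show ?thesis
    using P.bary_combination[OF perm3_sum[OF perm, of x]] perm3_comb[OF perm, of x] j by auto
qed

lemma basis_spline:
  assumes q: "q \<in> set label_perms" and g: "g < 8"
  shows "\<exists>\<kappa>>0. fst (labels_spline v (relabel_gen q (label_gens ! g))) =
    (\<lambda>x\<in>T. \<kappa> * profile g (b (q ! 0) x) (b (q ! 1) x) (b (q ! 2) x))"
proof -
  obtain p where p: "p permutes {1, 2, 3}" and qp: "q = [p 1, p 2, p 3]"
    using q unfolding perm_labels[symmetric] by blast
  obtain n m d where gen: "label_gens ! g = (n, m, d)" by (cases "label_gens ! g") auto
  have mem: "(n, m, d) \<in> set label_gens" using g gen by (metis nth_mem label_gens_length)
  then have n: "0 < n" using label_gens_wf by auto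
  interpret P: triangle "v \<circ> p" by (rule triangle_permuted[OF p])
  obtain \<kappa> where \<kappa>: "\<kappa> > 0" "\<forall>x\<in>T. simplex_spline (v \<circ> p) m x = \<kappa> * profile g (b (p 1) x) (b (p 2) x) (b (p 3) x)"
    using P.spline_profile[OF g] by (auto simp: gen triangle_permute[OF p] bary_permuted[OF p])
  have "fst (labels_spline v (relabel_gen q (label_gens ! g))) = (\<lambda>x\<in>T. real n / 4 * simplex_spline (v \<circ> p) m x)"
    using labels_spline_relabel[OF mem p, of v] by (simp add: gen qp)
  also have "\<dots> = (\<lambda>x\<in>T. real n / 4 * \<kappa> * profile g (b (q ! 0) x) (b (q ! 1) x) (b (q ! 2) x))"
    using \<kappa>(2) by (auto simp: qp restrict_def fun_eq_iff numeral_2_eq_2 One_nat_def)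
  finally show ?thesis using n \<kappa>(1) by (intro exI[of _ "real n / 4 * \<kappa>"]) simp
qed

text \<open>The collocation matrix is the integer matrix with columns scaled by positive factors. Writing the
  basis functions in terms of the spanning functions \<open>feature\<close> factors it as a product of square matrices whose
  left factor holds the values of the spanning functions; uniqueness follows from the nonsingularity of that factor.\<close>

theorem collocation_unisolvent:
  fixes S :: "39 \<Rightarrow> real^2 \<Rightarrow> real" and D :: "39 \<Rightarrow> (real^2) multiset"
  assumes bij: "bij_betw (\<lambda>j. (S j, D j)) UNIV (spline_basis v)"
  shows "invertible ((\<chi> i j. S j (domain_point (D i))) :: real^39^39) \<and>
    (\<forall>y :: 39 \<Rightarrow> real. \<exists>!s. s \<in> spline_space v \<and> (\<forall>i. s (domain_point (D i)) = y i))"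
proof -
  define M where "M = ((\<chi> i j. S j (domain_point (D i))) :: real^39^39)"
  define \<xi> where "\<xi> i = domain_point (D i)" for i
  define e where "e i = labels_spline v (case basis_index ! i of (q, g) \<Rightarrow> relabel_gen q (label_gens ! g))" for i
  have len: "length basis_index = 39" using basis_index_wf by blast
  have wf: "fst (basis_index ! i) \<in> set label_perms" "snd (basis_index ! i) < 8" if "i < 39" for i
    using basis_index_wf nth_mem[of i basis_index] that len by (auto simp: split_beta)
  have "spline_basis v = labels_spline v ` set (map (\<lambda>(q, g). relabel_gen q (label_gens ! g)) basis_index)"
    unfolding basis_index_labels by (rule spline_basis_labels)
  also have "\<dots> = e ` {..<39}"
  proof -
    have "set basis_index = (!) basis_index ` {..<39}" by (auto simp: set_conv_nth len)
    then show ?thesis by (simp add: image_image e_def)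
  qed
  finally have basis: "spline_basis v = e ` {..<39}" .
  have "\<exists>i. i < 39 \<and> e i = (S j, D j)" for j
  proof -
    have "(S j, D j) \<in> e ` {..<39}" using bij_betwE[OF bij] unfolding basis by blast
    then obtain i where "(S j, D j) = e i" "i \<in> {..<39}" by (rule imageE)
    then show ?thesis by auto
  qed
  then obtain r where r: "\<And>j. r j < 39" "\<And>j. e (r j) = (S j, D j)" by metis
  have "inj r"
    using bij_betw_imp_inj_on[OF bij] r(2) by (intro injI) (metis injD)
  moreover have "r ` UNIV \<subseteq> {..<39}" using r(1) by auto
  ultimately have bij_r: "bij_betw r UNIV {..<39}"
    unfolding bij_betw_def by (intro conjI card_subset_eq) (simp_all add: card_image)
  define Q where "Q j = fst (basis_index ! r j)" for j
  define G where "G j = snd (basis_index ! r j)" for j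
  have QG: "Q j \<in> set label_perms" "G j < 8" "basis_index ! r j = (Q j, G j)" for j
    using wf[OF r(1)] by (simp_all add: Q_def G_def)
  have SD: "(S j, D j) = labels_spline v (relabel_gen (Q j) (label_gens ! G j))" for j
    using r(2)[of j] by (simp add: e_def QG(3))
  have "\<forall>j. \<exists>\<kappa>>0. S j = (\<lambda>x\<in>T. \<kappa> * profile (G j) (b (Q j ! 0) x) (b (Q j ! 1) x) (b (Q j ! 2) x))"
  proof
    fix j
    have "S j = fst (labels_spline v (relabel_gen (Q j) (label_gens ! G j)))" using SD[of j] by (metis fst_conv)
    then show "\<exists>\<kappa>>0. S j = (\<lambda>x\<in>T. \<kappa> * profile (G j) (b (Q j ! 0) x) (b (Q j ! 1) x) (b (Q j ! 2) x))"
      using basis_spline[OF QG(1,2)] by simp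
  qed
  then obtain \<kappa> where \<kappa>: "\<And>j. 0 < \<kappa> j"
    and S: "\<And>j. S j = (\<lambda>x\<in>T. \<kappa> j * profile (G j) (b (Q j ! 0) x) (b (Q j ! 1) x) (b (Q j ! 2) x))" by metis
  have \<xi>: "b c (\<xi> i) = (1/30) * real_of_int (point_coord (Q i, G i) c)" if "c \<in> {1, 2, 3}" for c i
  proof -
    have "D i = snd (labels_spline v (relabel_gen (Q i) (label_gens ! G i)))" using SD[of i] by (metis snd_conv)
    then show ?thesis using bary_domain_point[OF QG(1,2) that] by (simp add: \<xi>_def)
  qed
  have coord_nonneg: "0 \<le> point_coord e c" for e c
    unfolding point_coord_def by (intro sum_list_nonneg) (auto simp: label_coord_def)
  have \<xi>T: "\<xi> i \<in> T" for i
  proof -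
    have "0 \<le> b c (\<xi> i)" if "c \<in> {1, 2, 3}" for c unfolding \<xi>[OF that] using coord_nonneg by simp
    then show ?thesis unfolding triangle_bary by blast
  qed
  have entry: "M $ i $ j = real_of_int (colloc_mat (r i) (r j)) * (\<kappa> j * (1/30) ^ 5)" for i j
  proof -
    have coords: "b c (\<xi> i) = (1/30) * real_of_int (point_coords (Q i, G i) ! (c - 1))" if "c \<in> {1, 2, 3}" for c
      unfolding point_coords_nth[OF that] by (rule \<xi>[OF that])
    have q: "Q j ! 0 \<in> {1, 2, 3}" "Q j ! 1 \<in> {1, 2, 3}" "Q j ! 2 \<in> {1, 2, 3}"
      using label_perms_perm3[OF QG(1)[of j]] by (auto elim!: perm3_cases)
    have "M $ i $ j = \<kappa> j * profile (G j) (b (Q j ! 0) (\<xi> i)) (b (Q j ! 1) (\<xi> i)) (b (Q j ! 2) (\<xi> i))"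
      unfolding M_def by (simp add: \<xi>_def[symmetric] S \<xi>T)
    also have "\<dots> = \<kappa> j * ((1/30) ^ 5 * real_of_int (colloc_mat (r i) (r j)))"
      unfolding coords[OF q(1)] coords[OF q(2)] coords[OF q(3)] colloc_mat_def colloc_entry_def QG(3)
      by (subst profile_scale, simp) (simp only: profile_of_int fst_conv snd_conv)
    finally show ?thesis by simp
  qed
  define Z where "Z = ((\<chi> i j. colloc_mat (r i) (r j)) :: int^39^39)"
  \<comment> \<open>the unknown normalisation factors form a diagonal matrix\<close>
  define K where "K = ((\<chi> i j. if i = j then \<kappa> j * (1/30) ^ 5 else 0) :: real^39^39)"
  have "M = (\<chi> i j. real_of_int (Z $ i $ j)) ** K"
    by (simp add: vec_eq_iff matrix_matrix_mult_def K_def Z_def entry if_distrib[of "\<lambda>u. _ * u"] cong: if_cong)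
  moreover have "det K \<noteq> 0"
  proof -
    have "det K = (\<Prod>i\<in>UNIV. K $ i $ i)" by (rule det_diagonal) (simp add: K_def)
    also have "\<dots> \<noteq> 0" using \<kappa> by (simp add: K_def less_imp_neq[symmetric])
    finally show ?thesis .
  qed
  moreover have "det Z \<noteq> 0" unfolding Z_def by (rule colloc_det[OF bij_r])
  ultimately have detM: "det M \<noteq> 0" by (simp add: det_mul det_of_int_matrix)
  then have inv: "invertible M" by (simp add: invertible_det_nz)
  have SV: "truncated_span (S j)" for j
  proof -
    have "truncated_span (\<lambda>x. \<kappa> j * profile (G j) (b (Q j ! 0) x) (b (Q j ! 1) x) (b (Q j ! 2) x))"
      by (intro truncated_span_cmult truncated_span_profile label_perms_perm3 QG(1))
    then show ?thesis by (rule truncated_span_cong) (simp add: S)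
  qed
  have "\<exists>!s. s \<in> spline_space v \<and> (\<forall>i. s (\<xi> i) = y i)" for y
  proof (rule ex_ex1I)
    obtain M' where M': "M ** M' = mat 1" using inv by (auto simp: invertible_def)
    define c where "c = M' *v (\<chi> i. y i)"
    have Mc: "M *v c = (\<chi> i. y i)" by (simp add: c_def matrix_vector_mul_assoc M')
    define s where "s = restrict (\<lambda>x. \<Sum>j\<in>UNIV. c $ j * S j x) T"
    have "s \<in> spline_space v" unfolding s_def by (intro truncated_span_spline truncated_span_sum truncated_span_cmult SV) simp
    moreover have "s (\<xi> i) = y i" for i
    proof -
      have "s (\<xi> i) = (M *v c) $ i"
        by (simp add: s_def matrix_vector_mult_def M_def \<xi>_def \<xi>T[unfolded \<xi>_def] mult.commute)
      then show ?thesis by (simp add: Mc)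
    qed
    ultimately show "\<exists>s. s \<in> spline_space v \<and> (\<forall>i. s (\<xi> i) = y i)" by blast
  next
    fix s s' assume s: "s \<in> spline_space v \<and> (\<forall>i. s (\<xi> i) = y i)" and s': "s' \<in> spline_space v \<and> (\<forall>i. s' (\<xi> i) = y i)"
    obtain h :: "39 \<Rightarrow> (nat \<times> nat) + (nat \<times> nat)" where h: "bij_betw h UNIV feature_index"
      using finite_same_card_bij[of "UNIV :: 39 set" feature_index] finite_feature_index card_feature_index by auto
    have expand: "\<exists>d. \<forall>x\<in>T. f x = (\<Sum>k\<in>UNIV. d k * feature (h k) x)" if V: "truncated_span f" for f
    proof -
      obtain d where "\<forall>x\<in>T. f x = (\<Sum>e\<in>feature_index. d e * feature e x)" using V unfolding truncated_span_def by blast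
      moreover have "(\<Sum>k\<in>UNIV. d (h k) * feature (h k) x) = (\<Sum>e\<in>feature_index. d e * feature e x)" for x
        using h by (rule sum.reindex_bij_betw)
      ultimately have "\<forall>x\<in>T. f x = (\<Sum>k\<in>UNIV. d (h k) * feature (h k) x)" by simp
      then show ?thesis by (intro exI[of _ "\<lambda>k. d (h k)"])
    qed
    have "\<forall>j. \<exists>d. \<forall>x\<in>T. S j x = (\<Sum>k\<in>UNIV. d k * feature (h k) x)" using expand[OF SV] by (rule allI)
    from choice[OF this] obtain C where C: "\<forall>j. \<forall>x\<in>T. S j x = (\<Sum>k\<in>UNIV. C j k * feature (h k) x)" ..
    define F where "F = ((\<chi> i k. feature (h k) (\<xi> i)) :: real^39^39)"
    have "S j (\<xi> i) = (\<Sum>k\<in>UNIV. feature (h k) (\<xi> i) * C j k)" for i j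
      using C \<xi>T[of i] by (simp add: mult.commute)
    then have "M = F ** (\<chi> k j. C j k)"
      by (simp add: vec_eq_iff M_def F_def matrix_matrix_mult_def \<xi>_def)
    with detM have "det F \<noteq> 0" by (auto simp: det_mul)
    then have "invertible F" by (simp add: invertible_det_nz)
    then obtain F' where F': "F' ** F = mat 1" unfolding invertible_def by blast
    have "truncated_span s" "truncated_span s'" using s s' spline_imp_truncated_span by simp_all
    from expand[OF this(1)] expand[OF this(2)] obtain d d'
      where d: "\<forall>x\<in>T. s x = (\<Sum>k\<in>UNIV. d k * feature (h k) x)" "\<forall>x\<in>T. s' x = (\<Sum>k\<in>UNIV. d' k * feature (h k) x)"
      by (elim exE)
    define w where "w = ((\<chi> k. d k - d' k) :: real^39)"
    have "F *v w = 0"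
    proof -
      have "(F *v w) $ i = s (\<xi> i) - s' (\<xi> i)" for i
        using d \<xi>T[of i] by (simp add: matrix_vector_mult_def F_def w_def right_diff_distrib sum_subtractf mult.commute[of _ "feature _ _"])
      then show ?thesis using s s' by (simp add: vec_eq_iff)
    qed
    then have "(F' ** F) *v w = 0" by (simp add: matrix_vector_mul_assoc[symmetric])
    then have "w = 0" by (simp add: F')
    then have "d k = d' k" for k by (simp add: w_def vec_eq_iff)
    then have "s x = s' x" if "x \<in> T" for x using d that by simp
    moreover have "s \<in> extensional T" "s' \<in> extensional T" using s s' by (simp_all add: spline_space_def)
    ultimately show "s = s'" by (intro extensionalityI[of s T s']) auto
  qed
  then show ?thesis using inv unfolding M_def \<xi>_def by blast
qed

end

theorem mainTheorem4:
  fixes v :: "nat \<Rightarrow> real^2"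
    and S :: "39 \<Rightarrow> real^2 \<Rightarrow> real" and D :: "39 \<Rightarrow> (real^2) multiset"
  assumes "\<not> collinear {v 1, v 2, v 3}"
    and "bij_betw (\<lambda>j. (S j, D j)) UNIV (spline_basis v)"
  shows "invertible ((\<chi> i j. S j (domain_point (D i))) :: real^39^39) \<and>
    (\<forall>y :: 39 \<Rightarrow> real. \<exists>!s. s \<in> spline_space v \<and> (\<forall>i. s (domain_point (D i)) = y i))"
proof -
  interpret triangle v by (rule triangle.intro) (rule assms(1))
  show ?thesis by (rule collocation_unisolvent[OF assms(2)])
qed

end
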